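(* For unital $C^*$-algebras $A$ and $B$, $$U_1(A\otimes^\gamma B)=U(A)\otimes U(B).$$
   Context: For Banach spaces $X, Y$, $X\otimes^\gamma Y$ denotes the Banach space projective tensor product, i.e. the completion of the algebraic tensor product $X\otimes Y$ in the norm $\|u\| = \inf\{\sum_{i=1}^n \|x_i\|\|y_i\| : u=\sum_{i=1}^n x_i\otimes y_i\}$. For $C^*$-algebras $A,B$, $A\otimes^\gamma B$ is a Banach $*$-algebra with $(a\otimes b)(c\otimes d)=ac\otimes bd$ and $(a\otimes b)^*=a^*\otimes b^*$. For a unital $C^*$-algebra $A$, $U(A)=\{u\in A: uu^*=u^*u=1\}$ is its unitary group (equivalently, the set of invertible $u$ with $\|u\|=\|u^{-1}\|=1$). The set of norm-one unitaries of $A\otimes^\gamma B$ is $U_1(A\otimes^\gamma B)=\{u\in A\otimes^\gamma B: u^*u=uu^*=1 \text{ and } \|u\|=1\}$, and $U(A)\otimes U(B):=\{a\otimes b: a\in U(A),\ b\in U(B)\}$. *)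

theory Defs
  imports "HOL-Analysis.Analysis"
begin

section \<open>Complex normed spaces and C*-algebras\<close>

class scaleC =
  fixes scaleC :: "complex \<Rightarrow> 'a \<Rightarrow> 'a"  (infixr \<open>*\<^sub>C\<close> 75)

class complex_vector = real_vector + scaleC +
  assumes scaleC_add_right: "c *\<^sub>C (x + y) = c *\<^sub>C x + c *\<^sub>C y"
    and scaleC_add_left: "(c + d) *\<^sub>C x = c *\<^sub>C x + d *\<^sub>C x"
    and scaleC_scaleC: "c *\<^sub>C d *\<^sub>C x = (c * d) *\<^sub>C x"
    and scaleC_one: "1 *\<^sub>C x = x"
    and scaleR_scaleC: "r *\<^sub>R x = complex_of_real r *\<^sub>C x"
begin

lemma scaleC_zero_right [simp]: "c *\<^sub>C 0 = 0"
  using scaleC_add_right [of c 0 0] by simp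

lemma scaleC_zero_left [simp]: "0 *\<^sub>C x = 0"
  using scaleC_add_left [of 0 0 x] by simp

end

class complex_normed_vector = complex_vector + real_normed_vector +
  assumes norm_scaleC: "norm (c *\<^sub>C x) = cmod c * norm x"

class complex_normed_algebra = complex_normed_vector + real_normed_algebra +
  assumes mult_scaleC_left: "(c *\<^sub>C x) * y = c *\<^sub>C (x * y)"
    and mult_scaleC_right: "x * (c *\<^sub>C y) = c *\<^sub>C (x * y)"

class star =
  fixes star :: "'a \<Rightarrow> 'a"

class involutive_algebra = complex_normed_algebra + star +
  assumes star_add: "star (x + y) = star x + star y"
    and star_scaleC: "star (c *\<^sub>C x) = cnj c *\<^sub>C star x"
    and star_mult: "star (x * y) = star y * star x"
    and star_star: "star (star x) = x"

class banach_star_algebra = involutive_algebra + banach +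
  assumes norm_star: "norm (star x) = norm x"

text \<open>Through \<^class>\<open>real_normed_algebra_1\<close> the unit is different from zero, so the zero
  algebra is excluded; it has no element of norm one.\<close>

class unital_cstar_algebra = involutive_algebra + banach + real_normed_algebra_1 +
  assumes cstar_identity: "norm (star x * x) = (norm x)\<^sup>2"

subclass (in unital_cstar_algebra) banach_star_algebra
proof
  have le: "norm y \<le> norm (star y)" for y
  proof (cases "y = 0")
    case False
    have "norm y * norm y \<le> norm (star y) * norm y"
      using cstar_identity [of y] norm_mult_ineq [of "star y" y] by (simp add: monoid_mult_class.power2_eq_square)
    then show ?thesis using False by simp
  qed simp
  show "norm (star x) = norm x" for x
    using le [of x] le [of "star x"] by (simp add: star_star)
qed

instantiation complex :: unital_cstar_algebra
begin

definition scaleC_complex :: "complex \<Rightarrow> complex \<Rightarrow> complex"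
  where "scaleC_complex c x = c * x"

definition star_complex :: "complex \<Rightarrow> complex"
  where "star_complex = cnj"

instance
  by standard
    (auto simp: scaleC_complex_def star_complex_def algebra_simps norm_mult scaleR_conv_of_real
      power2_eq_square)

end


section \<open>The algebraic tensor product\<close>

text \<open>The tensor product over the complex numbers is the free commutative monoid on
  \<open>X \<times> Y\<close> (finite multisets, i.e. formal sums of elementary tensors) modulo the congruence
  generated by biadditivity and \<open>(c x, y) \<sim> (x, c y)\<close>. The rule for \<open>(0, y)\<close> makes
  \<open>(- x, y)\<close> an additive inverse of \<open>(x, y)\<close>, so the quotient is a group. Scalar
  multiplication is defined below on the quotient.\<close>

inductive tensor_cong ::
  "('a::complex_vector \<times> 'b::complex_vector) multiset \<Rightarrow> ('a \<times> 'b) multiset \<Rightarrow> bool"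
where
  cong_refl: "tensor_cong M M"
| cong_sym: "tensor_cong M N \<Longrightarrow> tensor_cong N M"
| cong_trans: "tensor_cong M N \<Longrightarrow> tensor_cong N K \<Longrightarrow> tensor_cong M K"
| cong_plus: "tensor_cong M N \<Longrightarrow> tensor_cong (M + K) (N + K)"
| cong_add_left: "tensor_cong {#(x + x', y)#} {#(x, y), (x', y)#}"
| cong_add_right: "tensor_cong {#(x, y + y')#} {#(x, y), (x, y')#}"
| cong_scale: "tensor_cong {#(c *\<^sub>C x, y)#} {#(x, c *\<^sub>C y)#}"
| cong_zero: "tensor_cong {#(0, y)#} {#}"

quotient_type (overloaded) ('a, 'b) alg_tensor_product =
    "('a::complex_vector \<times> 'b::complex_vector) multiset" / tensor_cong
  by (rule equivpI)
    (auto intro: reflpI sympI transpI tensor_cong.cong_refl tensor_cong.cong_sym tensor_cong.cong_trans)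

instantiation alg_tensor_product :: (complex_vector, complex_vector) comm_monoid_add
begin

lift_definition zero_alg_tensor_product :: "('a, 'b) alg_tensor_product" is "{#}" .

lift_definition plus_alg_tensor_product ::
  "('a, 'b) alg_tensor_product \<Rightarrow> ('a, 'b) alg_tensor_product \<Rightarrow> ('a, 'b) alg_tensor_product"
  is "(+)"
  by (metis add.commute tensor_cong.cong_plus tensor_cong.cong_trans)

instance
  by (standard; transfer) (simp_all add: ac_simps tensor_cong.cong_refl)

end

lift_definition alg_tensor ::
  "'a::complex_vector \<Rightarrow> 'b::complex_vector \<Rightarrow> ('a, 'b) alg_tensor_product"
  is "\<lambda>x y. {#(x, y)#}" .

lemma alg_tensor_add_left: "alg_tensor (x + x') y = alg_tensor x y + alg_tensor x' y"
  by transfer (use tensor_cong.cong_add_left in \<open>simp add: add_mset_commute\<close>)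

lemma alg_tensor_add_right: "alg_tensor x (y + y') = alg_tensor x y + alg_tensor x y'"
  by transfer (use tensor_cong.cong_add_right in \<open>simp add: add_mset_commute\<close>)

lemma alg_tensor_scale: "alg_tensor (c *\<^sub>C x) y = alg_tensor x (c *\<^sub>C y)"
  by transfer (rule tensor_cong.cong_scale)

lemma alg_tensor_zero_left [simp]: "alg_tensor 0 y = 0"
  by transfer (rule tensor_cong.cong_zero)

lemma alg_tensor_zero_right [simp]: "alg_tensor x 0 = 0"
  using alg_tensor_scale [of 0 x 0] by simp

lemma alg_tensor_induct [case_names zero add]:
  assumes "P 0" and "\<And>x y u. P u \<Longrightarrow> P (alg_tensor x y + u)"
  shows "P u"
proof -
  have "P (abs_alg_tensor_product M)" for M
  proof (induction M)
    case empty
    then show ?case using assms(1) by (simp add: zero_alg_tensor_product_def)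
  next
    case (add p M)
    have "abs_alg_tensor_product (add_mset p M) =
        alg_tensor (fst p) (snd p) + abs_alg_tensor_product M"
      by (simp add: alg_tensor.abs_eq plus_alg_tensor_product.abs_eq)
    then show ?case using assms(2) [OF add] by simp
  qed
  then show ?thesis by (metis Quotient_alg_tensor_product Quotient_abs_rep)
qed

lemma alg_tensor_representation: "\<exists>M. u = (\<Sum>(x, y)\<in>#M. alg_tensor x y)"
proof (induction u rule: alg_tensor_induct)
  case zero
  then show ?case by (intro exI [of _ "{#}"]) simp
next
  case (add x y u)
  then obtain M where "u = (\<Sum>(x, y)\<in>#M. alg_tensor x y)" by blast
  then show ?case by (intro exI [of _ "add_mset (x, y) M"]) simp
qed

definition balanced :: "('a::complex_vector \<Rightarrow> 'b::complex_vector \<Rightarrow> 'c::comm_monoid_add) \<Rightarrow> bool"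
  where "balanced f \<longleftrightarrow>
    (\<forall>x x' y. f (x + x') y = f x y + f x' y) \<and> (\<forall>x y y'. f x (y + y') = f x y + f x y') \<and>
    (\<forall>c x y. f (c *\<^sub>C x) y = f x (c *\<^sub>C y)) \<and> (\<forall>y. f 0 y = 0)"

text \<open>The additive map on the tensor product induced by a balanced map (universal property).\<close>

lift_definition tensor_extend ::
  "('a::complex_vector \<Rightarrow> 'b::complex_vector \<Rightarrow> 'c::comm_monoid_add) \<Rightarrow>
    ('a, 'b) alg_tensor_product \<Rightarrow> 'c"
  is "\<lambda>f M. if balanced f then \<Sum>(x, y)\<in>#M. f x y else 0"
  subgoal for f M N
    by (induction rule: tensor_cong.induct)
      (auto simp: balanced_def split: if_splits)
  done

lemma tensor_extend_add: "tensor_extend f (u + v) = tensor_extend f u + tensor_extend f v"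
  by transfer simp

lemma tensor_extend_zero [simp]: "tensor_extend f 0 = 0"
  by transfer simp

lemma tensor_extend_alg_tensor:
  "balanced f \<Longrightarrow> tensor_extend f (alg_tensor x y) = f x y"
  by transfer simp

lemma balanced_scale_left:
  "balanced (\<lambda>x y. alg_tensor (c *\<^sub>C x) y)"
  by (auto simp: balanced_def alg_tensor_add_left alg_tensor_add_right alg_tensor_scale
      scaleC_add_right scaleC_scaleC mult.commute)

instantiation alg_tensor_product :: (complex_vector, complex_vector) complex_vector
begin

definition scaleC_alg_tensor_product ::
  "complex \<Rightarrow> ('a, 'b) alg_tensor_product \<Rightarrow> ('a, 'b) alg_tensor_product"
  where "c *\<^sub>C u = tensor_extend (\<lambda>x y. alg_tensor (c *\<^sub>C x) y) u"

definition scaleR_alg_tensor_product ::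
  "real \<Rightarrow> ('a, 'b) alg_tensor_product \<Rightarrow> ('a, 'b) alg_tensor_product"
  where "r *\<^sub>R u = complex_of_real r *\<^sub>C u" for u :: "('a, 'b) alg_tensor_product"

definition uminus_alg_tensor_product ::
  "('a, 'b) alg_tensor_product \<Rightarrow> ('a, 'b) alg_tensor_product"
  where "- u = (- 1) *\<^sub>C u" for u :: "('a, 'b) alg_tensor_product"

definition minus_alg_tensor_product ::
  "('a, 'b) alg_tensor_product \<Rightarrow> ('a, 'b) alg_tensor_product \<Rightarrow> ('a, 'b) alg_tensor_product"
  where "u - v = u + - v" for u v :: "('a, 'b) alg_tensor_product"

instance
proof
  fix u v :: "('a, 'b) alg_tensor_product" and c d :: complex and r s :: real
  have e: "c *\<^sub>C alg_tensor x y = alg_tensor (c *\<^sub>C x) y" for c and x :: 'a and y :: 'b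
    by (simp add: scaleC_alg_tensor_product_def tensor_extend_alg_tensor balanced_scale_left)
  have z: "c *\<^sub>C (0 :: ('a, 'b) alg_tensor_product) = 0" for c
    by (simp add: scaleC_alg_tensor_product_def)
  have ar: "c *\<^sub>C (u + v) = c *\<^sub>C u + c *\<^sub>C v" for c and u v :: "('a, 'b) alg_tensor_product"
    by (simp add: scaleC_alg_tensor_product_def tensor_extend_add)
  have al: "(c + d) *\<^sub>C u = c *\<^sub>C u + d *\<^sub>C u" for c d and u :: "('a, 'b) alg_tensor_product"
    by (induction u rule: alg_tensor_induct)
      (simp_all add: z ar e scaleC_add_left alg_tensor_add_left ac_simps)
  have ss: "c *\<^sub>C d *\<^sub>C u = (c * d) *\<^sub>C u" for c d and u :: "('a, 'b) alg_tensor_product"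
    by (induction u rule: alg_tensor_induct) (simp_all add: z ar e scaleC_scaleC)
  have one: "1 *\<^sub>C u = u" for u :: "('a, 'b) alg_tensor_product"
    by (induction u rule: alg_tensor_induct) (simp_all add: z ar e scaleC_one)
  have zl: "0 *\<^sub>C u = 0" for u :: "('a, 'b) alg_tensor_product"
    by (induction u rule: alg_tensor_induct) (simp_all add: z ar e)
  show "c *\<^sub>C (u + v) = c *\<^sub>C u + c *\<^sub>C v" by (rule ar)
  show "(c + d) *\<^sub>C u = c *\<^sub>C u + d *\<^sub>C u" by (rule al)
  show "c *\<^sub>C d *\<^sub>C u = (c * d) *\<^sub>C u" by (rule ss)
  show "1 *\<^sub>C u = u" by (rule one)
  show "r *\<^sub>R u = complex_of_real r *\<^sub>C u" by (rule scaleR_alg_tensor_product_def)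
  show "- u + u = 0"
    using al [of "- 1" 1 u] by (simp add: uminus_alg_tensor_product_def one zl)
  show "u - v = u + - v" by (rule minus_alg_tensor_product_def)
  show "r *\<^sub>R (u + v) = r *\<^sub>R u + r *\<^sub>R v" by (simp add: scaleR_alg_tensor_product_def ar)
  show "(r + s) *\<^sub>R u = r *\<^sub>R u + s *\<^sub>R u" by (simp add: scaleR_alg_tensor_product_def al)
  show "r *\<^sub>R s *\<^sub>R u = (r * s) *\<^sub>R u" by (simp add: scaleR_alg_tensor_product_def ss)
  show "1 *\<^sub>R u = u" by (simp add: scaleR_alg_tensor_product_def one)
qed

end

lemma scaleC_alg_tensor: "c *\<^sub>C alg_tensor x y = alg_tensor (c *\<^sub>C x) y"
  by (simp add: scaleC_alg_tensor_product_def tensor_extend_alg_tensor balanced_scale_left)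

lemma balanced_mult_inner:
  fixes a :: "'a::complex_normed_algebra" and b :: "'b::complex_normed_algebra"
  shows "balanced (\<lambda>c d. alg_tensor (a * c) (b * d))"
  by (auto simp: balanced_def alg_tensor_add_left alg_tensor_add_right alg_tensor_scale
      mult_scaleC_right distrib_left)

lemma balanced_mult_right:
  fixes c :: "'a::complex_normed_algebra" and d :: "'b::complex_normed_algebra"
  shows "balanced (\<lambda>a b. alg_tensor (a * c) (b * d))"
  by (auto simp: balanced_def alg_tensor_add_left alg_tensor_add_right alg_tensor_scale
      mult_scaleC_left distrib_right)

lemma balanced_plus: "balanced f \<Longrightarrow> balanced g \<Longrightarrow> balanced (\<lambda>x y. f x y + g x y)"
  by (simp add: balanced_def ac_simps)

lemma balanced_zero: "balanced (\<lambda>x y. 0)"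
  by (simp add: balanced_def)

lemma balanced_mult_outer:
  fixes v :: "('a::complex_normed_algebra, 'b::complex_normed_algebra) alg_tensor_product"
  shows "balanced (\<lambda>a b. tensor_extend (\<lambda>c d. alg_tensor (a * c) (b * d)) v)"
proof (induction v rule: alg_tensor_induct)
  case zero
  then show ?case by (simp add: balanced_def)
next
  case (add x y v)
  then show ?case
    by (simp add: tensor_extend_add tensor_extend_alg_tensor balanced_mult_inner
        balanced_plus balanced_mult_right)
qed

instantiation alg_tensor_product :: (complex_normed_algebra, complex_normed_algebra) ring
begin

definition times_alg_tensor_product ::
  "('a, 'b) alg_tensor_product \<Rightarrow> ('a, 'b) alg_tensor_product \<Rightarrow> ('a, 'b) alg_tensor_product"
  where "u * v = tensor_extend
    (\<lambda>a b. tensor_extend (\<lambda>c d. alg_tensor (a * c) (b * d)) v) u"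

instance
proof
  fix u v w :: "('a, 'b) alg_tensor_product"
  have e: "alg_tensor a b * alg_tensor c d = alg_tensor (a * c) (b * d)" for a c :: 'a and b d :: 'b
    by (simp add: times_alg_tensor_product_def tensor_extend_alg_tensor balanced_mult_outer
        balanced_mult_inner balanced_mult_right)
  have z [simp]: "0 * v = 0" for v :: "('a, 'b) alg_tensor_product"
    by (simp add: times_alg_tensor_product_def)
  have al: "(u + v) * w = u * w + v * w" for u v w :: "('a, 'b) alg_tensor_product"
    by (simp add: times_alg_tensor_product_def tensor_extend_add)
  have l: "alg_tensor a b * (v + w) = alg_tensor a b * v + alg_tensor a b * w"
    "alg_tensor a b * 0 = 0" for a b and v w :: "('a, 'b) alg_tensor_product"
    by (simp_all add: times_alg_tensor_product_def tensor_extend_alg_tensor balanced_mult_outer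
        tensor_extend_add balanced_plus balanced_zero)
  have ar: "u * (v + w) = u * v + u * w" for u v w :: "('a, 'b) alg_tensor_product"
    by (induction u rule: alg_tensor_induct) (simp_all add: al l ac_simps)
  have zr [simp]: "u * 0 = 0" for u :: "('a, 'b) alg_tensor_product"
    by (induction u rule: alg_tensor_induct) (simp_all add: al l)
  have a1: "alg_tensor a b * alg_tensor c d * w = alg_tensor a b * (alg_tensor c d * w)"
    for a b c d and w :: "('a, 'b) alg_tensor_product"
    by (induction w rule: alg_tensor_induct) (simp_all add: e ar mult.assoc)
  have a2: "alg_tensor a b * v * w = alg_tensor a b * (v * w)"
    for a b and v w :: "('a, 'b) alg_tensor_product"
    by (induction v rule: alg_tensor_induct) (simp_all add: a1 ar al)
  show "u * v * w = u * (v * w)"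
    by (induction u rule: alg_tensor_induct) (simp_all add: a2 al)
  show "(u + v) * w = u * w + v * w" by (rule al)
  show "u * (v + w) = u * v + u * w" by (rule ar)
qed

end

lemma alg_tensor_mult: "alg_tensor a b * alg_tensor c d = alg_tensor (a * c) (b * d)"
  by (simp add: times_alg_tensor_product_def tensor_extend_alg_tensor balanced_mult_outer
      balanced_mult_inner balanced_mult_right)

lemma alg_tensor_product_mult_scaleC:
  fixes u v :: "('a::complex_normed_algebra, 'b::complex_normed_algebra) alg_tensor_product"
  shows "(c *\<^sub>C u) * v = c *\<^sub>C (u * v)" and "u * (c *\<^sub>C v) = c *\<^sub>C (u * v)"
proof -
  have 1: "(c *\<^sub>C alg_tensor a b) * v = c *\<^sub>C (alg_tensor a b * v)"
    "alg_tensor a b * (c *\<^sub>C v) = c *\<^sub>C (alg_tensor a b * v)"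
    for a b and v :: "('a, 'b) alg_tensor_product"
    by (induction v rule: alg_tensor_induct)
      (simp_all add: scaleC_alg_tensor alg_tensor_mult distrib_left scaleC_add_right
        mult_scaleC_left mult_scaleC_right)
  show "(c *\<^sub>C u) * v = c *\<^sub>C (u * v)" and "u * (c *\<^sub>C v) = c *\<^sub>C (u * v)"
    by (induction u rule: alg_tensor_induct)
      (simp_all add: 1 distrib_right scaleC_add_right)
qed

lemma alg_tensor_one_mult:
  fixes u :: "('a::{complex_normed_algebra, monoid_mult}, 'b::{complex_normed_algebra, monoid_mult})
    alg_tensor_product"
  shows "alg_tensor 1 1 * u = u" and "u * alg_tensor 1 1 = u"
  by (induction u rule: alg_tensor_induct)
    (simp_all add: alg_tensor_mult distrib_left distrib_right)

lemma balanced_star: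
  "balanced (\<lambda>a b. alg_tensor (star (a::'a::involutive_algebra)) (star (b::'b::involutive_algebra)))"
proof -
  have "star (0::'a) = 0"
    using star_add [of "0::'a" 0] by simp
  then show ?thesis
    by (simp add: balanced_def star_add star_scaleC alg_tensor_add_left alg_tensor_add_right
        alg_tensor_scale)
qed

instantiation alg_tensor_product :: (involutive_algebra, involutive_algebra) star
begin

definition star_alg_tensor_product :: "('a, 'b) alg_tensor_product \<Rightarrow> ('a, 'b) alg_tensor_product"
  where "star u = tensor_extend (\<lambda>a b. alg_tensor (star a) (star b)) u"

instance ..

end

lemma star_alg_tensor: "star (alg_tensor a b) = alg_tensor (star a) (star b)"
  by (simp add: star_alg_tensor_product_def tensor_extend_alg_tensor balanced_star)

lemma star_alg_tensor_product:
  fixes u v :: "('a::involutive_algebra, 'b::involutive_algebra) alg_tensor_product"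
  shows star_alg_add: "star (u + v) = star u + star v"
    and star_alg_zero: "star (0 :: ('a, 'b) alg_tensor_product) = 0"
    and star_alg_scaleC: "star (c *\<^sub>C u) = cnj c *\<^sub>C star u"
    and star_alg_mult: "star (u * v) = star v * star u"
    and star_alg_star: "star (star u) = u"
proof -
  have a: "star (u + v) = star u + star v" for u v :: "('a, 'b) alg_tensor_product"
    by (simp add: star_alg_tensor_product_def tensor_extend_add)
  have z: "star (0 :: ('a, 'b) alg_tensor_product) = 0"
    by (simp add: star_alg_tensor_product_def)
  have 1: "star (alg_tensor a b * v) = star v * star (alg_tensor a b)"
    for a b and v :: "('a, 'b) alg_tensor_product"
    by (induction v rule: alg_tensor_induct)
      (simp_all add: a z star_alg_tensor alg_tensor_mult distrib_left distrib_right star_mult)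
  show "star (u + v) = star u + star v" by (rule a)
  show "star (0 :: ('a, 'b) alg_tensor_product) = 0" by (rule z)
  show "star (c *\<^sub>C u) = cnj c *\<^sub>C star u"
    by (induction u rule: alg_tensor_induct)
      (simp_all add: a z star_alg_tensor scaleC_alg_tensor star_scaleC scaleC_add_right)
  show "star (u * v) = star v * star u"
    by (induction u rule: alg_tensor_induct)
      (simp_all add: a z 1 distrib_left distrib_right)
  show "star (star u) = u"
    by (induction u rule: alg_tensor_induct) (simp_all add: a z star_alg_tensor star_star)
qed


section \<open>The projective norm\<close>

definition proj_norm ::
  "('a::complex_normed_vector, 'b::complex_normed_vector) alg_tensor_product \<Rightarrow> real"
  where "proj_norm u =
    Inf {(\<Sum>(x, y)\<in>#M. norm x * norm y) | M. u = (\<Sum>(x, y)\<in>#M. alg_tensor x y)}"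

lemma sum_norms_nonneg: "0 \<le> (\<Sum>(x, y)\<in>#M. norm x * norm y)"
  by (induction M) auto

lemma proj_norm_le:
  "u = (\<Sum>(x, y)\<in>#M. alg_tensor x y) \<Longrightarrow> proj_norm u \<le> (\<Sum>(x, y)\<in>#M. norm x * norm y)"
  unfolding proj_norm_def
  by (rule cInf_lower) (auto intro!: bdd_belowI [of _ 0] simp: sum_norms_nonneg)

lemma proj_norm_nonneg: "0 \<le> proj_norm u"
  unfolding proj_norm_def
  by (rule cInf_greatest) (use alg_tensor_representation [of u] in \<open>auto simp: sum_norms_nonneg\<close>)

lemma proj_norm_approx:
  assumes "e > 0"
  obtains M where "u = (\<Sum>(x, y)\<in>#M. alg_tensor x y)"
    and "(\<Sum>(x, y)\<in>#M. norm x * norm y) < proj_norm u + e"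
proof -
  let ?S = "{(\<Sum>(x, y)\<in>#M. norm x * norm y) | M. u = (\<Sum>(x, y)\<in>#M. alg_tensor x y)}"
  have "?S \<noteq> {}" using alg_tensor_representation [of u] by auto
  moreover have "Inf ?S < proj_norm u + e" using assms by (simp add: proj_norm_def)
  ultimately obtain s where "s \<in> ?S" "s < proj_norm u + e" using cInf_lessD [of ?S "proj_norm u + e"] by blast
  then obtain M where "u = (\<Sum>(x, y)\<in>#M. alg_tensor x y)"
    and "s = (\<Sum>(x, y)\<in>#M. norm x * norm y)"
    by blast
  with \<open>s < proj_norm u + e\<close> show thesis by (intro that [of M]) simp_all
qed

lemma proj_norm_zero [simp]: "proj_norm 0 = 0"
  by (rule antisym [OF order_trans [OF proj_norm_le [of 0 "{#}"]] proj_norm_nonneg]) simp_all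

lemma proj_norm_alg_tensor_le: "proj_norm (alg_tensor x y) \<le> norm x * norm y"
  using proj_norm_le [of "alg_tensor x y" "{#(x, y)#}"] by simp

lemma proj_norm_triangle: "proj_norm (u + v) \<le> proj_norm u + proj_norm v"
proof (rule field_le_epsilon)
  fix e :: real assume "e > 0"
  then have e: "e / 2 > 0" by simp
  obtain M where M: "u = (\<Sum>(x, y)\<in>#M. alg_tensor x y)"
    "(\<Sum>(x, y)\<in>#M. norm x * norm y) < proj_norm u + e / 2"
    by (rule proj_norm_approx [OF e])
  obtain N where N: "v = (\<Sum>(x, y)\<in>#N. alg_tensor x y)"
    "(\<Sum>(x, y)\<in>#N. norm x * norm y) < proj_norm v + e / 2"
    by (rule proj_norm_approx [OF e])
  show "proj_norm (u + v) \<le> proj_norm u + proj_norm v + e"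
    using proj_norm_le [of "u + v" "M + N"] M N by simp
qed

lemma proj_norm_bound:
  assumes T0: "T 0 = 0" and Tadd: "\<And>u v. T (u + v) = T u + T v"
    and K: "K \<ge> 0" and T: "\<And>x y. proj_norm (T (alg_tensor x y)) \<le> K * (norm x * norm y)"
  shows "proj_norm (T u) \<le> K * proj_norm u"
proof (rule field_le_epsilon)
  fix e :: real assume e: "e > 0"
  define d where "d = e / (K + 1)"
  have "d > 0" using e K by (simp add: d_def)
  then obtain M where M: "u = (\<Sum>(x, y)\<in>#M. alg_tensor x y)"
    "(\<Sum>(x, y)\<in>#M. norm x * norm y) < proj_norm u + d"
    by (rule proj_norm_approx)
  have "proj_norm (T (\<Sum>(x, y)\<in>#M. alg_tensor x y)) \<le> K * (\<Sum>(x, y)\<in>#M. norm x * norm y)"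
  proof (induction M)
    case empty
    then show ?case by (simp add: T0)
  next
    case (add p M)
    obtain x y where p: "p = (x, y)" by (cases p)
    show ?case
      using proj_norm_triangle [of "T (alg_tensor x y)" "T (\<Sum>(x, y)\<in>#M. alg_tensor x y)"]
        T [of x y] add
      by (simp add: p Tadd distrib_left)
  qed
  also have "\<dots> \<le> K * (proj_norm u + d)" using M K by (intro mult_left_mono) auto
  also have "\<dots> = K * proj_norm u + K * d" by (rule distrib_left)
  also have "K * d \<le> (K + 1) * d" using \<open>d > 0\<close> by simp
  also have "(K + 1) * d = e" using K by (simp add: d_def)
  finally show "proj_norm (T u) \<le> K * proj_norm u + e" by (simp flip: M(1))
qed

lemma proj_norm_scaleC: "proj_norm (c *\<^sub>C u) = cmod c * proj_norm u"
proof -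
  have le: "proj_norm (c *\<^sub>C u) \<le> cmod c * proj_norm u"
    for c and u :: "('a::complex_normed_vector, 'b::complex_normed_vector) alg_tensor_product"
  proof (rule proj_norm_bound [where T = "\<lambda>u. c *\<^sub>C u"])
    show "proj_norm (c *\<^sub>C alg_tensor x y) \<le> cmod c * (norm x * norm y)" for x :: 'a and y :: 'b
      using proj_norm_alg_tensor_le [of "c *\<^sub>C x" y]
      by (simp add: scaleC_alg_tensor norm_scaleC mult.assoc)
  qed (simp_all add: scaleC_add_right)
  show ?thesis
  proof (cases "c = 0")
    case False
    have "cmod c * proj_norm u = cmod c * proj_norm (inverse c *\<^sub>C c *\<^sub>C u)"
      using False by (simp add: scaleC_scaleC scaleC_one)
    also have "\<dots> \<le> cmod c * (cmod (inverse c) * proj_norm (c *\<^sub>C u))"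
      by (intro mult_left_mono le) simp
    also have "\<dots> = proj_norm (c *\<^sub>C u)"
      using False by (simp add: norm_inverse)
    finally show ?thesis using le [of c u] by simp
  qed simp
qed

lemma alg_uminus_scaleC:
  fixes u :: "('a::complex_vector, 'b::complex_vector) alg_tensor_product"
  shows "- u = (- 1) *\<^sub>C u"
  by (rule uminus_alg_tensor_product_def)

lemma proj_norm_minus [simp]: "proj_norm (- u) = proj_norm u"
  by (simp add: alg_uminus_scaleC proj_norm_scaleC)

lemma proj_norm_minus_commute: "proj_norm (u - v) = proj_norm (v - u)"
  using proj_norm_minus [of "u - v"] by simp

lemma proj_norm_triangle_minus: "proj_norm (u - w) \<le> proj_norm (u - v) + proj_norm (v - w)"
  using proj_norm_triangle [of "u - v" "v - w"] by simp

lemma proj_norm_diff_le: "\<bar>proj_norm u - proj_norm v\<bar> \<le> proj_norm (u - v)"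
  using proj_norm_triangle [of "u - v" v] proj_norm_triangle [of "v - u" u]
  by (simp add: proj_norm_minus_commute [of u v] abs_if)

lemma proj_norm_mult:
  fixes u v :: "('a::complex_normed_algebra, 'b::complex_normed_algebra) alg_tensor_product"
  shows "proj_norm (u * v) \<le> proj_norm u * proj_norm v"
proof -
  have 1: "proj_norm (alg_tensor a b * v) \<le> (norm a * norm b) * proj_norm v" for a b
  proof (rule proj_norm_bound [where T = "\<lambda>v. alg_tensor a b * v"])
    show "proj_norm (alg_tensor a b * alg_tensor x y) \<le> norm a * norm b * (norm x * norm y)" for x y
    proof -
      have "proj_norm (alg_tensor a b * alg_tensor x y) \<le> norm (a * x) * norm (b * y)"
        by (simp add: alg_tensor_mult proj_norm_alg_tensor_le)
      also have "\<dots> \<le> (norm a * norm x) * (norm b * norm y)"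
        by (intro mult_mono norm_mult_ineq) auto
      finally show ?thesis by (simp add: ac_simps)
    qed
  qed (simp_all add: distrib_left)
  have "proj_norm (u * v) \<le> proj_norm v * proj_norm u"
    by (rule proj_norm_bound [where T = "\<lambda>u. u * v"])
      (use 1 in \<open>auto simp: distrib_right proj_norm_nonneg ac_simps\<close>)
  then show ?thesis by (simp add: mult.commute)
qed

lemma proj_norm_star:
  fixes u :: "('a::banach_star_algebra, 'b::banach_star_algebra) alg_tensor_product"
  shows "proj_norm (star u) = proj_norm u"
proof -
  have le: "proj_norm (star u) \<le> 1 * proj_norm u" for u :: "('a, 'b) alg_tensor_product"
    by (rule proj_norm_bound [where T = star])
      (simp_all add: star_alg_zero star_alg_add star_alg_tensor,
        metis norm_star proj_norm_alg_tensor_le)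
  show ?thesis using le [of u] le [of "star u"] by (simp add: star_alg_star)
qed


section \<open>The projective tensor product\<close>

text \<open>The completion of the algebraic tensor product in the projective norm: Cauchy sequences
  modulo null sequences. Only the seminorm properties of \<^const>\<open>proj_norm\<close> are used, so its
  definiteness (a consequence of the Hahn-Banach theorem) does not have to be proved here.\<close>

definition proj_Cauchy ::
  "(nat \<Rightarrow> ('a::complex_normed_vector, 'b::complex_normed_vector) alg_tensor_product) \<Rightarrow> bool"
  where "proj_Cauchy X \<longleftrightarrow>
    (\<forall>e>0. \<exists>N. \<forall>m\<ge>N. \<forall>n\<ge>N. proj_norm (X m - X n) < e)"

definition completion_rel ::
  "(nat \<Rightarrow> ('a::complex_normed_vector, 'b::complex_normed_vector) alg_tensor_product) \<Rightarrow>
    (nat \<Rightarrow> ('a, 'b) alg_tensor_product) \<Rightarrow> bool"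
  where "completion_rel X Y \<longleftrightarrow>
    proj_Cauchy X \<and> proj_Cauchy Y \<and> (\<lambda>n. proj_norm (X n - Y n)) \<longlonglongrightarrow> 0"

lemma proj_Cauchy_const [simp]: "proj_Cauchy (\<lambda>n. u)"
  by (simp add: proj_Cauchy_def)

lemma completion_rel_refl [simp]: "completion_rel X X \<longleftrightarrow> proj_Cauchy X"
  by (simp add: completion_rel_def)

lemma completion_rel_Cauchy: "completion_rel X Y \<Longrightarrow> proj_Cauchy X \<and> proj_Cauchy Y"
  by (simp add: completion_rel_def)

lemma completion_rel_part_equivp:
  "part_equivp (completion_rel ::
    (nat \<Rightarrow> ('a::complex_normed_vector, 'b::complex_normed_vector) alg_tensor_product) \<Rightarrow> _)"
  (is "part_equivp ?R")
proof (rule part_equivpI)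
  show "\<exists>X. ?R X X" by (auto intro: exI [of _ "\<lambda>n. 0"])
  show "symp ?R"
    by (rule sympI) (simp add: completion_rel_def proj_norm_minus_commute)
  show "transp ?R"
  proof (rule transpI)
    fix X Y Z :: "nat \<Rightarrow> ('a, 'b) alg_tensor_product"
    assume *: "completion_rel X Y" "completion_rel Y Z"
    then have "(\<lambda>n. proj_norm (X n - Y n) + proj_norm (Y n - Z n)) \<longlonglongrightarrow> 0"
      by (auto simp: completion_rel_def intro: tendsto_eq_intros)
    then have "(\<lambda>n. proj_norm (X n - Z n)) \<longlonglongrightarrow> 0"
      by (rule Lim_null_comparison [rotated]) (simp add: proj_norm_nonneg proj_norm_triangle_minus)
    with * show "completion_rel X Z" by (simp add: completion_rel_def)
  qed
qed

lemma proj_Cauchy_norm: "proj_Cauchy X \<Longrightarrow> Cauchy (\<lambda>n. proj_norm (X n))"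
  unfolding proj_Cauchy_def Cauchy_def dist_real_def
  by (meson proj_norm_diff_le le_less_trans)

lemma proj_Cauchy_norm_lim: "proj_Cauchy X \<Longrightarrow> (\<lambda>n. proj_norm (X n)) \<longlonglongrightarrow> lim (\<lambda>n. proj_norm (X n))"
  using proj_Cauchy_norm Cauchy_convergent convergent_LIMSEQ_iff by blast

lemma proj_Cauchy_bounded:
  assumes "proj_Cauchy X" obtains B where "\<And>n. proj_norm (X n) \<le> B"
proof -
  have "Bseq (\<lambda>n. proj_norm (X n))"
    using proj_Cauchy_norm [OF assms] by (rule Cauchy_Bseq)
  then obtain K where "\<And>n. norm (proj_norm (X n)) \<le> K" by (auto simp: Bseq_def)
  then show thesis using that by (metis abs_le_D1 real_norm_def)
qed

lemma proj_Cauchy_bound2: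
  assumes X: "proj_Cauchy X" and Y: "proj_Cauchy Y" and K: "K \<ge> 0"
    and Z: "\<And>m n. proj_norm (Z m - Z n) \<le> K * (proj_norm (X m - X n) + proj_norm (Y m - Y n))"
  shows "proj_Cauchy Z"
  unfolding proj_Cauchy_def
proof (intro allI impI)
  fix e :: real assume e: "e > 0"
  define d where "d = e / (2 * (K + 1))"
  have d: "d > 0" using e K by (simp add: d_def)
  obtain M where M: "\<And>m n. m \<ge> M \<Longrightarrow> n \<ge> M \<Longrightarrow> proj_norm (X m - X n) < d"
    using X d unfolding proj_Cauchy_def by blast
  obtain N where N: "\<And>m n. m \<ge> N \<Longrightarrow> n \<ge> N \<Longrightarrow> proj_norm (Y m - Y n) < d"
    using Y d unfolding proj_Cauchy_def by blast
  show "\<exists>N. \<forall>m\<ge>N. \<forall>n\<ge>N. proj_norm (Z m - Z n) < e"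
  proof (intro exI allI impI)
    fix m n assume *: "max M N \<le> m" "max M N \<le> n"
    have "proj_norm (Z m - Z n) \<le> K * (proj_norm (X m - X n) + proj_norm (Y m - Y n))" by (rule Z)
    also have "\<dots> \<le> K * (d + d)"
      using M [of m n] N [of m n] * K by (intro mult_left_mono) auto
    also have "\<dots> < (K + 1) * (d + d)" using d by (simp add: distrib_right)
    also have "\<dots> = (2 * (K + 1)) * d" by (simp only: algebra_simps mult_2)
    also have "\<dots> = e" using K by (simp add: d_def)
    finally show "proj_norm (Z m - Z n) < e" .
  qed
qed

lemma completion_rel_map2:
  assumes X: "completion_rel X X'" and Y: "completion_rel Y Y'"
    and F: "\<And>B::real. \<exists>K\<ge>0. \<forall>u u' v v'. proj_norm u \<le> B \<longrightarrow> proj_norm u' \<le> B \<longrightarrow>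
      proj_norm v \<le> B \<longrightarrow> proj_norm v' \<le> B \<longrightarrow>
      proj_norm (F u v - F u' v') \<le> K * (proj_norm (u - u') + proj_norm (v - v'))"
  shows "completion_rel (\<lambda>n. F (X n) (Y n)) (\<lambda>n. F (X' n) (Y' n))"
proof -
  have C: "proj_Cauchy X" "proj_Cauchy X'" "proj_Cauchy Y" "proj_Cauchy Y'"
    using X Y by (auto dest: completion_rel_Cauchy)
  obtain B1 where B1: "\<And>n. proj_norm (X n) \<le> B1" using proj_Cauchy_bounded [OF C(1)] by blast
  obtain B2 where B2: "\<And>n. proj_norm (X' n) \<le> B2" using proj_Cauchy_bounded [OF C(2)] by blast
  obtain B3 where B3: "\<And>n. proj_norm (Y n) \<le> B3" using proj_Cauchy_bounded [OF C(3)] by blast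
  obtain B4 where B4: "\<And>n. proj_norm (Y' n) \<le> B4" using proj_Cauchy_bounded [OF C(4)] by blast
  define B where "B = max (max B1 B2) (max B3 B4)"
  have B: "proj_norm (X n) \<le> B" "proj_norm (X' n) \<le> B" "proj_norm (Y n) \<le> B" "proj_norm (Y' n) \<le> B" for n
    using B1 [of n] B2 [of n] B3 [of n] B4 [of n] by (simp_all add: B_def)
  obtain K where K: "K \<ge> 0" and F': "\<And>u u' v v'. proj_norm u \<le> B \<Longrightarrow>
      proj_norm u' \<le> B \<Longrightarrow> proj_norm v \<le> B \<Longrightarrow> proj_norm v' \<le> B \<Longrightarrow>
      proj_norm (F u v - F u' v') \<le> K * (proj_norm (u - u') + proj_norm (v - v'))"
    using F [of B] by blast
  have "(\<lambda>n. K * (proj_norm (X n - X' n) + proj_norm (Y n - Y' n))) \<longlonglongrightarrow> K * (0 + 0)"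
    using X Y unfolding completion_rel_def by (intro tendsto_intros) blast+
  then have g: "(\<lambda>n. K * (proj_norm (X n - X' n) + proj_norm (Y n - Y' n))) \<longlonglongrightarrow> 0"
    by simp
  have "(\<lambda>n. proj_norm (F (X n) (Y n) - F (X' n) (Y' n))) \<longlonglongrightarrow> 0"
    by (rule Lim_null_comparison [OF _ g]) (simp add: proj_norm_nonneg F' B)
  moreover have "proj_Cauchy (\<lambda>n. F (X n) (Y n))"
    by (rule proj_Cauchy_bound2 [OF C(1) C(3) K]) (intro F' B)
  moreover have "proj_Cauchy (\<lambda>n. F (X' n) (Y' n))"
    by (rule proj_Cauchy_bound2 [OF C(2) C(4) K]) (intro F' B)
  ultimately show ?thesis by (simp add: completion_rel_def)
qed

lemma completion_rel_map:
  assumes X: "completion_rel X X'"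
    and F: "\<And>u v. proj_norm (F u - F v) \<le> K * proj_norm (u - v)" and K: "K \<ge> 0"
  shows "completion_rel (\<lambda>n. F (X n)) (\<lambda>n. F (X' n))"
proof (rule completion_rel_map2 [OF X X, where F = "\<lambda>u v. F u"])
  show "\<exists>K\<ge>0. \<forall>u u' v v'. proj_norm u \<le> B \<longrightarrow> proj_norm u' \<le> B \<longrightarrow>
      proj_norm v \<le> B \<longrightarrow> proj_norm v' \<le> B \<longrightarrow>
      proj_norm (F u - F u') \<le> K * (proj_norm (u - u') + proj_norm (v - v'))" for B
  proof (intro exI [of _ K] conjI allI impI)
    show "proj_norm (F u - F u') \<le> K * (proj_norm (u - u') + proj_norm (v - v'))" for u u' v v'
      using F [of u u'] mult_nonneg_nonneg [OF K proj_norm_nonneg [of "v - v'"]]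
      by (simp add: distrib_left)
  qed (rule K)
qed

lemma completion_rel_scaleC: "completion_rel X Y \<Longrightarrow> completion_rel (\<lambda>n. c *\<^sub>C X n) (\<lambda>n. c *\<^sub>C Y n)"
proof (erule completion_rel_map [where K = "cmod c" and F = "\<lambda>u. c *\<^sub>C u"])
  have "c *\<^sub>C u - c *\<^sub>C v = c *\<^sub>C (u - v)" for u v :: "('a, 'b) alg_tensor_product"
    using scaleC_add_right [of c "u - v" v] by simp
  then show "proj_norm (c *\<^sub>C u - c *\<^sub>C v) \<le> cmod c * proj_norm (u - v)"
    for u v :: "('a, 'b) alg_tensor_product"
    by (simp add: proj_norm_scaleC)
qed auto

lemma completion_rel_uminus: "completion_rel X Y \<Longrightarrow> completion_rel (\<lambda>n. - X n) (\<lambda>n. - Y n)"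
  unfolding alg_uminus_scaleC by (rule completion_rel_scaleC)

lemma completion_rel_plus:
  assumes "completion_rel X X'" and "completion_rel Y Y'"
  shows "completion_rel (\<lambda>n. X n + Y n) (\<lambda>n. X' n + Y' n)"
proof (rule completion_rel_map2 [OF assms, where F = "(+)"])
  have "proj_norm (u + v - (u' + v')) \<le> proj_norm (u - u') + proj_norm (v - v')"
    for u u' v v' :: "('a, 'b) alg_tensor_product"
    using proj_norm_triangle [of "u - u'" "v - v'"] by (simp add: algebra_simps)
  then show "\<exists>K\<ge>0. \<forall>u u' v v' :: ('a, 'b) alg_tensor_product. proj_norm u \<le> B \<longrightarrow>
      proj_norm u' \<le> B \<longrightarrow> proj_norm v \<le> B \<longrightarrow> proj_norm v' \<le> B \<longrightarrow>
      proj_norm (u + v - (u' + v')) \<le> K * (proj_norm (u - u') + proj_norm (v - v'))" for B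
    by (intro exI [of _ 1]) simp
qed

lemma completion_rel_minus:
  assumes "completion_rel X X'" and "completion_rel Y Y'"
  shows "completion_rel (\<lambda>n. X n - Y n) (\<lambda>n. X' n - Y' n)"
  using completion_rel_plus [OF assms(1) completion_rel_uminus [OF assms(2)]] by simp

lemma completion_rel_mult:
  fixes X Y :: "nat \<Rightarrow> ('a::complex_normed_algebra, 'b::complex_normed_algebra) alg_tensor_product"
  assumes "completion_rel X X'" and "completion_rel Y Y'"
  shows "completion_rel (\<lambda>n. X n * Y n) (\<lambda>n. X' n * Y' n)"
proof (rule completion_rel_map2 [OF assms, where F = "(*)"])
  fix B :: real
  have "proj_norm (u * v - u' * v') \<le> max 0 B * (proj_norm (u - u') + proj_norm (v - v'))"
    if "proj_norm u' \<le> B" "proj_norm v \<le> B" for u u' v v' :: "('a, 'b) alg_tensor_product"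
  proof -
    have "proj_norm (u * v - u' * v') = proj_norm ((u - u') * v + u' * (v - v'))"
      by (simp add: algebra_simps)
    also have "\<dots> \<le> proj_norm (u - u') * proj_norm v + proj_norm u' * proj_norm (v - v')"
      by (rule order_trans [OF proj_norm_triangle]) (intro add_mono proj_norm_mult)
    also have "\<dots> \<le> proj_norm (u - u') * max 0 B + max 0 B * proj_norm (v - v')"
      using that by (intro add_mono mult_left_mono mult_right_mono) (auto simp: proj_norm_nonneg)
    finally show ?thesis by (simp add: distrib_left mult.commute)
  qed
  then show "\<exists>K\<ge>0. \<forall>u u' v v' :: ('a, 'b) alg_tensor_product. proj_norm u \<le> B \<longrightarrow>
      proj_norm u' \<le> B \<longrightarrow> proj_norm v \<le> B \<longrightarrow> proj_norm v' \<le> B \<longrightarrow>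
      proj_norm (u * v - u' * v') \<le> K * (proj_norm (u - u') + proj_norm (v - v'))"
    by (intro exI [of _ "max 0 B"]) simp
qed

lemma completion_rel_star:
  fixes X Y :: "nat \<Rightarrow> ('a::banach_star_algebra, 'b::banach_star_algebra) alg_tensor_product"
  assumes "completion_rel X Y"
  shows "completion_rel (\<lambda>n. star (X n)) (\<lambda>n. star (Y n))"
proof (rule completion_rel_map [OF assms, where K = 1 and F = star])
  have "star u - star v = star (u - v)" for u v :: "('a, 'b) alg_tensor_product"
    using star_alg_add [of "u - v" v] by simp
  then show "proj_norm (star u - star v) \<le> 1 * proj_norm (u - v)"
    for u v :: "('a, 'b) alg_tensor_product"
    by (simp add: proj_norm_star)
qed simp

lemmas proj_Cauchy_intros [intro!] =
  completion_rel_scaleC [of X X for X, unfolded completion_rel_refl]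
  completion_rel_uminus [of X X for X, unfolded completion_rel_refl]
  completion_rel_plus [of X X Y Y for X Y, unfolded completion_rel_refl]
  completion_rel_minus [of X X Y Y for X Y, unfolded completion_rel_refl]
  completion_rel_mult [of X X Y Y for X Y, unfolded completion_rel_refl]
  completion_rel_star [of X X for X, unfolded completion_rel_refl]

quotient_type (overloaded) ('a, 'b) proj_tensor_product =
    "nat \<Rightarrow> ('a::complex_normed_vector, 'b::complex_normed_vector) alg_tensor_product" /
    partial: completion_rel
  by (rule completion_rel_part_equivp)

instantiation proj_tensor_product ::
  (complex_normed_vector, complex_normed_vector) complex_normed_vector
begin

lift_definition zero_proj_tensor_product :: "('a, 'b) proj_tensor_product" is "\<lambda>n. 0"
  by simp

lift_definition plus_proj_tensor_product ::
  "('a, 'b) proj_tensor_product \<Rightarrow> ('a, 'b) proj_tensor_product \<Rightarrow> ('a, 'b) proj_tensor_product"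
  is "\<lambda>X Y n. X n + Y n"
  by (rule completion_rel_plus)

lift_definition minus_proj_tensor_product ::
  "('a, 'b) proj_tensor_product \<Rightarrow> ('a, 'b) proj_tensor_product \<Rightarrow> ('a, 'b) proj_tensor_product"
  is "\<lambda>X Y n. X n - Y n"
  by (rule completion_rel_minus)

lift_definition uminus_proj_tensor_product ::
  "('a, 'b) proj_tensor_product \<Rightarrow> ('a, 'b) proj_tensor_product"
  is "\<lambda>X n. - X n"
  by (rule completion_rel_uminus)

lift_definition scaleC_proj_tensor_product ::
  "complex \<Rightarrow> ('a, 'b) proj_tensor_product \<Rightarrow> ('a, 'b) proj_tensor_product"
  is "\<lambda>c X n. c *\<^sub>C X n"
  by (rule completion_rel_scaleC)

definition scaleR_proj_tensor_product ::
  "real \<Rightarrow> ('a, 'b) proj_tensor_product \<Rightarrow> ('a, 'b) proj_tensor_product"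
  where "r *\<^sub>R x = complex_of_real r *\<^sub>C x" for x :: "('a, 'b) proj_tensor_product"

lift_definition norm_proj_tensor_product :: "('a, 'b) proj_tensor_product \<Rightarrow> real"
  is "\<lambda>X. lim (\<lambda>n. proj_norm (X n))"
proof -
  fix X Y :: "nat \<Rightarrow> ('a, 'b) alg_tensor_product"
  assume XY: "completion_rel X Y"
  have "(\<lambda>n. proj_norm (X n) - proj_norm (Y n)) \<longlonglongrightarrow> 0"
    by (rule Lim_null_comparison [where g = "\<lambda>n. proj_norm (X n - Y n)"])
      (use XY in \<open>auto simp: completion_rel_def proj_norm_diff_le\<close>)
  moreover have "(\<lambda>n. proj_norm (X n) - proj_norm (Y n)) \<longlonglongrightarrow>
      lim (\<lambda>n. proj_norm (X n)) - lim (\<lambda>n. proj_norm (Y n))"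
    using completion_rel_Cauchy [OF XY] by (intro tendsto_diff proj_Cauchy_norm_lim) auto
  ultimately show "lim (\<lambda>n. proj_norm (X n)) = lim (\<lambda>n. proj_norm (Y n))"
    using LIMSEQ_unique by force
qed

definition dist_proj_tensor_product ::
  "('a, 'b) proj_tensor_product \<Rightarrow> ('a, 'b) proj_tensor_product \<Rightarrow> real"
  where "dist x y = norm (x - y)" for x y :: "('a, 'b) proj_tensor_product"

definition sgn_proj_tensor_product :: "('a, 'b) proj_tensor_product \<Rightarrow> ('a, 'b) proj_tensor_product"
  where "sgn x = inverse (norm x) *\<^sub>R x" for x :: "('a, 'b) proj_tensor_product"

definition uniformity_proj_tensor_product ::
  "(('a, 'b) proj_tensor_product \<times> ('a, 'b) proj_tensor_product) filter"
  where [code del]: "uniformity_proj_tensor_product = (INF e\<in>{0 <..}. principal {(x, y). dist x y < e})"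

definition open_proj_tensor_product :: "('a, 'b) proj_tensor_product set \<Rightarrow> bool"
  where [code del]: "open_proj_tensor_product S \<longleftrightarrow>
    (\<forall>x\<in>S. \<forall>\<^sub>F (x', y) in uniformity. x' = x \<longrightarrow> y \<in> S)"

instance
proof
  fix x y z :: "('a, 'b) proj_tensor_product" and c d :: complex and r s :: real
  have ar: "c *\<^sub>C (x + y) = c *\<^sub>C x + c *\<^sub>C y" for c and x y :: "('a, 'b) proj_tensor_product"
    by transfer (auto simp: scaleC_add_right)
  have al: "(c + d) *\<^sub>C x = c *\<^sub>C x + d *\<^sub>C x" for c d and x :: "('a, 'b) proj_tensor_product"
    by transfer (auto simp: scaleC_add_left)
  have ss: "c *\<^sub>C d *\<^sub>C x = (c * d) *\<^sub>C x" for c d and x :: "('a, 'b) proj_tensor_product"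
    by transfer (auto simp: scaleC_scaleC)
  have one: "1 *\<^sub>C x = x" for x :: "('a, 'b) proj_tensor_product"
    by transfer (auto simp: scaleC_one)
  have ns: "norm (c *\<^sub>C x) = cmod c * norm x" for c and x :: "('a, 'b) proj_tensor_product"
  proof transfer
    fix c and X :: "nat \<Rightarrow> ('a, 'b) alg_tensor_product"
    assume "completion_rel X X"
    then have "(\<lambda>n. cmod c * proj_norm (X n)) \<longlonglongrightarrow> cmod c * lim (\<lambda>n. proj_norm (X n))"
      by (intro tendsto_mult_left proj_Cauchy_norm_lim) simp
    then show "lim (\<lambda>n. proj_norm (c *\<^sub>C X n)) = cmod c * lim (\<lambda>n. proj_norm (X n))"
      by (simp add: proj_norm_scaleC limI)
  qed
  show "c *\<^sub>C (x + y) = c *\<^sub>C x + c *\<^sub>C y" by (rule ar)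
  show "(c + d) *\<^sub>C x = c *\<^sub>C x + d *\<^sub>C x" by (rule al)
  show "c *\<^sub>C d *\<^sub>C x = (c * d) *\<^sub>C x" by (rule ss)
  show "1 *\<^sub>C x = x" by (rule one)
  show "norm (c *\<^sub>C x) = cmod c * norm x" by (rule ns)
  show "r *\<^sub>R x = complex_of_real r *\<^sub>C x" by (rule scaleR_proj_tensor_product_def)
  show "r *\<^sub>R (x + y) = r *\<^sub>R x + r *\<^sub>R y" by (simp add: scaleR_proj_tensor_product_def ar)
  show "(r + s) *\<^sub>R x = r *\<^sub>R x + s *\<^sub>R x" by (simp add: scaleR_proj_tensor_product_def al)
  show "r *\<^sub>R s *\<^sub>R x = (r * s) *\<^sub>R x" by (simp add: scaleR_proj_tensor_product_def ss)
  show "1 *\<^sub>R x = x" by (simp add: scaleR_proj_tensor_product_def one)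
  show "norm (r *\<^sub>R x) = \<bar>r\<bar> * norm x" by (simp add: scaleR_proj_tensor_product_def ns)
  show "x + y + z = x + (y + z)" by transfer (auto simp: ac_simps)
  show "x + y = y + x" by transfer (auto simp: ac_simps)
  show "0 + x = x" by transfer auto
  show "- x + x = 0" by transfer auto
  show "x - y = x + - y" by transfer auto
  show "norm x = 0 \<longleftrightarrow> x = 0"
  proof transfer
    fix X :: "nat \<Rightarrow> ('a, 'b) alg_tensor_product"
    assume X: "completion_rel X X"
    then have lim: "(\<lambda>n. proj_norm (X n)) \<longlonglongrightarrow> lim (\<lambda>n. proj_norm (X n))"
      by (intro proj_Cauchy_norm_lim) simp
    have "completion_rel X (\<lambda>n. 0) \<longleftrightarrow> (\<lambda>n. proj_norm (X n)) \<longlonglongrightarrow> 0"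
      using X by (simp add: completion_rel_def)
    also have "\<dots> \<longleftrightarrow> lim (\<lambda>n. proj_norm (X n)) = 0"
      by (metis lim LIMSEQ_unique)
    finally show "lim (\<lambda>n. proj_norm (X n)) = 0 \<longleftrightarrow> completion_rel X (\<lambda>n. 0)" by blast
  qed
  show "norm (x + y) \<le> norm x + norm y"
  proof transfer
    fix X Y :: "nat \<Rightarrow> ('a, 'b) alg_tensor_product"
    assume "completion_rel X X" "completion_rel Y Y"
    then have "proj_Cauchy X" "proj_Cauchy Y" by simp_all
    then show "lim (\<lambda>n. proj_norm (X n + Y n)) \<le>
        lim (\<lambda>n. proj_norm (X n)) + lim (\<lambda>n. proj_norm (Y n))"
      by (intro LIMSEQ_le [OF proj_Cauchy_norm_lim tendsto_add [OF proj_Cauchy_norm_lim proj_Cauchy_norm_lim]])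
        (auto simp: proj_norm_triangle)
  qed
qed (fact dist_proj_tensor_product_def sgn_proj_tensor_product_def
  uniformity_proj_tensor_product_def open_proj_tensor_product_def)+

end

lemma proj_tensor_product_representative:
  obtains U where "proj_Cauchy U" and "x = abs_proj_tensor_product U"
proof (rule that [of "rep_proj_tensor_product x"])
  show "proj_Cauchy (rep_proj_tensor_product x)"
    using Quotient_rep_reflp [OF Quotient_proj_tensor_product] by simp
  show "x = abs_proj_tensor_product (rep_proj_tensor_product x)"
    by (rule Quotient_abs_rep [OF Quotient_proj_tensor_product, symmetric])
qed

lemma norm_abs_proj_tensor_product:
  "proj_Cauchy X \<Longrightarrow> norm (abs_proj_tensor_product X) = lim (\<lambda>n. proj_norm (X n))"
  by (simp add: norm_proj_tensor_product.abs_eq)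

definition completion_embed ::
  "('a::complex_normed_vector, 'b::complex_normed_vector) alg_tensor_product \<Rightarrow>
    ('a, 'b) proj_tensor_product"
  where "completion_embed u = abs_proj_tensor_product (\<lambda>n. u)"

lemma norm_completion_embed: "norm (completion_embed u) = proj_norm u"
  by (simp add: completion_embed_def norm_abs_proj_tensor_product limI)

lemma completion_embed_zero: "completion_embed 0 = 0"
  by (simp add: completion_embed_def zero_proj_tensor_product_def)

lemma completion_embed_add: "completion_embed (u + v) = completion_embed u + completion_embed v"
  by (simp add: completion_embed_def plus_proj_tensor_product.abs_eq)

lemma completion_embed_diff: "completion_embed (u - v) = completion_embed u - completion_embed v"
  by (simp add: completion_embed_def minus_proj_tensor_product.abs_eq)

lemma completion_embed_scaleC: "completion_embed (c *\<^sub>C u) = c *\<^sub>C completion_embed u"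
  by (simp add: completion_embed_def scaleC_proj_tensor_product.abs_eq)

lemma completion_embed_limit:
  assumes U: "proj_Cauchy U"
  shows "(\<lambda>n. completion_embed (U n)) \<longlonglongrightarrow> abs_proj_tensor_product U"
proof (rule LIMSEQ_I)
  fix e :: real assume "e > 0"
  then obtain N where N: "\<And>m n. m \<ge> N \<Longrightarrow> n \<ge> N \<Longrightarrow> proj_norm (U m - U n) < e / 2"
    using U unfolding proj_Cauchy_def by (meson half_gt_zero)
  have "norm (completion_embed (U n) - abs_proj_tensor_product U) < e" if n: "n \<ge> N" for n
  proof -
    have C: "proj_Cauchy (\<lambda>m. U n - U m)" using U by auto
    have "norm (completion_embed (U n) - abs_proj_tensor_product U) =
        lim (\<lambda>m. proj_norm (U n - U m))"
      using U C by (simp add: completion_embed_def minus_proj_tensor_product.abs_eq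
          norm_abs_proj_tensor_product)
    also have "\<dots> \<le> e / 2"
      by (rule LIMSEQ_le_const2 [OF proj_Cauchy_norm_lim [OF C]])
        (use N n in \<open>auto intro!: exI [of _ N] less_imp_le\<close>)
    also have "\<dots> < e" using \<open>e > 0\<close> by simp
    finally show ?thesis .
  qed
  then show "\<exists>N. \<forall>n\<ge>N. norm (completion_embed (U n) - abs_proj_tensor_product U) < e" by blast
qed

lemma completion_embed_limit_ex: "\<exists>U. proj_Cauchy U \<and> (\<lambda>n. completion_embed (U n)) \<longlonglongrightarrow> x"
  by (metis proj_tensor_product_representative completion_embed_limit)

lemma completion_embed_dense:
  assumes "e > 0" shows "\<exists>u. norm (x - completion_embed u) < e"
proof -
  obtain U where "(\<lambda>n. completion_embed (U n)) \<longlonglongrightarrow> x"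
    using completion_embed_limit_ex by blast
  then obtain n where "norm (completion_embed (U n) - x) < e"
    using LIMSEQ_D [OF _ assms] by blast
  then show ?thesis by (metis norm_minus_commute)
qed

instance proj_tensor_product :: (complex_normed_vector, complex_normed_vector) banach
proof
  fix X :: "nat \<Rightarrow> ('a, 'b) proj_tensor_product"
  assume X: "Cauchy X"
  have "\<exists>u. norm (X n - completion_embed u) < inverse (real (Suc n))" for n
    by (rule completion_embed_dense) simp
  then obtain U where U: "\<And>n. norm (X n - completion_embed (U n)) < inverse (real (Suc n))"
    by metis
  have null: "(\<lambda>n. X n - completion_embed (U n)) \<longlonglongrightarrow> 0"
    by (rule Lim_null_comparison [OF _ LIMSEQ_inverse_real_of_nat]) (use U in \<open>intro always_eventually allI less_imp_le\<close>)
  have "proj_Cauchy U"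
    unfolding proj_Cauchy_def
  proof (intro allI impI)
    fix e :: real assume "e > 0"
    then have e: "e / 2 > 0" by simp
    define D where "D = (\<lambda>n. X n - completion_embed (U n))"
    have "Cauchy D" using null unfolding D_def by (rule LIMSEQ_imp_Cauchy)
    then obtain M where M: "\<And>m n. m \<ge> M \<Longrightarrow> n \<ge> M \<Longrightarrow> norm (D m - D n) < e / 2"
      using e unfolding Cauchy_iff by blast
    obtain N where N: "\<And>m n. m \<ge> N \<Longrightarrow> n \<ge> N \<Longrightarrow> norm (X m - X n) < e / 2"
      using X e unfolding Cauchy_iff by blast
    have "proj_norm (U m - U n) < e" if "m \<ge> max M N" "n \<ge> max M N" for m n
    proof -
      have "proj_norm (U m - U n) = norm ((X m - X n) - (D m - D n))"
        by (simp add: D_def completion_embed_diff flip: norm_completion_embed)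
      also have "\<dots> \<le> norm (X m - X n) + norm (D m - D n)" by (rule norm_triangle_ineq4)
      also have "\<dots> < e" using M [of m n] N [of m n] that by simp
      finally show ?thesis .
    qed
    then show "\<exists>N. \<forall>m\<ge>N. \<forall>n\<ge>N. proj_norm (U m - U n) < e" by blast
  qed
  then have "(\<lambda>n. (X n - completion_embed (U n)) + completion_embed (U n)) \<longlonglongrightarrow>
      0 + abs_proj_tensor_product U"
    by (intro tendsto_add null completion_embed_limit)
  then show "convergent X" by (auto simp: convergent_def)
qed

instantiation proj_tensor_product ::
  (complex_normed_algebra, complex_normed_algebra) complex_normed_algebra
begin

lift_definition times_proj_tensor_product ::
  "('a, 'b) proj_tensor_product \<Rightarrow> ('a, 'b) proj_tensor_product \<Rightarrow> ('a, 'b) proj_tensor_product"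
  is "\<lambda>X Y n. X n * Y n"
  by (rule completion_rel_mult)

instance
proof
  fix x y z :: "('a, 'b) proj_tensor_product" and c :: complex and r :: real
  have l: "(c *\<^sub>C x) * y = c *\<^sub>C (x * y)" for c and x y :: "('a, 'b) proj_tensor_product"
    by transfer (auto simp: alg_tensor_product_mult_scaleC)
  have r: "x * (c *\<^sub>C y) = c *\<^sub>C (x * y)" for c and x y :: "('a, 'b) proj_tensor_product"
    by transfer (auto simp: alg_tensor_product_mult_scaleC)
  show "(c *\<^sub>C x) * y = c *\<^sub>C (x * y)" by (rule l)
  show "x * (c *\<^sub>C y) = c *\<^sub>C (x * y)" by (rule r)
  show "(r *\<^sub>R x) * y = r *\<^sub>R (x * y)" by (simp add: scaleR_scaleC l)
  show "x * (r *\<^sub>R y) = r *\<^sub>R (x * y)" by (simp add: scaleR_scaleC r)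
  show "x * y * z = x * (y * z)" by transfer (auto simp: mult.assoc)
  show "(x + y) * z = x * z + y * z" by transfer (auto simp: distrib_right)
  show "x * (y + z) = x * y + x * z" by transfer (auto simp: distrib_left)
  show "norm (x * y) \<le> norm x * norm y"
  proof transfer
    fix X Y :: "nat \<Rightarrow> ('a, 'b) alg_tensor_product"
    assume "completion_rel X X" "completion_rel Y Y"
    then have C: "proj_Cauchy X" "proj_Cauchy Y" "proj_Cauchy (\<lambda>n. X n * Y n)" by auto
    show "lim (\<lambda>n. proj_norm (X n * Y n)) \<le>
        lim (\<lambda>n. proj_norm (X n)) * lim (\<lambda>n. proj_norm (Y n))"
      by (intro LIMSEQ_le [OF proj_Cauchy_norm_lim [OF C(3)]
            tendsto_mult [OF proj_Cauchy_norm_lim [OF C(1)] proj_Cauchy_norm_lim [OF C(2)]]])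
        (auto simp: proj_norm_mult)
  qed
qed

end

instantiation proj_tensor_product ::
  (banach_star_algebra, banach_star_algebra) banach_star_algebra
begin

lift_definition star_proj_tensor_product ::
  "('a, 'b) proj_tensor_product \<Rightarrow> ('a, 'b) proj_tensor_product"
  is "\<lambda>X n. star (X n)"
  by (rule completion_rel_star)

instance
proof
  fix x y :: "('a, 'b) proj_tensor_product" and c :: complex
  show "star (x + y) = star x + star y" by transfer (auto simp: star_alg_add)
  show "star (c *\<^sub>C x) = cnj c *\<^sub>C star x" by transfer (auto simp: star_alg_scaleC)
  show "star (x * y) = star y * star x" by transfer (auto simp: star_alg_mult)
  show "star (star x) = x" by transfer (auto simp: star_alg_star)
  show "norm (star x) = norm x" by transfer (simp add: proj_norm_star)
qed

end

definition tensor ::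
  "'a::complex_normed_vector \<Rightarrow> 'b::complex_normed_vector \<Rightarrow> ('a, 'b) proj_tensor_product"
  (infixr \<open>\<otimes>\<close> 70)
  where "x \<otimes> y = completion_embed (alg_tensor x y)"

lemma completion_embed_mult: "completion_embed (u * v) = completion_embed u * completion_embed v"
  by (simp add: completion_embed_def times_proj_tensor_product.abs_eq)

lemma completion_embed_star: "completion_embed (star u) = star (completion_embed u)"
  by (simp add: completion_embed_def star_proj_tensor_product.abs_eq)

lemma tensor_mult: "(a \<otimes> b) * (c \<otimes> d) = (a * c) \<otimes> (b * d)"
  by (simp add: tensor_def alg_tensor_mult flip: completion_embed_mult)

lemma star_tensor: "star (a \<otimes> b) = star a \<otimes> star b"
  by (simp add: tensor_def star_alg_tensor flip: completion_embed_star)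

lemma norm_tensor_le: "norm (x \<otimes> y) \<le> norm x * norm y"
  by (simp add: tensor_def norm_completion_embed proj_norm_alg_tensor_le)

instantiation proj_tensor_product ::
  ("{complex_normed_algebra, monoid_mult}", "{complex_normed_algebra, monoid_mult}") monoid_mult
begin

definition one_proj_tensor_product :: "('a, 'b) proj_tensor_product"
  where "1 = (1 \<otimes> 1 :: ('a, 'b) proj_tensor_product)"

instance
proof
  fix x :: "('a, 'b) proj_tensor_product"
  obtain U where U: "proj_Cauchy U" "x = abs_proj_tensor_product U"
    by (rule proj_tensor_product_representative)
  then show "1 * x = x" and "x * 1 = x"
    by (simp_all add: one_proj_tensor_product_def tensor_def completion_embed_def
        times_proj_tensor_product.abs_eq alg_tensor_one_mult)
qed

end


section \<open>Unitaries\<close>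

definition unitaries :: "'a::{banach_star_algebra, monoid_mult} set"
  where "unitaries = {u. star u * u = 1 \<and> u * star u = 1}"

definition norm_one_unitaries :: "'a::{banach_star_algebra, monoid_mult} set"
  where "norm_one_unitaries = {u. star u * u = 1 \<and> u * star u = 1 \<and> norm u = 1}"

end

theory Submission
  imports Defs
begin

text \<open>A tensor of unitaries is a unitary of norm at most one, and slicing by states shows that the
unit of the projective tensor product has norm one, so the norm of such a tensor is exactly one.
The substance is the converse: a unitary \<open>w\<close> of norm one is a tensor of unitaries.

By the Russo-Dye theorem, the unit ball of the tensor product is the closed convex hull of the
tensors of unitaries (\<open>proj_unit_ball_subset_hull\<close>). So \<open>w\<close> is close to a mean of tensors
\<open>u i \<otimes> v i\<close>, and \<open>w * star w = 1\<close> says that the mean of the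
tensors \<open>(u i * star (u j)) \<otimes> (v i * star (v j))\<close> is close to the unit. A slice by a state of the second
algebra yields phases for which the mean of the unitaries \<open>\<sigma> (i, j) u i star (u j)\<close> is
close to the unit (\<open>state_slice_phases\<close>). In this averaged
sense the \<open>u i\<close> are approximately multiples of one unitary.

The difficulty is to exploit this in the projective norm, because the single deviations need not be
small in norm. The main estimate \<open>small_defect_imp_small_tensor_sum\<close> says that, when a mean of
unitaries \<open>z i\<close> is close to the unit, the mean of \<open>(1 - z i) \<otimes> Y i\<close> is small, uniformly over all
contractions \<open>Y i\<close>. It rests on two facts. The first is that an element \<open>Z\<close> for which all \<open>1 + \<zeta> Z\<close> with \<open>cmod \<zeta> = 1\<close> have norm at most
\<open>1 + \<beta>\<close> has norm at most \<open>9 \<beta>\<close> (\<open>small_if_perturbs_one_little\<close>). So it suffices to see that the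
mean in question perturbs the unit to second order only. The second is a bound of this kind,
obtained by averaging over the circle the tensor of an analytic disc of unitaries through a self-adjoint
contraction \<open>q\<close> with a skew perturbation of the unit (\<open>disc_tensor_bound\<close>). The contraction \<open>q\<close>
is, up to a scalar, a mean of the real parts of powers of \<open>z i\<close>: it is close to the unit on average and
is almost annihilated by \<open>1 - z i\<close>.

With the main estimate, a suitable combination \<open>a\<close> of the \<open>u i\<close> has \<open>star a * a\<close> close to a scalar
bounded away from zero, and \<open>w * (star a \<otimes> 1)\<close> is close to some \<open>1 \<otimes> b\<close>. So \<open>w\<close> is close to an
elementary tensor. Slices show that a norm-one unitary that is a limit of elementary tensors is
itself an elementary tensor \<open>a \<otimes> b\<close>, and that the factors of such a unitary are multiples of unitaries.\<close>

section \<open>Involutive algebras\<close>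

lemma scaleC_minus_one: "(- 1) *\<^sub>C x = - x" for x :: "'a::complex_vector"
  using scaleR_scaleC [of "- 1" x] by simp

lemma scaleC_minus_right: "c *\<^sub>C (- x) = - (c *\<^sub>C x)" for x :: "'a::complex_vector"
  by (metis add.right_inverse add_cancel_right_left minus_unique scaleC_add_right scaleC_zero_right)

lemma scaleC_diff_right: "c *\<^sub>C (x - y) = c *\<^sub>C x - c *\<^sub>C y" for x :: "'a::complex_vector"
  using scaleC_add_right [of c x "- y"] by (simp add: scaleC_minus_right)

lemma scaleC_minus_left: "(- c) *\<^sub>C x = - (c *\<^sub>C x)" for x :: "'a::complex_vector"
  by (metis mult_minus1 scaleC_minus_one scaleC_scaleC)

lemma scaleC_sum_right: "c *\<^sub>C (\<Sum>i\<in>I. f i) = (\<Sum>i\<in>I. c *\<^sub>C f i)"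
  for f :: "'i \<Rightarrow> 'a::complex_vector"
  by (induction I rule: infinite_finite_induct) (simp_all add: scaleC_add_right)

lemma scaleC_sum_left: "(\<Sum>i\<in>I. c i) *\<^sub>C x = (\<Sum>i\<in>I. c i *\<^sub>C x)"
  for x :: "'a::complex_vector"
  by (induction I rule: infinite_finite_induct) (simp_all add: scaleC_add_left)

lemma scaleC_scaleR: "c *\<^sub>C (r *\<^sub>R x) = r *\<^sub>R (c *\<^sub>C x)" for x :: "'a::complex_vector"
  by (simp add: scaleR_scaleC scaleC_scaleC mult.commute)

lemmas scaleC_mult_simps = mult_scaleC_left mult_scaleC_right scaleC_scaleC

lemma star_zero: "star (0 :: 'a::involutive_algebra) = 0"
  using star_add [of "0::'a" 0] by simp

lemma star_minus: "star (- x) = - star x" for x :: "'a::involutive_algebra"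
  by (metis add.right_inverse minus_unique star_add star_zero)

lemma star_diff: "star (x - y) = star x - star y" for x :: "'a::involutive_algebra"
  using star_add [of x "- y"] by (simp add: star_minus)

lemma star_scaleR: "star (r *\<^sub>R x) = r *\<^sub>R star x" for x :: "'a::involutive_algebra"
  by (simp add: scaleR_scaleC star_scaleC)

lemma star_sum: "star (\<Sum>i\<in>I. f i) = (\<Sum>i\<in>I. star (f i))" for f :: "'i \<Rightarrow> 'a::involutive_algebra"
  by (induction I rule: infinite_finite_induct) (simp_all add: star_add star_zero)

lemma star_one: "star (1 :: 'a::{involutive_algebra, monoid_mult}) = 1"
  by (metis mult.left_neutral mult.right_neutral star_mult star_star)

lemma star_power: "star (x ^ n) = star x ^ n" for x :: "'a::{involutive_algebra, monoid_mult}"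
  by (induction n) (simp_all add: star_one star_mult power_commutes)

lemma tendsto_star:
  fixes f :: "'i \<Rightarrow> 'a::banach_star_algebra"
  assumes "(f \<longlongrightarrow> l) F" shows "((\<lambda>x. star (f x)) \<longlongrightarrow> star l) F"
  using assms by (simp add: tendsto_iff dist_norm norm_star flip: star_diff)

section \<open>Polynomials with vector coefficients\<close>

lemma primitive_root_of_unity:
  assumes "N > 0"
  obtains \<omega> :: complex where "cmod \<omega> = 1" and "\<omega> ^ N = 1"
    and "\<And>e. 0 < e \<Longrightarrow> e < N \<Longrightarrow> \<omega> ^ e \<noteq> 1"
proof
  let ?w = "exp (2 * of_real pi * \<i> / of_nat N)"
  have pw: "?w ^ e = exp (2 * of_real pi * \<i> * of_nat e / of_nat N)" for e
    by (simp add: exp_of_nat_mult [symmetric] field_simps)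
  show "?w ^ N = 1" using assms pw [of N] by simp
  show "?w ^ e \<noteq> 1" if "0 < e" "e < N" for e
    using complex_root_unity_eq_1 [of N e] assms that pw [of e] by (auto dest: dvd_imp_le)
  show "cmod ?w = 1" by (simp add: norm_exp_eq_Re)
qed

lemma roots_of_unity_orthogonal:
  assumes "cmod \<omega> = 1" "\<omega> ^ N = 1" "\<And>e. 0 < e \<Longrightarrow> e < N \<Longrightarrow> \<omega> ^ e \<noteq> 1"
    and "k < N" "m < N"
  shows "(\<Sum>j<N. cnj (\<omega> ^ j) ^ m * (\<omega> ^ j) ^ k) = (if k = m then of_nat N else 0)"
proof -
  have inv: "cnj \<omega> * \<omega> = 1"
    using complex_norm_square [of \<omega>] assms(1) by (simp add: mult.commute)
  have zero: "(\<Sum>j<N. (\<omega> ^ e) ^ j) = 0" if "0 < e" "e < N" for e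
  proof -
    have "(\<omega> ^ e) ^ N = 1"
      using assms(2) by (metis mult.commute power_mult power_one)
    then show ?thesis
      using assms(3) [OF that] geometric_sum [of "\<omega> ^ e" N] by simp
  qed
  have cc: "cnj \<omega> ^ n * \<omega> ^ n = 1" for n by (metis inv power_mult_distrib power_one)
  consider "k = m" | "m < k" | "k < m" by linarith
  then show ?thesis
  proof cases
    case 1
    have "cnj (\<omega> ^ j) ^ m * (\<omega> ^ j) ^ m = 1" for j
      using cc [of "j * m"] by (simp add: power_mult)
    then show ?thesis using 1 by simp
  next
    case 2
    have "cnj (\<omega> ^ j) ^ m * (\<omega> ^ j) ^ k = (\<omega> ^ (k - m)) ^ j" for j
    proof -
      have "(\<omega> ^ j) ^ k = \<omega> ^ (j * m) * (\<omega> ^ (k - m)) ^ j"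
        using 2 by (simp flip: power_mult power_add add: algebra_simps)
      then show ?thesis using cc [of "j * m"] by (simp add: power_mult mult.assoc [symmetric])
    qed
    then show ?thesis using 2 zero [of "k - m"] assms(4) by simp
  next
    case 3
    have "cnj (\<omega> ^ j) ^ m * (\<omega> ^ j) ^ k = cnj ((\<omega> ^ (m - k)) ^ j)" for j
    proof -
      have "cnj (\<omega> ^ j) ^ m = cnj \<omega> ^ (j * k) * cnj ((\<omega> ^ (m - k)) ^ j)"
        using 3 by (simp flip: power_mult power_add add: algebra_simps)
      then show ?thesis using cc [of "j * k"] by (simp add: power_mult mult.assoc mult.commute mult.left_commute)
    qed
    then have "(\<Sum>j<N. cnj (\<omega> ^ j) ^ m * (\<omega> ^ j) ^ k) = cnj (\<Sum>j<N. (\<omega> ^ (m - k)) ^ j)"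
      by simp
    then show ?thesis using 3 zero [of "m - k"] assms(5) by simp
  qed
qed

lemma coefficient_average:
  fixes c :: "nat \<Rightarrow> 'a::complex_vector"
  assumes "cmod \<omega> = 1" "\<omega> ^ N = 1" "\<And>e. 0 < e \<Longrightarrow> e < N \<Longrightarrow> \<omega> ^ e \<noteq> 1" and "m < N"
  shows "(\<Sum>j<N. cnj (\<omega> ^ j) ^ m *\<^sub>C (\<Sum>k<N. (\<omega> ^ j) ^ k *\<^sub>C c k)) = real N *\<^sub>R c m"
proof -
  have "(\<Sum>j<N. cnj (\<omega> ^ j) ^ m *\<^sub>C (\<Sum>k<N. (\<omega> ^ j) ^ k *\<^sub>C c k))
      = (\<Sum>k<N. (\<Sum>j<N. cnj (\<omega> ^ j) ^ m * (\<omega> ^ j) ^ k) *\<^sub>C c k)"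
    by (simp only: scaleC_sum_right scaleC_scaleC scaleC_sum_left) (rule sum.swap)
  also have "\<dots> = (\<Sum>k<N. (if k = m then of_nat N else 0) *\<^sub>C c k)"
    using roots_of_unity_orthogonal [OF assms(1-3) _ assms(4)] by (intro sum.cong) auto
  also have "\<dots> = (\<Sum>k<N. if k = m then of_nat N *\<^sub>C c m else 0)"
    by (intro sum.cong) auto
  also have "\<dots> = real N *\<^sub>R c m" using assms(4) by (simp add: scaleR_scaleC)
  finally show ?thesis .
qed

text \<open>The coefficient \<open>c m\<close> is the mean of \<open>cnj z ^ m\<close> times the polynomial over the \<open>N\<close>-th roots of
unity, so it is bounded by the maximum on the circle. A finite mean does the work of a contour
integral here.\<close>

lemma cauchy_estimate:
  fixes c :: "nat \<Rightarrow> 'a::complex_normed_vector"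
  assumes bound: "\<And>z. cmod z = 1 \<Longrightarrow> norm (\<Sum>k<N. z ^ k *\<^sub>C c k) \<le> B" and "m < N"
  shows "norm (c m) \<le> B"
proof -
  have "N > 0" using assms(2) by simp
  then obtain \<omega> where w: "cmod \<omega> = 1" "\<omega> ^ N = 1" "\<And>e. 0 < e \<Longrightarrow> e < N \<Longrightarrow> \<omega> ^ e \<noteq> 1"
    using primitive_root_of_unity by blast
  have "real N * norm (c m) = norm (\<Sum>j<N. cnj (\<omega> ^ j) ^ m *\<^sub>C (\<Sum>k<N. (\<omega> ^ j) ^ k *\<^sub>C c k))"
    using coefficient_average [OF w assms(2), of c] by simp
  also have "\<dots> \<le> (\<Sum>j<N. B)"
  proof (rule sum_norm_le)
    fix j
    have "norm (cnj (\<omega> ^ j) ^ m *\<^sub>C (\<Sum>k<N. (\<omega> ^ j) ^ k *\<^sub>C c k)) = norm (\<Sum>k<N. (\<omega> ^ j) ^ k *\<^sub>C c k)"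
      using w(1) by (simp add: norm_scaleC norm_power)
    also have "\<dots> \<le> B" using w(1) by (intro bound) (simp add: norm_power)
    finally show "norm (cnj (\<omega> ^ j) ^ m *\<^sub>C (\<Sum>k<N. (\<omega> ^ j) ^ k *\<^sub>C c k)) \<le> B" .
  qed
  finally show ?thesis using \<open>N > 0\<close> by simp
qed

lemma power_one_plus_expansion:
  fixes z :: "'a::{complex_normed_algebra, monoid_mult}"
  assumes "m > 0"
  shows "\<exists>c. c 1 = real m *\<^sub>R z \<and> (\<forall>\<zeta>. (1 + \<zeta> *\<^sub>C z) ^ m = (\<Sum>k<Suc m. \<zeta> ^ k *\<^sub>C c k))"
proof -
  have "\<exists>c. c 0 = 1 \<and> c 1 = real m *\<^sub>R z \<and> (\<forall>k>m. c k = 0) \<and>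
    (\<forall>\<zeta>. (1 + \<zeta> *\<^sub>C z) ^ m = (\<Sum>k<Suc m. \<zeta> ^ k *\<^sub>C c k))"
  proof (induction m)
    case 0
    show ?case by (rule exI [of _ "\<lambda>k. if k = 0 then 1 else 0"]) (simp add: scaleC_one)
  next
    case (Suc m)
    then obtain c where c: "c 0 = 1" "c 1 = real m *\<^sub>R z" "\<And>k. k > m \<Longrightarrow> c k = 0"
      and e: "\<And>\<zeta>. (1 + \<zeta> *\<^sub>C z) ^ m = (\<Sum>k<Suc m. \<zeta> ^ k *\<^sub>C c k)" by blast
    define d where "d = (\<lambda>k. c k + (case k of 0 \<Rightarrow> 0 | Suc k \<Rightarrow> z * c k))"
    have "(1 + \<zeta> *\<^sub>C z) ^ Suc m = (\<Sum>k<Suc (Suc m). \<zeta> ^ k *\<^sub>C d k)" for \<zeta>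
    proof -
      have "(1 + \<zeta> *\<^sub>C z) ^ Suc m
          = (\<Sum>k<Suc m. \<zeta> ^ k *\<^sub>C c k) + \<zeta> *\<^sub>C z * (\<Sum>k<Suc m. \<zeta> ^ k *\<^sub>C c k)"
        by (simp add: e distrib_right)
      also have "(\<Sum>k<Suc m. \<zeta> ^ k *\<^sub>C c k) = (\<Sum>k<Suc (Suc m). \<zeta> ^ k *\<^sub>C c k)"
        using c(3) [of "Suc m"] by simp
      also have "\<zeta> *\<^sub>C z * \<dots> = (\<Sum>k<Suc m. \<zeta> ^ Suc k *\<^sub>C (z * c k))"
        using c(3) [of "Suc m"] by (simp add: sum_distrib_left scaleC_mult_simps mult.commute distrib_left scaleC_add_right)
      also have "\<dots> = (\<Sum>k<Suc (Suc m). \<zeta> ^ k *\<^sub>C (case k of 0 \<Rightarrow> 0 | Suc k \<Rightarrow> z * c k))"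
        by (subst (2) sum.lessThan_Suc_shift) simp
      finally show ?thesis by (simp only: d_def scaleC_add_right sum.distrib)
    qed
    moreover have "d 0 = 1" "d 1 = real (Suc m) *\<^sub>R z" "\<And>k. k > Suc m \<Longrightarrow> d k = 0"
      using c by (auto simp: d_def scaleR_add_left split: nat.split)
    ultimately show ?case by (intro exI [of _ d]) blast
  qed
  then show ?thesis by blast
qed

lemma norm_power_le: "m > 0 \<Longrightarrow> norm (x ^ m) \<le> norm x ^ m"
  for x :: "'a::{complex_normed_algebra, monoid_mult}"
proof (induction m)
  case (Suc m)
  show ?case
  proof (cases "m = 0")
    case False
    have "norm (x ^ Suc m) \<le> norm x * norm (x ^ m)" by (simp add: norm_mult_ineq)
    also have "\<dots> \<le> norm x * norm x ^ m" using Suc False by (intro mult_left_mono) auto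
    finally show ?thesis by simp
  qed simp
qed simp

text \<open>A quantitative form of the theorem of Bohnenblust and Karlin that the unit is a vertex of the
unit ball: the coefficient of \<open>\<zeta>\<close> in \<open>(1 + \<zeta> z) ^ m\<close> is \<open>m z\<close>, while the norm of the power is at
most \<open>(1 + \<beta>) ^ m\<close>. Taking \<open>m\<close> close to \<open>1 / \<beta>\<close> keeps this power bounded. In the tensor product,
it turns estimates of second order into smallness.\<close>

lemma small_if_perturbs_one_little:
  fixes z :: "'a::{complex_normed_algebra, monoid_mult}"
  assumes "\<And>\<zeta>. cmod \<zeta> = 1 \<Longrightarrow> norm (1 + \<zeta> *\<^sub>C z) \<le> 1 + \<beta>" and \<beta>: "0 < \<beta>" "\<beta> \<le> 1"
  shows "norm z \<le> 9 * \<beta>"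
proof -
  define m where "m = nat \<lceil>1 / \<beta>\<rceil>"
  have m: "1 / \<beta> \<le> real m" "real m \<le> 1 / \<beta> + 1" "m > 0"
    using \<beta> by (auto simp: m_def of_nat_nat) 
  obtain c where c: "c 1 = real m *\<^sub>R z" 
    and e: "\<And>\<zeta>. (1 + \<zeta> *\<^sub>C z) ^ m = (\<Sum>k<Suc m. \<zeta> ^ k *\<^sub>C c k)"
    using power_one_plus_expansion [OF m(3), of z] by blast
  have "norm (c 1) \<le> (1 + \<beta>) ^ m"
  proof (rule cauchy_estimate)
    show "norm (\<Sum>k<Suc m. \<zeta> ^ k *\<^sub>C c k) \<le> (1 + \<beta>) ^ m" if "cmod \<zeta> = 1" for \<zeta>
    proof -
      have "norm ((1 + \<zeta> *\<^sub>C z) ^ m) \<le> norm (1 + \<zeta> *\<^sub>C z) ^ m" by (rule norm_power_le [OF m(3)])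
      also have "\<dots> \<le> (1 + \<beta>) ^ m" using assms(1) [OF that] by (rule power_mono) simp
      finally show ?thesis by (simp only: e)
    qed
  qed (use m in simp)
  then have "real m * norm z \<le> (1 + \<beta>) ^ m" using c by simp
  also have "\<dots> \<le> exp \<beta> ^ m" using \<beta> by (intro power_mono exp_ge_add_one_self) auto
  also have "\<dots> = exp (real m * \<beta>)" by (simp add: exp_of_nat_mult)
  also have "\<dots> \<le> exp 2"
  proof -
    have "real m * \<beta> \<le> (1 / \<beta> + 1) * \<beta>" using m \<beta> by (intro mult_right_mono) auto
    also have "\<dots> \<le> 2" using \<beta> by (simp add: field_simps)
    finally show ?thesis by simp
  qed
  also have "exp 2 \<le> (9::real)"
  proof -
    have "exp 2 = exp 1 * exp (1::real)" by (simp flip: exp_add)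
    also have "\<dots> \<le> 3 * 3" by (intro mult_mono exp_le) auto
    finally show ?thesis by simp
  qed
  finally have "real m * norm z \<le> 9" .
  moreover have "1 / \<beta> * norm z \<le> real m * norm z" using m by (intro mult_right_mono) auto
  ultimately have "1 / \<beta> * norm z \<le> 9" by linarith
  then show ?thesis using \<beta> by (simp add: field_simps)
qed

section \<open>Elementary norm estimates in C*-algebras\<close>

lemma norm_unitary: "u \<in> unitaries \<Longrightarrow> norm u = 1" for u :: "'a::unital_cstar_algebra"
  using cstar_identity [of u] by (simp add: unitaries_def power2_eq_1_iff) (metis norm_ge_zero not_one_le_zero neg_0_le_iff_le order_trans zero_le_one)

lemma unitary_star: "u \<in> unitaries \<Longrightarrow> star u \<in> unitaries"
  by (simp add: unitaries_def star_star)

lemma unitary_one: "1 \<in> (unitaries :: 'a::{banach_star_algebra, monoid_mult} set)"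
  by (simp add: unitaries_def star_one)

lemma unitary_mult: "u \<in> unitaries \<Longrightarrow> v \<in> unitaries \<Longrightarrow> u * v \<in> unitaries"
  unfolding unitaries_def mem_Collect_eq star_mult
  by (metis mult.assoc mult.left_neutral)

lemma unitary_scaleC:
  assumes "u \<in> unitaries" "cmod c = 1" shows "c *\<^sub>C u \<in> unitaries"
proof -
  have "cnj c * c = 1" using complex_norm_square [of c] assms(2) by (simp add: mult.commute)
  then show ?thesis
    using assms(1) by (simp add: unitaries_def star_scaleC scaleC_mult_simps mult.commute [of c] scaleC_one)
qed

lemma unitary_minus: "u \<in> unitaries \<Longrightarrow> - u \<in> unitaries"
  using unitary_scaleC [of u "- 1"] by (simp add: scaleC_minus_one)

lemma unitary_power: "u \<in> unitaries \<Longrightarrow> u ^ n \<in> unitaries"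
  by (induction n) (simp_all add: unitary_one unitary_mult)

lemma le_one_plus_half: "N \<le> 1 + y / 2" if "N\<^sup>2 \<le> 1 + y" for N y :: real
proof (rule power2_le_imp_le)
  show "N\<^sup>2 \<le> (1 + y / 2)\<^sup>2" 
  proof -
    have "(1 + y / 2)\<^sup>2 = 1 + y + (y / 2)\<^sup>2" by (simp add: power2_eq_square field_simps)
    then show ?thesis using that zero_le_power2 [of "y / 2"] by linarith
  qed
  have "0 \<le> N\<^sup>2" by simp
  then show "0 \<le> 1 + y / 2" using that by linarith
qed

text \<open>The adjoint of \<open>1 + k\<close> is \<open>1 - k\<close>, so the C*-identity removes the first-order term.\<close>

lemma norm_one_plus_skew:
  fixes k :: "'a::unital_cstar_algebra"
  assumes "star k = - k" shows "norm (1 + k) \<le> 1 + (norm k)\<^sup>2 / 2"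
proof (rule le_one_plus_half)
  have "(norm (1 + k))\<^sup>2 = norm (1 - k * k)"
    using assms by (simp add: cstar_identity [symmetric] star_add star_one algebra_simps)
  also have "\<dots> \<le> 1 + norm (k * k)" using norm_triangle_ineq4 [of 1 "k * k"] by simp
  also have "\<dots> \<le> 1 + (norm k)\<^sup>2" using norm_mult_ineq [of k k] by (simp add: power2_eq_square)
  finally show "(norm (1 + k))\<^sup>2 \<le> 1 + (norm k)\<^sup>2" .
qed

text \<open>Second-order Taylor expansion of the unitary \<open>exp (\<i> \<surd>(2\<tau>) h)\<close>: its truncation \<open>N\<close> satisfies
\<open>star N * N = 1 + \<tau>\<^sup>2 h ^ 4\<close>, and the left-hand side is the real part of \<open>N\<close>. This says that
\<open>h * h\<close> is positive without any spectral theory.\<close>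

lemma norm_one_minus_square:
  fixes h :: "'a::unital_cstar_algebra"
  assumes h: "star h = h" and \<tau>: "\<tau> \<ge> 0"
  shows "norm (1 - \<tau> *\<^sub>R (h * h)) \<le> 1 + \<tau>\<^sup>2 * norm h ^ 4 / 2"
proof -
  define N where "N = 1 - \<tau> *\<^sub>R (h * h) + (\<i> * sqrt (2 * \<tau>)) *\<^sub>C h"
  have sN: "star N = 1 - \<tau> *\<^sub>R (h * h) - (\<i> * sqrt (2 * \<tau>)) *\<^sub>C h"
    by (simp add: N_def star_add star_diff star_one star_scaleR star_scaleC star_mult h scaleC_minus_left)
  have sq: "((\<i> * sqrt (2 * \<tau>)) *\<^sub>C h) * ((\<i> * sqrt (2 * \<tau>)) *\<^sub>C h) = - (2 * \<tau>) *\<^sub>R (h * h)"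
  proof -
    have "(\<i> * sqrt (2 * \<tau>)) * (\<i> * sqrt (2 * \<tau>)) = (\<i> * \<i>) * complex_of_real (sqrt (2 * \<tau>) * sqrt (2 * \<tau>))"
      by (simp only: of_real_mult ac_simps)
    also have "\<dots> = complex_of_real (- (2 * \<tau>))"
      using \<tau> by simp
    finally show ?thesis by (simp add: scaleC_mult_simps scaleR_scaleC)
  qed
  have "(norm N)\<^sup>2 = norm (star N * N)" by (simp add: cstar_identity)
  also have "star N * N = (1 - \<tau> *\<^sub>R (h * h)) * (1 - \<tau> *\<^sub>R (h * h))
      - ((\<i> * sqrt (2 * \<tau>)) *\<^sub>C h) * ((\<i> * sqrt (2 * \<tau>)) *\<^sub>C h)"
  proof -
    have "(h * h) * (c *\<^sub>C h) = (c *\<^sub>C h) * (h * h)" for c by (simp add: scaleC_mult_simps mult.assoc)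
    then show ?thesis unfolding sN by (simp add: N_def distrib_left distrib_right left_diff_distrib right_diff_distrib
        scaleR_add_right scaleR_diff_right)
  qed
  also have "\<dots> = 1 + \<tau>\<^sup>2 *\<^sub>R (h * h * h * h)"
  proof -
    have "(1 - X) * (1 - X) - - (2 *\<^sub>R X) = 1 + X * X" for X :: 'a
      by (simp add: algebra_simps scaleR_2)
    from this [of "\<tau> *\<^sub>R (h * h)"] show ?thesis
      unfolding sq by (simp add: power2_eq_square mult.assoc)
  qed
  also have "norm \<dots> \<le> 1 + \<tau>\<^sup>2 * norm h ^ 4"
  proof -
    have "norm (h * h * h * h) \<le> norm h * norm h * norm h * norm h"
      by (intro order_trans [OF norm_mult_ineq] mult_mono norm_mult_ineq mult_nonneg_nonneg norm_ge_zero order_refl)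
    then have "\<tau>\<^sup>2 * norm (h * h * h * h) \<le> \<tau>\<^sup>2 * norm h ^ 4"
      by (intro mult_left_mono) (simp_all add: power4_eq_xxxx)
    then show ?thesis using norm_triangle_ineq [of 1 "\<tau>\<^sup>2 *\<^sub>R (h * h * h * h)"] by simp
  qed
  finally have N: "norm N \<le> 1 + \<tau>\<^sup>2 * norm h ^ 4 / 2" by (rule le_one_plus_half)
  have "2 *\<^sub>R (1 - \<tau> *\<^sub>R (h * h)) = N + star N" by (simp add: sN) (simp add: N_def scaleR_2)
  then have "2 * norm (1 - \<tau> *\<^sub>R (h * h)) = norm (N + star N)" by (metis norm_scaleR abs_numeral)
  also have "\<dots> \<le> 2 * norm N" using norm_triangle_ineq [of N "star N"] by (simp add: norm_star)
  finally show ?thesis using N by simp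
qed

text \<open>For \<open>z = h + \<i> k\<close> with \<open>h\<close> and \<open>k\<close> self-adjoint, \<open>star z * z + z * star z\<close> is twice the sum of the
squares of \<open>h\<close> and \<open>k\<close>. The symmetrised product is used because positivity of
\<open>star z * z\<close> alone is a deeper fact when \<open>z\<close> is not normal.\<close>

lemma norm_one_minus_jordan_square:
  fixes z :: "'a::unital_cstar_algebra"
  assumes \<tau>: "\<tau> \<ge> 0"
  shows "norm (1 - \<tau> *\<^sub>R (star z * z + z * star z)) \<le> 1 + 8 * \<tau>\<^sup>2 * norm z ^ 4"
proof -
  define h where "h = (1/2) *\<^sub>R (z + star z)"
  define k where "k = (- \<i> / 2) *\<^sub>C (z - star z)"
  have sh: "star h = h" by (simp add: h_def star_scaleR star_add star_star add.commute)
  have sk: "star k = k"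
    by (simp add: k_def star_scaleC star_diff star_star scaleC_diff_right scaleC_minus_left)
  have nh: "norm h \<le> norm z" using norm_triangle_ineq [of z "star z"] by (simp add: h_def norm_star)
  have nk: "norm k \<le> norm z"
    using norm_triangle_ineq4 [of z "star z"] by (simp add: k_def norm_star norm_scaleC norm_divide)
  have kk: "k * k = - (1/4) *\<^sub>R ((z - star z) * (z - star z))"
    by (simp add: k_def scaleC_mult_simps scaleR_scaleC)
  have hk: "h * h + k * k = (1/2) *\<^sub>R (star z * z + z * star z)"
  proof -
    have "h * h + k * k = (1/4) *\<^sub>R ((z + star z) * (z + star z) - (z - star z) * (z - star z))"
      unfolding kk by (simp add: h_def scaleR_diff_right)
    also have "(z + star z) * (z + star z) - (z - star z) * (z - star z) = 2 *\<^sub>R (star z * z + z * star z)"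
      by (simp add: algebra_simps scaleR_2)
    finally show ?thesis by simp
  qed
  have "2 *\<^sub>R (1 - \<tau> *\<^sub>R (star z * z + z * star z)) = (1 - (4 * \<tau>) *\<^sub>R (h * h)) + (1 - (4 * \<tau>) *\<^sub>R (k * k))"
  proof -
    have "(4 * \<tau>) *\<^sub>R (h * h) + (4 * \<tau>) *\<^sub>R (k * k) = (2 * \<tau>) *\<^sub>R (star z * z + z * star z)"
      by (simp add: hk flip: scaleR_add_right)
    then show ?thesis by (simp add: scaleR_2 scaleR_diff_right algebra_simps)
  qed
  then have "2 * norm (1 - \<tau> *\<^sub>R (star z * z + z * star z))
      \<le> norm (1 - (4 * \<tau>) *\<^sub>R (h * h)) + norm (1 - (4 * \<tau>) *\<^sub>R (k * k))"
    by (metis norm_scaleR abs_numeral norm_triangle_ineq)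
  also have "\<dots> \<le> (1 + (4 * \<tau>)\<^sup>2 * norm h ^ 4 / 2) + (1 + (4 * \<tau>)\<^sup>2 * norm k ^ 4 / 2)"
    using \<tau> by (intro add_mono norm_one_minus_square sh sk) auto
  also have "\<dots> \<le> (1 + (4 * \<tau>)\<^sup>2 * norm z ^ 4 / 2) + (1 + (4 * \<tau>)\<^sup>2 * norm z ^ 4 / 2)"
    using nh nk by (intro add_mono divide_right_mono mult_left_mono power_mono order_refl) auto
  finally show ?thesis by (simp add: power_mult_distrib)
qed

section \<open>States\<close>

definition sublinear :: "('a::real_vector \<Rightarrow> real) \<Rightarrow> bool"
  where "sublinear p \<longleftrightarrow> (\<forall>x y. p (x + y) \<le> p x + p y) \<and> (\<forall>r x. 0 \<le> r \<longrightarrow> p (r *\<^sub>R x) = r * p x)"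

lemma sublinear_lower: "sublinear p \<Longrightarrow> - p (- x) \<le> p x"
proof -
  assume p: "sublinear p"
  then have "p (0 *\<^sub>R x) = 0 * p x" unfolding sublinear_def by blast
  then have "p 0 = 0" by simp
  moreover have "p (x + - x) \<le> p x + p (- x)" using p unfolding sublinear_def by blast
  ultimately show ?thesis by simp
qed

text \<open>The infimum of \<open>p (x + t y) - t p y\<close> over \<open>t \<ge> 0\<close> is the step of the Hahn-Banach theorem. It is
used twice: to make a minimal sublinear functional linear, and to prescribe the value of the
functional at one point.\<close>

lemma sublinear_descend:
  assumes p: "sublinear p"
  obtains q where "sublinear q" "\<And>x. q x \<le> p x" "q (- y) \<le> - p y"
proof -
  have add: "p (x + y) \<le> p x + p y" and scale: "0 \<le> r \<Longrightarrow> p (r *\<^sub>R x) = r * p x" for x y r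
    using p unfolding sublinear_def by blast+
  define V where "V = (\<lambda>x. (\<lambda>t. p (x + t *\<^sub>R y) - t * p y) ` {0..})"
  define q where "q = (\<lambda>x. Inf (V x))"
  have ne: "V x \<noteq> {}" for x by (auto simp: V_def)
  have bdd: "bdd_below (V x)" for x
  proof (rule bdd_belowI)
    fix v assume "v \<in> V x"
    then obtain t where t: "t \<ge> 0" "v = p (x + t *\<^sub>R y) - t * p y" by (auto simp: V_def)
    show "- p (- x) \<le> v"
      using add [of "x + t *\<^sub>R y" "- x"] scale [of t y] t by simp
  qed
  have le: "q x \<le> p (x + t *\<^sub>R y) - t * p y" if "t \<ge> 0" for x t
    unfolding q_def by (rule cInf_lower [OF _ bdd]) (use that in \<open>auto simp: V_def\<close>)
  have ge: "c \<le> q x" if "\<And>t. t \<ge> 0 \<Longrightarrow> c \<le> p (x + t *\<^sub>R y) - t * p y" for c x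
    unfolding q_def by (rule cInf_greatest [OF ne]) (use that in \<open>auto simp: V_def\<close>)
  have "q (x + x') \<le> q x + q x'" for x x'
  proof -
    have *: "q (x + x') \<le> (p (x + t *\<^sub>R y) - t * p y) + (p (x' + t' *\<^sub>R y) - t' * p y)"
      if "t \<ge> 0" "t' \<ge> 0" for t t'
      using le [of "t + t'" "x + x'"] add [of "x + t *\<^sub>R y" "x' + t' *\<^sub>R y"] that
      by (simp add: algebra_simps)
    have "q (x + x') - (p (x' + t' *\<^sub>R y) - t' * p y) \<le> q x" if "t' \<ge> 0" for t'
      by (rule ge) (use * that in \<open>force simp: algebra_simps\<close>)
    then have "q (x + x') - q x \<le> q x'"
      by (intro ge) (force simp: algebra_simps)
    then show ?thesis by simp
  qed
  moreover have "q (r *\<^sub>R x) = r * q x" if r: "0 \<le> r" for r x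
  proof (cases "r = 0")
    case True
    have "q 0 \<le> 0" using le [of 0 0] scale [of 0 0] by simp
    moreover have "0 \<le> q 0" by (rule ge) (simp add: scale)
    ultimately show ?thesis using True by simp
  next
    case False
    then have r: "r > 0" using r by simp
    have le': "q (r *\<^sub>R x) \<le> r * q x" if r: "r > 0" for r x
    proof -
      have "q (r *\<^sub>R x) / r \<le> q x"
      proof (rule ge)
        fix t :: real assume t: "t \<ge> 0"
        have "q (r *\<^sub>R x) \<le> p (r *\<^sub>R (x + t *\<^sub>R y)) - (r * t) * p y"
          using le [of "r * t" "r *\<^sub>R x"] r t by (simp add: scaleR_add_right)
        also have "\<dots> = r * (p (x + t *\<^sub>R y) - t * p y)"
          using r by (subst scale) (auto simp: algebra_simps)
        finally show "q (r *\<^sub>R x) / r \<le> p (x + t *\<^sub>R y) - t * p y"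
          using r by (simp add: field_simps)
      qed
      then show ?thesis using r by (simp add: field_simps)
    qed
    have "q (inverse r *\<^sub>R (r *\<^sub>R x)) \<le> inverse r * q (r *\<^sub>R x)" using r by (intro le') simp
    then have "r * q x \<le> q (r *\<^sub>R x)" using r by (simp add: field_simps)
    with le' [OF r, of x] show ?thesis by simp
  qed
  ultimately have "sublinear q" by (simp add: sublinear_def)
  moreover have "q x \<le> p x" for x using le [of 0 x] by simp
  moreover have "q (- y) \<le> - p y" using le [of 1 "- y"] scale [of 0 0] by simp
  ultimately show thesis by (rule that)
qed

text \<open>Zorn's lemma for the reversed pointwise order: the infimum of a chain is again sublinear,
because of two members of the chain the smaller one controls both summands.\<close>

lemma minimal_sublinear:
  fixes p :: "'a::real_vector \<Rightarrow> real"
  assumes p: "sublinear p"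
  obtains q where "sublinear q" "\<And>x. q x \<le> p x"
    "\<And>q'. sublinear q' \<Longrightarrow> (\<And>x. q' x \<le> q x) \<Longrightarrow> q' = q"
proof -
  define A where "A = {q. sublinear q \<and> q \<le> p}"
  have "\<exists>m\<in>A. \<forall>a\<in>A. m \<ge> a \<longrightarrow> a = m"
  proof (rule predicate_Zorn)
    show "partial_order_on A (relation_of (\<ge>) A)"
      by (auto simp: partial_order_on_def preorder_on_def refl_on_def trans_def antisym_def relation_of_def)
    fix C assume "C \<in> Chains (relation_of (\<ge>) A)"
    then have C: "C \<subseteq> A" and chain: "\<And>q q'. q \<in> C \<Longrightarrow> q' \<in> C \<Longrightarrow> q \<le> q' \<or> q' \<le> q"
      by (auto simp: Chains_def relation_of_def)
    show "\<exists>u\<in>A. \<forall>a\<in>C. u \<le> a"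
    proof (cases "C = {}")
      case True
      then show ?thesis using p by (auto simp: A_def)
    next
      case False
      define u where "u = (\<lambda>x. INF q\<in>C. q x)"
      have sub: "sublinear q" "q \<le> p" if "q \<in> C" for q using that C by (auto simp: A_def)
      have "- p (- x) \<le> q x" if "q \<in> C" for q x
        using sublinear_lower [OF sub(1) [OF that], of x] sub(2) [OF that] le_funD [of q p "- x"] by simp
      then have bdd: "bdd_below ((\<lambda>q. q x) ` C)" for x by (intro bdd_belowI [of _ "- p (- x)"]) auto
      have le: "u x \<le> q x" if "q \<in> C" for q x
        unfolding u_def by (rule cINF_lower [OF bdd that])
      have ge: "c \<le> u x" if "\<And>q. q \<in> C \<Longrightarrow> c \<le> q x" for c x
        unfolding u_def by (rule cINF_greatest [OF False that])
      have "u (x + y) \<le> u x + u y" for x y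
      proof -
        have *: "u (x + y) \<le> q x + q' y" if qq: "q \<in> C" "q' \<in> C" for q q'
        proof -
          obtain r where r: "r \<in> C" "r \<le> q" "r \<le> q'" using chain [OF qq] qq by blast
          have "u (x + y) \<le> r (x + y)" by (rule le [OF r(1)])
          also have "\<dots> \<le> r x + r y" using sub(1) [OF r(1)] by (simp add: sublinear_def)
          also have "\<dots> \<le> q x + q' y" using r(2,3) by (intro add_mono) (auto dest: le_funD)
          finally show ?thesis .
        qed
        have "u (x + y) - q' y \<le> u x" if "q' \<in> C" for q'
          by (rule ge) (use * that in \<open>force simp: algebra_simps\<close>)
        then have "u (x + y) - u x \<le> u y" by (intro ge) (force simp: algebra_simps)
        then show ?thesis by simp
      qed
      moreover have "u (r *\<^sub>R x) = r * u x" if r: "0 \<le> r" for r x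
      proof -
        have q: "q (r *\<^sub>R x) = r * q x" if "q \<in> C" for q
          using sub(1) [OF that] r by (simp add: sublinear_def)
        show ?thesis
        proof (cases "r = 0")
          case True
          have "(\<lambda>q. q 0) ` C = (\<lambda>q. 0) ` C" using q [unfolded True] by (intro image_cong) auto
          also have "\<dots> = {0}" using \<open>C \<noteq> {}\<close> by auto
          finally have "(\<lambda>q. q 0) ` C = {0}" .
          then show ?thesis using True by (simp add: u_def)
        next
          case False
          then have r: "r > 0" using r by simp
          have "u (r *\<^sub>R x) / r \<le> u x"
            by (rule ge) (use r q le in \<open>force simp: field_simps\<close>)
          moreover have "r * u x \<le> u (r *\<^sub>R x)"
            by (rule ge) (use r q le in \<open>force simp: field_simps\<close>)
          ultimately show ?thesis using r by (simp add: field_simps)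
        qed
      qed
      ultimately have "sublinear u" by (simp add: sublinear_def)
      moreover have "u \<le> p"
      proof -
        obtain q where "q \<in> C" using False by blast
        then show ?thesis using le sub(2) by (meson le_funI le_funD order_trans)
      qed
      ultimately have "u \<in> A" by (simp add: A_def)
      then show ?thesis using le by (auto intro!: le_funI)
    qed
  qed
  then obtain m where m: "m \<in> A" "\<And>a. a \<in> A \<Longrightarrow> a \<le> m \<Longrightarrow> a = m" by blast
  show thesis
  proof (rule that)
    show "sublinear m" "m x \<le> p x" for x using m(1) by (auto simp: A_def le_fun_def)
    show "q' = m" if "sublinear q'" "\<And>x. q' x \<le> m x" for q'
      using m that by (auto simp: A_def le_fun_def intro: order_trans)
  qed
qed

text \<open>The Hahn-Banach theorem: descending in the direction of \<open>x\<close> does not change a minimal sublinear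
functional \<open>g\<close>, which forces \<open>g (- x) = - g x\<close>.\<close>

lemma dominated_linear_functional:
  fixes p :: "'a::real_vector \<Rightarrow> real"
  assumes "sublinear p"
  obtains g where "\<And>x y. g (x + y) = g x + g y" "\<And>r x. g (r *\<^sub>R x) = r * g x" "\<And>x. g x \<le> p x"
proof -
  obtain g where g: "sublinear g" "\<And>x. g x \<le> p x"
    and min: "\<And>q'. sublinear q' \<Longrightarrow> (\<And>x. q' x \<le> g x) \<Longrightarrow> q' = g"
    using minimal_sublinear [OF assms] by blast
  have neg: "g (- x) = - g x" for x
  proof -
    obtain q where q: "sublinear q" "\<And>x. q x \<le> g x" "q (- x) \<le> - g x"
      using sublinear_descend [OF g(1)] by blast
    then have "q = g" by (intro min) auto
    with q(3) have "g (- x) \<le> - g x" by simp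
    moreover have "- g x \<le> g (- x)" using sublinear_lower [OF g(1), of "- x"] by simp
    ultimately show ?thesis by simp
  qed
  have add: "g (x + y) \<le> g x + g y" for x y using g(1) by (simp add: sublinear_def)
  show thesis
  proof (rule that)
    show "g (x + y) = g x + g y" for x y
      using add [of x y] add [of "x + y" "- y"] neg [of y] by simp
    show "g (r *\<^sub>R x) = r * g x" for r x
    proof (cases "r \<ge> 0")
      case False
      then have "g ((- r) *\<^sub>R x) = - r * g x" using g(1) unfolding sublinear_def by (meson linear neg_0_le_iff_le)
      then show ?thesis using neg [of "r *\<^sub>R x"] by simp
    qed (use g(1) in \<open>simp add: sublinear_def\<close>)
  qed (rule g(2))
qed

definition state :: "('a::unital_cstar_algebra \<Rightarrow> complex) \<Rightarrow> bool"
  where "state f \<longleftrightarrow> (\<forall>x y. f (x + y) = f x + f y) \<and> (\<forall>c x. f (c *\<^sub>C x) = c * f x) \<and>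
    (\<forall>x. cmod (f x) \<le> norm x) \<and> f 1 = 1"

lemma
  assumes "state f"
  shows state_add: "f (x + y) = f x + f y" and state_scaleC: "f (c *\<^sub>C x) = c * f x"
    and state_norm: "cmod (f x) \<le> norm x" and state_one: "f 1 = 1"
  using assms by (simp_all add: state_def)

lemma state_zero: "state f \<Longrightarrow> f 0 = 0"
  using state_scaleC [of f 0 0] by simp

lemma state_scaleR: "state f \<Longrightarrow> f (r *\<^sub>R x) = of_real r * f x"
  by (simp add: scaleR_scaleC state_scaleC)

lemma state_diff: "state f \<Longrightarrow> f (x - y) = f x - f y"
  using state_add [of f "x - y" y] by simp

lemma state_sum: "state f \<Longrightarrow> f (\<Sum>i\<in>I. g i) = (\<Sum>i\<in>I. f (g i))"
  by (induction I rule: infinite_finite_induct) (simp_all add: state_zero state_add)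

text \<open>A real functional below the norm with value 1 at the unit is complexified in the usual way. Its
imaginary part vanishes at the unit because the modulus there is at most 1.\<close>

lemma state_exists: "\<exists>f :: 'a::unital_cstar_algebra \<Rightarrow> complex. state f"
proof -
  have "sublinear (norm :: 'a \<Rightarrow> real)" by (simp add: sublinear_def norm_triangle_ineq)
  then obtain q :: "'a \<Rightarrow> real" where q: "sublinear q" "\<And>x. q x \<le> norm x" "q (- 1) \<le> - norm (1::'a)"
    using sublinear_descend [of norm "1::'a"] by blast
  obtain g where add: "\<And>x y. g (x + y) = g x + g y" and scale: "\<And>r x. g (r *\<^sub>R x) = r * g x"
    and le: "\<And>x::'a. g x \<le> q x"
    using dominated_linear_functional [OF q(1)] by blast
  have neg: "g (- x) = - g x" for x using scale [of "- 1" x] by simp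
  have bound: "g x \<le> norm x" for x using le [of x] q(2) [of x] by simp
  have one: "g 1 = 1"
    using bound [of 1] le [of "- 1"] q(3) neg [of 1] by simp
  define f where "f = (\<lambda>x. Complex (g x) (- g (\<i> *\<^sub>C x)))"
  have fadd: "f (x + y) = f x + f y" for x y by (simp add: f_def complex_eq_iff scaleC_add_right add)
  have decomp: "c *\<^sub>C x = Re c *\<^sub>R x + Im c *\<^sub>R (\<i> *\<^sub>C x)" for c and x :: 'a
  proof -
    have "c = complex_of_real (Re c) + complex_of_real (Im c) * \<i>" by (simp add: complex_eq_iff)
    then show ?thesis by (metis scaleC_add_left scaleC_scaleC scaleR_scaleC)
  qed
  have fscale: "f (c *\<^sub>C x) = c * f x" for c x
  proof -
    have 1: "g (c *\<^sub>C x) = Re c * g x + Im c * g (\<i> *\<^sub>C x)" for c x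
      by (subst decomp) (simp only: add scale)
    have "g (\<i> *\<^sub>C c *\<^sub>C x) = Re c * g (\<i> *\<^sub>C x) - Im c * g x"
      unfolding scaleC_scaleC by (subst 1) (simp add: algebra_simps)
    then show ?thesis using 1 [of c x] by (simp add: f_def complex_eq_iff algebra_simps)
  qed
  have fbound: "cmod (f x) \<le> norm x" for x
  proof (cases "f x = 0")
    case False
    define c where "c = cnj (f x) / cmod (f x)"
    have c: "cmod c = 1" using False by (simp add: c_def norm_divide)
    have "c * f x = cmod (f x)"
      using False complex_norm_square [of "f x"] by (simp add: c_def field_simps power2_eq_square)
    then have "cmod (f x) = Re (f (c *\<^sub>C x))" by (simp add: fscale)
    also have "\<dots> \<le> norm (c *\<^sub>C x)" using bound by (simp add: f_def)
    finally show ?thesis using c by (simp add: norm_scaleC)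
  qed simp
  have "(cmod (f 1))\<^sup>2 = 1 + (g (\<i> *\<^sub>C 1))\<^sup>2" by (simp add: f_def cmod_power2 one)
  moreover have "(cmod (f 1))\<^sup>2 \<le> 1" using fbound [of 1] by (simp add: power_le_one)
  ultimately have "g (\<i> *\<^sub>C 1) = 0" by simp
  then have "f 1 = 1" by (simp add: f_def one complex_eq_iff)
  then show ?thesis using fadd fscale fbound by (auto simp: state_def)
qed

text \<open>A strictly negative value would make the state exceed the norm of \<open>1 - \<tau> (star z * z + z * star z)\<close>
for small \<open>\<tau>\<close>, as this norm is \<open>1 + O(\<tau>\<^sup>2)\<close>.\<close>

lemma state_jordan_positive:
  fixes z :: "'a::unital_cstar_algebra"
  assumes "state f" shows "0 \<le> Re (f (star z * z + z * star z))" (is "0 \<le> Re (f ?J)")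
proof (rule ccontr)
  assume neg: "\<not> ?thesis"
  define K where "K = 8 * norm z ^ 4 + 1"
  have K: "K > 0" by (simp add: K_def add_nonneg_pos)
  define \<tau> where "\<tau> = - Re (f ?J) / (2 * K)"
  have \<tau>: "\<tau> > 0" using neg K by (simp add: \<tau>_def divide_neg_pos)
  have "Re (f (1 - \<tau> *\<^sub>R ?J)) \<le> norm (1 - \<tau> *\<^sub>R ?J)"
    using state_norm [OF assms] complex_Re_le_cmod order_trans by blast
  also have "\<dots> \<le> 1 + 8 * \<tau>\<^sup>2 * norm z ^ 4"
    using \<tau> by (intro norm_one_minus_jordan_square) simp
  finally have "1 - \<tau> * Re (f ?J) \<le> 1 + 8 * \<tau>\<^sup>2 * norm z ^ 4"
    unfolding state_diff [OF assms] state_scaleR [OF assms] state_one [OF assms] by simp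
  then have "\<tau> * - Re (f ?J) \<le> \<tau> * (\<tau> * (8 * norm z ^ 4))"
    by (simp add: power2_eq_square ac_simps)
  then have "- Re (f ?J) \<le> \<tau> * (8 * norm z ^ 4)" using \<tau> by (simp only: mult_le_cancel_left_pos)
  also have "\<dots> \<le> \<tau> * K" using \<tau> by (intro mult_left_mono) (auto simp: K_def)
  also have "\<dots> = - Re (f ?J) / 2" using K by (simp add: \<tau>_def)
  finally show False using neg by simp
qed

section \<open>Maps out of the projective tensor product\<close>

lemma tensor_add_left: "(x + x') \<otimes> y = x \<otimes> y + x' \<otimes> y"
  by (simp add: tensor_def alg_tensor_add_left completion_embed_add)

lemma tensor_add_right: "x \<otimes> (y + y') = x \<otimes> y + x \<otimes> y'"
  by (simp add: tensor_def alg_tensor_add_right completion_embed_add)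

lemma tensor_scaleC_left: "(c *\<^sub>C x) \<otimes> y = c *\<^sub>C (x \<otimes> y)"
  by (simp add: tensor_def scaleC_alg_tensor flip: completion_embed_scaleC)

lemma tensor_scaleC_right: "x \<otimes> (c *\<^sub>C y) = c *\<^sub>C (x \<otimes> y)"
  by (simp add: tensor_def scaleC_alg_tensor alg_tensor_scale flip: completion_embed_scaleC)

lemma tensor_zero_left [simp]: "0 \<otimes> y = 0" and tensor_zero_right [simp]: "x \<otimes> 0 = 0"
  by (simp_all add: tensor_def completion_embed_zero)

lemma tensor_scaleR_left: "(r *\<^sub>R x) \<otimes> y = r *\<^sub>R (x \<otimes> y)"
  and tensor_scaleR_right: "x \<otimes> (r *\<^sub>R y) = r *\<^sub>R (x \<otimes> y)"
  by (simp_all add: scaleR_scaleC tensor_scaleC_left tensor_scaleC_right)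

lemma tensor_minus_left: "(- x) \<otimes> y = - (x \<otimes> y)"
  and tensor_minus_right: "x \<otimes> (- y) = - (x \<otimes> y)"
  using tensor_scaleC_left [of "- 1" x y] tensor_scaleC_right [of x "- 1" y]
  by (simp_all add: scaleC_minus_one)

lemma tensor_diff_left: "(x - x') \<otimes> y = x \<otimes> y - x' \<otimes> y"
  and tensor_diff_right: "x \<otimes> (y - y') = x \<otimes> y - x \<otimes> y'"
  using tensor_add_left [of x "- x'" y] tensor_add_right [of x y "- y'"]
  by (simp_all add: tensor_minus_left tensor_minus_right)

lemma tensor_sum_left: "(\<Sum>i\<in>I. f i) \<otimes> y = (\<Sum>i\<in>I. f i \<otimes> y)"
  by (induction I rule: infinite_finite_induct) (simp_all add: tensor_add_left)

lemma tensor_sum_right: "x \<otimes> (\<Sum>i\<in>I. f i) = (\<Sum>i\<in>I. x \<otimes> f i)"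
  by (induction I rule: infinite_finite_induct) (simp_all add: tensor_add_right)

text \<open>The universal property of the completed tensor product. The norm bound on the algebraic tensor
product is immediate from the definition of the projective norm as an infimum over
representations; a contraction extends to limits of Cauchy sequences.\<close>

lemma bounded_balanced_map_extends:
  fixes \<beta> :: "'a::complex_normed_vector \<Rightarrow> 'b::complex_normed_vector \<Rightarrow> 'c::banach"
  assumes \<beta>: "balanced \<beta>" and bound: "\<And>x y. norm (\<beta> x y) \<le> norm x * norm y"
  obtains T where "Modules.additive T" "\<And>x y. T (x \<otimes> y) = \<beta> x y" "\<And>u. norm (T u) \<le> norm u"
proof -
  define E where "E = tensor_extend \<beta>"
  have Eadd: "E (u + v) = E u + E v" for u v by (simp add: E_def tensor_extend_add)
  have Ediff: "E (u - v) = E u - E v" for u v using Eadd [of "u - v" v] by simp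
  have Enorm: "norm (E u) \<le> norm (completion_embed u)" for u
  proof (rule field_le_epsilon)
    fix e :: real assume "e > 0"
    then obtain M where M: "u = (\<Sum>(x, y)\<in>#M. alg_tensor x y)"
      "(\<Sum>(x, y)\<in>#M. norm x * norm y) < proj_norm u + e"
      by (rule proj_norm_approx)
    have "norm (E (\<Sum>(x, y)\<in>#M. alg_tensor x y)) \<le> (\<Sum>(x, y)\<in>#M. norm x * norm y)"
    proof (induction M)
      case (add p M)
      obtain x y where p: "p = (x, y)" by (cases p)
      show ?case
        using add norm_triangle_ineq [of "\<beta> x y" "E (\<Sum>(x, y)\<in>#M. alg_tensor x y)"] bound [of x y]
        by (simp add: p Eadd) (simp add: E_def tensor_extend_alg_tensor [OF \<beta>])
    qed (simp add: E_def)
    then show "norm (E u) \<le> norm (completion_embed u) + e"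
      using M by (simp add: norm_completion_embed)
  qed
  \<comment> \<open>An approximating sequence is fixed for each \<open>x\<close>; the limit is the same for all others.\<close>
  define U where "U = (\<lambda>x. SOME U. (\<lambda>n. completion_embed (U n)) \<longlonglongrightarrow> (x :: ('a, 'b) proj_tensor_product))"
  have U: "(\<lambda>n. completion_embed (U x n)) \<longlonglongrightarrow> x" for x
  proof -
    have "\<exists>U. (\<lambda>n. completion_embed (U n)) \<longlonglongrightarrow> x"
      by (rule ex_forward [OF completion_embed_limit_ex [of x]]) (erule conjunct2)
    from someI_ex [OF this] show ?thesis by (simp only: U_def)
  qed
  define T where "T = (\<lambda>x. lim (\<lambda>n. E (U x n)))"
  have conv: "(\<lambda>n. E (U x n)) \<longlonglongrightarrow> T x" for x
  proof -
    have "Cauchy (\<lambda>n. completion_embed (U x n))" using U by (rule LIMSEQ_imp_Cauchy)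
    then have "Cauchy (\<lambda>n. E (U x n))"
      unfolding Cauchy_iff Ediff [symmetric] completion_embed_diff [symmetric]
      by (meson Enorm le_less_trans)
    then show ?thesis unfolding T_def by (simp add: Cauchy_convergent flip: convergent_LIMSEQ_iff)
  qed
  have lim: "(\<lambda>n. E (V n)) \<longlonglongrightarrow> T x" if V: "(\<lambda>n. completion_embed (V n)) \<longlonglongrightarrow> x" for V x
  proof -
    have "(\<lambda>n. completion_embed (V n) - completion_embed (U x n)) \<longlonglongrightarrow> x - x"
      by (intro tendsto_diff V U)
    then have "(\<lambda>n. norm (completion_embed (V n - U x n))) \<longlonglongrightarrow> 0"
      by (simp add: completion_embed_diff tendsto_norm_zero)
    then have "(\<lambda>n. E (V n) - E (U x n)) \<longlonglongrightarrow> 0"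
      by (rule Lim_null_comparison [rotated]) (simp add: Enorm flip: Ediff)
    with conv [of x] show ?thesis by (rule Lim_transform)
  qed
  show thesis
  proof (rule that)
    show "Modules.additive T"
    proof
      fix x y
      have "(\<lambda>n. completion_embed (U x n + U y n)) \<longlonglongrightarrow> x + y"
        unfolding completion_embed_add by (intro tendsto_add U)
      then have "(\<lambda>n. E (U x n + U y n)) \<longlonglongrightarrow> T (x + y)" by (rule lim)
      moreover have "(\<lambda>n. E (U x n + U y n)) \<longlonglongrightarrow> T x + T y"
        unfolding Eadd by (intro tendsto_add conv)
      ultimately show "T (x + y) = T x + T y" by (rule LIMSEQ_unique)
    qed
    show "T (x \<otimes> y) = \<beta> x y" for x y
    proof -
      have "(\<lambda>n. E (alg_tensor x y)) \<longlonglongrightarrow> T (x \<otimes> y)" by (rule lim) (simp add: tensor_def)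
      then have "T (x \<otimes> y) = E (alg_tensor x y)" using tendsto_const by (rule LIMSEQ_unique)
      then show ?thesis by (simp add: E_def tensor_extend_alg_tensor [OF \<beta>])
    qed
    show "norm (T u) \<le> norm u" for u
      by (rule LIMSEQ_le [OF tendsto_norm [OF conv] tendsto_norm [OF U]]) (use Enorm in blast)
  qed
qed

text \<open>Slice maps are the only means used to pass from the tensor product back to a factor.\<close>

lemma right_slice:
  fixes f :: "'b::unital_cstar_algebra \<Rightarrow> complex"
  assumes f: "state f"
  obtains T :: "('a::unital_cstar_algebra, 'b) proj_tensor_product \<Rightarrow> 'a"
  where "Modules.additive T" "\<And>x y. T (x \<otimes> y) = f y *\<^sub>C x" "\<And>u. norm (T u) \<le> norm u"
proof (rule bounded_balanced_map_extends [where \<beta> = "\<lambda>(x::'a) y. f y *\<^sub>C x"])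
  show "balanced (\<lambda>(x::'a) y. f y *\<^sub>C x)"
    by (simp add: balanced_def scaleC_add_right scaleC_add_left state_add [OF f] state_scaleC [OF f]
        scaleC_scaleC mult.commute)
  show "norm (f y *\<^sub>C x) \<le> norm x * norm y" for x :: 'a and y
    using mult_left_mono [OF state_norm [OF f, of y] norm_ge_zero [of x]] by (simp add: norm_scaleC mult.commute)
qed (use that in blast)

lemma left_slice:
  fixes f :: "'a::unital_cstar_algebra \<Rightarrow> complex"
  assumes f: "state f"
  obtains T :: "('a, 'b::unital_cstar_algebra) proj_tensor_product \<Rightarrow> 'b"
  where "Modules.additive T" "\<And>x y. T (x \<otimes> y) = f x *\<^sub>C y" "\<And>u. norm (T u) \<le> norm u"
proof (rule bounded_balanced_map_extends [where \<beta> = "\<lambda>x (y::'b). f x *\<^sub>C y"])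
  show "balanced (\<lambda>x (y::'b). f x *\<^sub>C y)"
    by (simp add: balanced_def scaleC_add_right scaleC_add_left state_add [OF f] state_scaleC [OF f]
        scaleC_scaleC mult.commute state_zero [OF f])
  show "norm (f x *\<^sub>C y) \<le> norm x * norm y" for x and y :: 'b
    using state_norm [OF f, of x] by (simp add: norm_scaleC mult_right_mono)
qed (use that in blast)

lemma norm_tensor_one:
  fixes x :: "'a::unital_cstar_algebra"
  shows "norm (x \<otimes> (1 :: 'b::unital_cstar_algebra)) = norm x"
proof (rule antisym)
  obtain f :: "'b \<Rightarrow> complex" where f: "state f" using state_exists by blast
  obtain T :: "('a, 'b) proj_tensor_product \<Rightarrow> 'a"
    where "\<And>x y. T (x \<otimes> y) = f y *\<^sub>C x" "\<And>u. norm (T u) \<le> norm u"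
    using right_slice [OF f] by metis
  then show "norm x \<le> norm (x \<otimes> (1 :: 'b))" by (metis f scaleC_one state_one)
qed (use norm_tensor_le [of x "1::'b"] in simp)

lemma norm_proj_one:
  "norm (1 :: ('a::unital_cstar_algebra, 'b::unital_cstar_algebra) proj_tensor_product) = 1"
  by (simp add: one_proj_tensor_product_def norm_tensor_one)

section \<open>Square roots and a unitary dilation\<close>

definition sqrt_one_minus :: "'a::{real_normed_algebra_1, banach} \<Rightarrow> 'a"
  where "sqrt_one_minus t = (\<Sum>n. ((1 / 2 gchoose n) * (- 1) ^ n) *\<^sub>R t ^ n)"

lemma abs_gbinomial_half_le_one: "\<bar>(1 / 2 :: real) gchoose n\<bar> \<le> 1"
proof (induction n)
  case (Suc n)
  have "real (Suc n) * ((1 / 2) gchoose Suc n) = (1 / 2 - real n) * ((1 / 2) gchoose n)"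
    using gbinomial_mult_1 [of "1 / 2 :: real" n] by (simp add: algebra_simps)
  then have "real (Suc n) * \<bar>(1 / 2) gchoose Suc n\<bar> = \<bar>1 / 2 - real n\<bar> * \<bar>(1 / 2) gchoose n\<bar>"
    by (metis abs_mult abs_of_nat)
  also have "\<dots> \<le> real (Suc n) * 1" using Suc by (intro mult_mono) auto
  finally show ?case by (simp only: mult_le_cancel_left_pos of_nat_0_less_iff zero_less_Suc)
qed simp

lemma summable_sqrt_one_minus:
  fixes t :: "'a::{real_normed_algebra_1, banach}"
  assumes "norm t < 1"
  shows "summable (\<lambda>n. norm (((1 / 2 gchoose n) * (- 1) ^ n) *\<^sub>R t ^ n))"
proof (rule summable_comparison_test')
  show "summable (\<lambda>n. norm t ^ n)" using assms by (simp add: summable_geometric)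
  show "norm (norm (((1 / 2 gchoose n) * (- 1) ^ n) *\<^sub>R t ^ n)) \<le> norm t ^ n" for n
    using mult_mono [OF abs_gbinomial_half_le_one [of n] norm_power_ineq [of t n]]
    by (simp add: abs_mult)
qed

text \<open>The Cauchy product of the series with itself has coefficients \<open>(1/2 + 1/2) gchoose n\<close> by
Vandermonde's identity, which vanish from \<open>n = 2\<close> on.\<close>

lemma sqrt_one_minus_square:
  fixes t :: "'a::{real_normed_algebra_1, banach}"
  assumes "norm t < 1" shows "sqrt_one_minus t * sqrt_one_minus t = 1 - t"
proof -
  let ?c = "\<lambda>n. (1 / 2 gchoose n) * (- 1) ^ n :: real"
  have "(\<lambda>n. \<Sum>i\<le>n. (?c i *\<^sub>R t ^ i) * (?c (n - i) *\<^sub>R t ^ (n - i)))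
      sums (sqrt_one_minus t * sqrt_one_minus t)"
    unfolding sqrt_one_minus_def using summable_sqrt_one_minus [OF assms] by (rule Cauchy_product_sums) (rule summable_sqrt_one_minus [OF assms])
  moreover have "(\<Sum>i\<le>n. (?c i *\<^sub>R t ^ i) * (?c (n - i) *\<^sub>R t ^ (n - i))) =
      (if n = 0 then 1 else if n = 1 then - t else 0)" for n
  proof -
    have "(\<Sum>i\<le>n. (?c i *\<^sub>R t ^ i) * (?c (n - i) *\<^sub>R t ^ (n - i)))
        = (\<Sum>i\<le>n. ((- 1) ^ n * ((1 / 2 gchoose i) * (1 / 2 gchoose (n - i)))) *\<^sub>R t ^ n)"
    proof (rule sum.cong [OF refl])
      fix i assume "i \<in> {..n}"
      then have "t ^ n = t ^ i * t ^ (n - i)" "(- 1) ^ n = (- 1) ^ i * (- 1 :: real) ^ (n - i)"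
        by (simp_all flip: power_add)
      then show "(?c i *\<^sub>R t ^ i) * (?c (n - i) *\<^sub>R t ^ (n - i)) =
          ((- 1) ^ n * ((1 / 2 gchoose i) * (1 / 2 gchoose (n - i)))) *\<^sub>R t ^ n"
        by (simp add: ac_simps)
    qed
    also have "\<dots> = ((- 1) ^ n * ((1 / 2 + 1 / 2 :: real) gchoose n)) *\<^sub>R t ^ n"
      by (simp only: gbinomial_Vandermonde [symmetric] scaleR_sum_left [symmetric] sum_distrib_left
          atMost_atLeast0)
    also have "\<dots> = (if n = 0 then 1 else if n = 1 then - t else 0)"
    proof -
      have "(1 :: real) gchoose n = of_nat (1 choose n)" by (metis binomial_gbinomial of_nat_1)
      then show ?thesis by (cases n; cases "n - 1") auto
    qed
    finally show ?thesis .
  qed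
  ultimately have "(\<lambda>n. if n = 0 then 1 else if n = 1 then - t else 0)
      sums (sqrt_one_minus t * sqrt_one_minus t)" by simp
  moreover have "(\<lambda>n. if n = 0 then 1 else if n = 1 then - t else 0) sums (\<Sum>n\<in>{0, 1::nat}. if n = 0 then 1 else if n = 1 then - t else 0)"
    by (rule sums_finite) auto
  ultimately have "sqrt_one_minus t * sqrt_one_minus t
      = (\<Sum>n\<in>{0, 1::nat}. if n = 0 then 1 else if n = 1 then - t else 0)"
    by (rule sums_unique2)
  then show ?thesis by simp
qed

lemma sqrt_one_minus_intertwines:
  fixes x :: "'a::{real_normed_algebra_1, banach}"
  assumes "x * s = t * x" "norm s < 1" "norm t < 1"
  shows "x * sqrt_one_minus s = sqrt_one_minus t * x"
proof -
  have p: "x * s ^ n = t ^ n * x" for n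
    by (induction n) (simp, metis assms(1) mult.assoc power_Suc power_Suc2)
  note sm = summable_norm_cancel [OF summable_sqrt_one_minus]
  show ?thesis
    unfolding sqrt_one_minus_def
    by (simp add: suminf_mult [OF sm [OF assms(2)], symmetric] suminf_mult2 [OF sm [OF assms(3)]] p)
qed

lemma star_sqrt_one_minus:
  fixes t :: "'a::unital_cstar_algebra"
  assumes "norm t < 1" "star t = t" shows "star (sqrt_one_minus t) = sqrt_one_minus t"
proof -
  let ?f = "\<lambda>n. ((1 / 2 gchoose n) * (- 1) ^ n) *\<^sub>R t ^ n"
  have "?f sums sqrt_one_minus t"
    unfolding sqrt_one_minus_def
    by (rule summable_sums [OF summable_norm_cancel [OF summable_sqrt_one_minus [OF assms(1)]]])
  then have lim: "(\<lambda>n. \<Sum>i<n. ?f i) \<longlonglongrightarrow> sqrt_one_minus t" by (simp add: sums_def)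
  moreover have "star (\<Sum>i<n. ?f i) = (\<Sum>i<n. ?f i)" for n
    by (simp add: star_sum star_scaleR star_power assms(2))
  ultimately have "(\<lambda>n. \<Sum>i<n. ?f i) \<longlonglongrightarrow> star (sqrt_one_minus t)"
    using tendsto_star [OF lim] by simp
  then show ?thesis using lim LIMSEQ_unique by blast
qed

lemma neumann_series:
  fixes e :: "'a::{real_normed_algebra_1, banach}"
  assumes e: "norm e < 1"
  obtains T where "(1 + e) * T = 1" "T * (1 + e) = 1"
    "\<And>N. norm (T - (\<Sum>k<N. (- e) ^ k)) \<le> norm e ^ N / (1 - norm e)"
proof -
  have sm: "summable (\<lambda>k. (- e) ^ k)"
  proof (rule summable_norm_cancel, rule summable_comparison_test')
    show "summable (\<lambda>n. norm e ^ n)" using e by (simp add: summable_geometric)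
    show "norm (norm ((- e) ^ n)) \<le> norm e ^ n" for n using norm_power_ineq [of "- e" n] by simp
  qed
  define T where "T = (\<Sum>k. (- e) ^ k)"
  have split: "T = 1 + (\<Sum>k. (- e) ^ Suc k)" using suminf_split_head [OF sm] by (simp add: T_def)
  have "(\<Sum>k. (- e) ^ Suc k) = - e * T" unfolding T_def power_Suc by (rule suminf_mult [OF sm])
  then have 1: "(1 + e) * T = 1" using split by (simp add: algebra_simps)
  have "(\<Sum>k. (- e) ^ Suc k) = T * - e"
    unfolding T_def suminf_mult2 [OF sm] by (simp only: power_Suc2)
  then have 2: "T * (1 + e) = 1" using split by (simp add: algebra_simps)
  have "norm T \<le> 1 + norm e * norm T"
  proof -
    have "T = 1 - e * T" using 1 by (simp add: algebra_simps)
    then have "norm T \<le> norm (1::'a) + norm (e * T)" by (metis norm_triangle_ineq4)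
    then show ?thesis using norm_mult_ineq [of e T] by simp
  qed
  then have nT: "norm T \<le> 1 / (1 - norm e)" using e by (simp add: field_simps)
  have 3: "norm (T - (\<Sum>k<N. (- e) ^ k)) \<le> norm e ^ N / (1 - norm e)" for N
  proof -
    have "(1 + e) * (\<Sum>k<N. (- e) ^ k) = 1 - (- e) ^ N"
      by (induction N) (simp_all add: distrib_left distrib_right)
    then have "T * (1 + e) * (\<Sum>k<N. (- e) ^ k) = T * (1 - (- e) ^ N)" by (simp only: mult.assoc)
    then have "T - (\<Sum>k<N. (- e) ^ k) = T * (- e) ^ N" by (simp add: 2 right_diff_distrib)
    then have "norm (T - (\<Sum>k<N. (- e) ^ k)) \<le> norm T * norm ((- e) ^ N)" by (simp add: norm_mult_ineq)
    also have "\<dots> \<le> 1 / (1 - norm e) * norm e ^ N"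
      using nT norm_power_ineq [of "- e" N] e by (intro mult_mono) auto
    finally show ?thesis by simp
  qed
  show thesis using that [OF 1 2 3] .
qed

text \<open>Writing \<open>l\<close> and \<open>r\<close> for the two defect operators of the strict contraction \<open>x\<close>, the element
\<open>x + l v (1 + star x v)\<^sup>-\<^sup>1 r\<close> is unitary: it is the transfer function, evaluated at the unitary \<open>v\<close>,
of the Julia operator of \<open>x\<close>, and an operator form of a Moebius transformation of the disc. The
partial sums of the Neumann series of the inverse converge geometrically.\<close>

lemma unitary_dilation:
  fixes x v :: "'a::unital_cstar_algebra"
  assumes x: "norm x < 1" and v: "v \<in> unitaries"
  defines "l \<equiv> sqrt_one_minus (x * star x)" and "r \<equiv> sqrt_one_minus (star x * x)"
  obtains F where "F \<in> unitaries"
    "\<And>N. norm (F - (x + (\<Sum>k<N. l * v * (- (star x * v)) ^ k * r)))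
      \<le> norm l * norm r * (norm x ^ N / (1 - norm x))"
proof -
  have vv: "star v * v = 1" "v * star v = 1" using v by (auto simp: unitaries_def)
  have nv: "norm v = 1" using v by (rule norm_unitary)
  have lt: "norm (x * star x) < 1" "norm (star x * x) < 1"
  proof -
    have "norm x * norm x < 1" using x by (metis mult_strict_mono' mult_1 norm_ge_zero)
    then show "norm (x * star x) < 1" "norm (star x * x) < 1"
      using norm_mult_ineq [of x "star x"] norm_mult_ineq [of "star x" x] by (simp_all add: norm_star)
  qed
  have ll: "l * l = 1 - x * star x" and rr: "r * r = 1 - star x * x"
    unfolding l_def r_def using lt by (auto intro: sqrt_one_minus_square)
  have sl: "star l = l" and sr: "star r = r"
    unfolding l_def r_def using lt by (auto intro!: star_sqrt_one_minus simp: star_mult star_star)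
  have xr: "x * r = l * x"
    unfolding l_def r_def using lt by (intro sqrt_one_minus_intertwines) (auto simp: mult.assoc)
  then have "star (x * r) = star (l * x)" by simp
  then have rx: "r * star x = star x * l" by (simp add: star_mult sl sr)
  define e where "e = star x * v"
  have ne: "norm e = norm x"
  proof (rule antisym)
    show "norm e \<le> norm x" unfolding e_def using norm_mult_ineq [of "star x" v] nv by (simp add: norm_star)
    have "star x = e * star v" by (simp add: e_def mult.assoc vv)
    then show "norm x \<le> norm e" using norm_mult_ineq [of e "star v"] nv by (metis mult.right_neutral norm_star)
  qed
  obtain T where T: "(1 + e) * T = 1" "T * (1 + e) = 1"
    "\<And>N. norm (T - (\<Sum>k<N. (- e) ^ k)) \<le> norm e ^ N / (1 - norm e)"
    using neumann_series [of e] x ne by auto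
  define S where "S = star T"
  have se: "star e = star v * x" by (simp add: e_def star_mult star_star)
  have "star ((1 + e) * T) = 1" "star (T * (1 + e)) = 1" by (simp_all add: T star_one)
  then have eT: "e * T = 1 - T" "T * e = 1 - T" and eS: "S * star e = 1 - S" "star e * S = 1 - S"
    using T(1,2) by (simp_all add: S_def star_mult star_add star_one algebra_simps)
  define F where "F = x + l * v * T * r"
  have sF: "star F = star x + r * S * star v * l"
    by (simp add: F_def star_add star_mult sl sr S_def mult.assoc)
  have "star F * F = 1"
  proof -
    have 1: "star x * (l * v * T * r) = r * (1 - T) * r"
    proof -
      have "star x * (l * v * T * r) = r * ((star x * v) * T) * r" using rx by (simp add: mult.assoc [symmetric])
      then show ?thesis by (simp add: eT flip: e_def)
    qed
    have 2: "r * S * star v * l * x = r * (1 - S) * r"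
    proof -
      have "r * S * star v * l * x = r * (S * (star v * x)) * r" using xr by (simp add: mult.assoc)
      then show ?thesis by (simp add: eS flip: se)
    qed
    have 3: "(r * S * star v * l) * (l * v * T * r) = r * (S + T - 1) * r"
    proof -
      have "(r * S * star v * l) * (l * v * T * r) = r * S * star v * (l * l) * v * T * r"
        by (simp add: mult.assoc)
      also have "\<dots> = r * (S * (star v * v) * T - (S * (star v * x)) * ((star x * v) * T)) * r"
        unfolding ll by (simp add: algebra_simps)
      also have "\<dots> = r * (S * T - (1 - S) * (1 - T)) * r"
        by (simp add: vv eS eT flip: se e_def)
      finally show ?thesis by (simp add: algebra_simps)
    qed
    have "star F * F = star x * x + star x * (l * v * T * r) + r * S * star v * l * x
        + (r * S * star v * l) * (l * v * T * r)"
      unfolding sF unfolding F_def by (simp add: algebra_simps)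
    also have "\<dots> = star x * x + r * r" unfolding 1 2 3 by (simp add: algebra_simps)
    finally show ?thesis by (simp add: rr)
  qed
  moreover have "F * star F = 1"
  proof -
    have xS: "x * S = v * (1 - S)"
    proof -
      have "v * (star v * x * S) = x * S" by (simp add: vv flip: mult.assoc)
      then show ?thesis by (metis eS(2) se)
    qed
    have Tx: "T * star x = (1 - T) * star v"
    proof -
      have "T * (star x * v) * star v = T * star x" by (simp add: vv mult.assoc)
      then show ?thesis by (metis eT(2) e_def)
    qed
    have 1: "x * (r * S * star v * l) = l * v * (1 - S) * star v * l"
    proof -
      have "x * (r * S * star v * l) = l * (x * S) * star v * l" using xr by (simp add: mult.assoc [symmetric])
      then show ?thesis by (simp add: xS mult.assoc)
    qed
    have 2: "l * v * T * r * star x = l * v * (1 - T) * star v * l"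
    proof -
      have "l * v * T * r * star x = l * v * (T * star x) * l" using rx by (simp add: mult.assoc)
      then show ?thesis by (simp add: Tx mult.assoc)
    qed
    have 3: "(l * v * T * r) * (r * S * star v * l) = l * v * (T + S - 1) * star v * l"
    proof -
      have "(l * v * T * r) * (r * S * star v * l) = l * v * (T * (r * r) * S) * star v * l"
        by (simp add: mult.assoc)
      also have "T * (r * r) * S = T * S - (T * star x) * (x * S)"
        unfolding rr by (simp add: algebra_simps)
      also have "(T * star x) * (x * S) = (1 - T) * (star v * v) * (1 - S)"
        unfolding xS Tx by (simp add: mult.assoc)
      finally show ?thesis by (simp add: vv algebra_simps)
    qed
    have "F * star F = x * star x + x * (r * S * star v * l) + l * v * T * r * star x
        + (l * v * T * r) * (r * S * star v * l)"
      unfolding sF unfolding F_def by (simp add: algebra_simps)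
    also have "\<dots> = x * star x + l * (v * star v) * l" unfolding 1 2 3 by (simp add: algebra_simps)
    finally show ?thesis by (simp add: vv ll)
  qed
  ultimately have "F \<in> unitaries" by (simp add: unitaries_def)
  moreover have "norm (F - (x + (\<Sum>k<N. l * v * (- (star x * v)) ^ k * r)))
      \<le> norm l * norm r * (norm x ^ N / (1 - norm x))" for N
  proof -
    have "F - (x + (\<Sum>k<N. l * v * (- (star x * v)) ^ k * r)) = l * v * (T - (\<Sum>k<N. (- e) ^ k)) * r"
      by (simp add: F_def e_def right_diff_distrib left_diff_distrib sum_distrib_left sum_distrib_right)
    also have "norm \<dots> \<le> norm l * norm v * norm (T - (\<Sum>k<N. (- e) ^ k)) * norm r"
      by (intro order_trans [OF norm_mult_ineq] mult_mono norm_mult_ineq mult_nonneg_nonneg norm_ge_zero order_refl)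
    also have "\<dots> = norm l * norm r * norm (T - (\<Sum>k<N. (- e) ^ k))" by (simp add: nv)
    also have "\<dots> \<le> norm l * norm r * (norm x ^ N / (1 - norm x))"
      using T(3) [of N] by (intro mult_left_mono) (auto simp: ne)
    finally show ?thesis .
  qed
  ultimately show thesis by (rule that)
qed

lemma power_scaleC: "(c *\<^sub>C x) ^ n = c ^ n *\<^sub>C x ^ n"
  for x :: "'a::{complex_normed_algebra, monoid_mult}"
  by (induction n) (simp_all add: scaleC_one scaleC_mult_simps mult.commute)

text \<open>With \<open>\<zeta> X\<close> in place of \<open>v\<close> the dilation becomes an analytic disc \<open>\<zeta> \<mapsto> F \<zeta>\<close> of unitaries. Only its
value at the centre and its first coefficient matter later; the polynomial approximation is
uniform on the circle.\<close>

lemma unitary_dilation_polynomial: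
  fixes x X :: "'a::unital_cstar_algebra"
  assumes x: "norm x < 1" and X: "X \<in> unitaries"
  obtains c K where "c 0 = x" "c 1 = sqrt_one_minus (x * star x) * X * sqrt_one_minus (star x * x)"
    "\<And>\<zeta> N. cmod \<zeta> = 1 \<Longrightarrow> \<exists>F\<in>unitaries. norm (F - (\<Sum>k<Suc N. \<zeta> ^ k *\<^sub>C c k)) \<le> K * norm x ^ N"
proof -
  define l where "l = sqrt_one_minus (x * star x)"
  define r where "r = sqrt_one_minus (star x * x)"
  define c where "c = (\<lambda>k. case k of 0 \<Rightarrow> x | Suc k \<Rightarrow> l * X * (- (star x * X)) ^ k * r)"
  define K where "K = norm l * norm r / (1 - norm x)"
  have "\<exists>F\<in>unitaries. norm (F - (\<Sum>k<Suc N. \<zeta> ^ k *\<^sub>C c k)) \<le> K * norm x ^ N"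
    if \<zeta>: "cmod \<zeta> = 1" for \<zeta> N
  proof -
    obtain F where F: "F \<in> unitaries"
      "norm (F - (x + (\<Sum>k<N. l * (\<zeta> *\<^sub>C X) * (- (star x * (\<zeta> *\<^sub>C X))) ^ k * r)))
        \<le> norm l * norm r * (norm x ^ N / (1 - norm x))"
      unfolding l_def r_def using unitary_dilation [OF x unitary_scaleC [OF X \<zeta>]] by blast
    have "l * (\<zeta> *\<^sub>C X) * (- (star x * (\<zeta> *\<^sub>C X))) ^ k * r = \<zeta> ^ Suc k *\<^sub>C c (Suc k)" for k
    proof -
      have "- (star x * (\<zeta> *\<^sub>C X)) = \<zeta> *\<^sub>C (- (star x * X))"
        by (simp add: scaleC_mult_simps scaleC_minus_right)
      then show ?thesis by (simp add: c_def power_scaleC scaleC_mult_simps mult.commute)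
    qed
    then have "x + (\<Sum>k<N. l * (\<zeta> *\<^sub>C X) * (- (star x * (\<zeta> *\<^sub>C X))) ^ k * r) = (\<Sum>k<Suc N. \<zeta> ^ k *\<^sub>C c k)"
      by (simp only: sum.lessThan_Suc_shift) (simp add: c_def scaleC_one)
    then show ?thesis using F by (auto simp: K_def)
  qed
  moreover have "c 0 = x" "c 1 = l * X * r" by (simp_all add: c_def)
  ultimately show thesis using that [of c K] by (simp add: l_def r_def)
qed

section \<open>The unit ball as a closed convex hull\<close>

lemma eventually_geometric_small:
  fixes K \<rho> e :: real
  assumes "0 \<le> \<rho>" "\<rho> < 1" "e > 0" shows "\<exists>N. K * \<rho> ^ N < e"
proof -
  have "(\<lambda>N. K * \<rho> ^ N) \<longlonglongrightarrow> K * 0" using assms by (intro tendsto_mult_left LIMSEQ_power_zero) auto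
  then have "eventually (\<lambda>N. K * \<rho> ^ N < e) sequentially" using assms(3) by (auto dest: order_tendstoD(2))
  then show ?thesis by (auto simp: eventually_sequentially)
qed

text \<open>The mean of the disc of unitaries over sufficiently many roots of unity is close to its value
\<open>x\<close> at the centre (the proof of the Russo-Dye theorem due to Harris).\<close>

lemma open_ball_subset_unitary_hull:
  fixes x :: "'a::unital_cstar_algebra"
  assumes x: "norm x < 1" shows "x \<in> closure (convex hull unitaries)"
  unfolding closure_approachable
proof (intro allI impI)
  fix e :: real assume e: "e > 0"
  obtain c K where c: "c 0 = x"
    and F: "\<And>\<zeta> N. cmod \<zeta> = 1 \<Longrightarrow> \<exists>F\<in>unitaries. norm (F - (\<Sum>k<Suc N. \<zeta> ^ k *\<^sub>C c k)) \<le> K * norm x ^ N"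
    using unitary_dilation_polynomial [OF x unitary_one] by metis
  obtain N where N: "K * norm x ^ N < e" using eventually_geometric_small x e by (metis norm_ge_zero)
  define M where "M = Suc N"
  obtain \<omega> :: complex where w: "cmod \<omega> = 1" "\<omega> ^ M = 1" "\<And>e. 0 < e \<Longrightarrow> e < M \<Longrightarrow> \<omega> ^ e \<noteq> 1"
    using primitive_root_of_unity [of M] by (auto simp: M_def)
  define P where "P = (\<lambda>j. \<Sum>k<M. (\<omega> ^ j) ^ k *\<^sub>C c k)"
  have "\<exists>F\<in>unitaries. norm (F - P j) \<le> K * norm x ^ N" for j
    unfolding P_def M_def by (rule F) (simp add: norm_power w)
  then obtain F where F: "\<And>j. F j \<in> unitaries" "\<And>j. norm (F j - P j) \<le> K * norm x ^ N" by metis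
  have M: "real M > 0" by (simp add: M_def)
  have avg: "(\<Sum>j<M. P j) = real M *\<^sub>R x"
    using coefficient_average [OF w, of 0 c] by (simp add: P_def c scaleC_one) (simp add: M_def)
  define y where "y = (\<Sum>j<M. (1 / real M) *\<^sub>R F j)"
  have "y \<in> convex hull unitaries"
    unfolding y_def using M F(1) by (intro convex_sum convex_convex_hull) (auto intro: hull_inc)
  moreover have "dist y x < e"
  proof -
    have "y - x = (1 / real M) *\<^sub>R (\<Sum>j<M. F j - P j)"
      using M by (simp add: y_def sum_subtractf avg scaleR_diff_right scaleR_sum_right)
    then have "dist y x = norm (\<Sum>j<M. F j - P j) / real M" using M by (simp add: dist_norm)
    also have "\<dots> \<le> (\<Sum>j<M. K * norm x ^ N) / real M"
      using F(2) by (intro divide_right_mono sum_norm_le) auto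
    also have "\<dots> < e" using M N by simp
    finally show ?thesis .
  qed
  ultimately show "\<exists>y\<in>convex hull unitaries. dist y x < e" by blast
qed

lemma closed_contains_if_contains_shrinkings:
  fixes x :: "'a::real_normed_vector"
  assumes "closed H" and "\<And>r. 0 \<le> r \<Longrightarrow> r < 1 \<Longrightarrow> r *\<^sub>R x \<in> H" shows "x \<in> H"
proof -
  have "(\<lambda>n. (real n / real (Suc n)) *\<^sub>R x) \<longlonglongrightarrow> 1 *\<^sub>R x"
    by (intro tendsto_scaleR LIMSEQ_n_over_Suc_n tendsto_const)
  then have lim: "(\<lambda>n. (real n / real (Suc n)) *\<^sub>R x) \<longlonglongrightarrow> x" by simp
  have "(real n / real (Suc n)) *\<^sub>R x \<in> H" for n by (rule assms(2)) auto
  then show ?thesis using lim by (rule closed_sequentially [OF assms(1)])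
qed

lemma russo_dye:
  fixes x :: "'a::unital_cstar_algebra"
  assumes x: "norm x \<le> 1" shows "x \<in> closure (convex hull unitaries)"
proof (rule closed_contains_if_contains_shrinkings)
  fix r :: real assume r: "0 \<le> r" "r < 1"
  have "r * norm x \<le> r * 1" using x r by (intro mult_left_mono) auto
  then show "r *\<^sub>R x \<in> closure (convex hull unitaries)"
    using r by (intro open_ball_subset_unitary_hull) simp
qed simp

lemma bounded_linear_tensor_right: "bounded_linear (\<lambda>y. x \<otimes> y)"
  by (rule bounded_linear_intro [where K = "norm x"])
    (simp_all add: tensor_add_right tensor_scaleR_right norm_tensor_le mult.commute [of _ "norm x"])

lemma bounded_linear_tensor_left: "bounded_linear (\<lambda>x. x \<otimes> y)"
  by (rule bounded_linear_intro [where K = "norm y"])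
    (simp_all add: tensor_add_left tensor_scaleR_left norm_tensor_le)

text \<open>The Russo-Dye theorem in the form in which it is applied in each tensor factor separately.\<close>

lemma unit_ball_into_closed_convex:
  fixes L :: "'a::unital_cstar_algebra \<Rightarrow> 'c::real_normed_vector"
  assumes L: "bounded_linear L" and H: "closed H" "convex H" and U: "\<And>u. u \<in> unitaries \<Longrightarrow> L u \<in> H"
    and y: "norm y \<le> 1"
  shows "L y \<in> H"
proof -
  interpret L: bounded_linear L by (rule L)
  have "convex hull unitaries \<subseteq> L -` H"
    by (rule hull_minimal) (auto simp: U intro: convex_linear_vimage L.linear H)
  moreover have "closed (L -` H)"
    by (rule closed_vimage [OF H(1)]) (intro L.continuous_on continuous_on_id)
  ultimately have "closure (convex hull unitaries) \<subseteq> L -` H" by (rule closure_minimal)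
  then show ?thesis using russo_dye [OF y] by blast
qed

definition unitary_tensors :: "('a::unital_cstar_algebra, 'b::unital_cstar_algebra) proj_tensor_product set"
  where "unitary_tensors = {u \<otimes> v | u v. u \<in> unitaries \<and> v \<in> unitaries}"

text \<open>The closed convex hull \<open>H\<close> of the tensors of unitaries contains all elementary tensors of contractions,
and every element of norm less than one is a limit of sums of elementary tensors
with \<open>\<Sum> norm x * norm y < 1\<close>, that is, of subconvex combinations of elements of \<open>H\<close>.\<close>

lemma proj_unit_ball_subset_hull:
  fixes w :: "('a::unital_cstar_algebra, 'b::unital_cstar_algebra) proj_tensor_product"
  assumes w: "norm w \<le> 1" shows "w \<in> closure (convex hull unitary_tensors)"
proof -
  define H :: "('a, 'b) proj_tensor_product set" where "H = closure (convex hull unitary_tensors)"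
  have H: "closed H" "convex H" by (simp_all add: H_def convex_closure convex_convex_hull)
  have UT: "t \<in> H" if "t \<in> unitary_tensors" for t
    unfolding H_def using that by (meson closure_subset hull_inc subsetD)
  have 1: "u \<otimes> y \<in> H" if "u \<in> unitaries" "norm y \<le> 1" for u y
    by (rule unit_ball_into_closed_convex [OF bounded_linear_tensor_right H _ that(2)])
      (use that UT in \<open>auto simp: unitary_tensors_def\<close>)
  have 2: "x \<otimes> y \<in> H" if "norm x \<le> 1" "norm y \<le> 1" for x y
    by (rule unit_ball_into_closed_convex [OF bounded_linear_tensor_left H _ that(1)])
      (use that 1 in auto)
  have zero: "0 \<in> H" using 2 [of 0 0] by simp
  have scale: "r *\<^sub>R h \<in> H" if "h \<in> H" "0 \<le> r" "r \<le> 1" for r h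
    using convexD [OF H(2) that(1) zero, of r "1 - r"] that by simp
  have sum: "\<exists>h\<in>H. (\<Sum>(x, y)\<in>#M. x \<otimes> y) = (\<Sum>(x, y)\<in>#M. norm x * norm y) *\<^sub>R h" for M
  proof (induction M)
    case empty
    show ?case using zero by auto
  next
    case (add p M)
    obtain x y where p: "p = (x, y)" by (cases p)
    obtain h where h: "h \<in> H" "(\<Sum>(x, y)\<in>#M. x \<otimes> y) = (\<Sum>(x, y)\<in>#M. norm x * norm y) *\<^sub>R h"
      using add by blast
    define s where "s = (\<Sum>(x, y)\<in>#M. norm x * norm y)"
    define t where "t = norm x * norm y"
    have s: "s \<ge> 0" "t \<ge> 0" by (simp_all add: s_def t_def sum_norms_nonneg)
    define g where "g = sgn x \<otimes> sgn y"
    have g: "g \<in> H" unfolding g_def by (intro 2) (simp_all add: norm_sgn)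
    have xy: "x \<otimes> y = t *\<^sub>R g"
    proof (cases "x = 0 \<or> y = 0")
      case False
      then have "t * (inverse (norm x) * inverse (norm y)) = 1" by (simp add: t_def divide_simps)
      moreover have "t *\<^sub>R g = (t * (inverse (norm x) * inverse (norm y))) *\<^sub>R (x \<otimes> y)"
        by (simp add: g_def sgn_div_norm tensor_scaleR_left tensor_scaleR_right)
      ultimately show ?thesis by (metis scaleR_one)
    qed (auto simp: t_def)
    have "\<exists>h'\<in>H. t *\<^sub>R g + s *\<^sub>R h = (t + s) *\<^sub>R h'"
    proof (cases "t + s = 0")
      case True
      then have "t = 0" "s = 0" using s by linarith+
      then show ?thesis using zero by auto
    next
      case False
      then have "t + s > 0" using s by simp
      then show ?thesis using s g h(1)
        by (intro bexI [of _ "(t / (t + s)) *\<^sub>R g + (s / (t + s)) *\<^sub>R h"] convexD [OF H(2)])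
          (auto simp: scaleR_add_right add_divide_distrib [symmetric])
    qed
    then show ?case by (simp add: p h(2) xy) (simp add: s_def t_def)
  qed
  have ball: "v \<in> H" if v: "norm v < 1" for v
  proof -
    have "\<exists>u\<in>H. dist u v < e" if e: "e > 0" for e
    proof -
      obtain u where u: "norm (v - completion_embed u) < min e (1 - norm v)"
        using completion_embed_dense [of "min e (1 - norm v)" v] e v by auto
      then have "norm (completion_embed u) < 1"
        using norm_triangle_ineq2 [of "completion_embed u" v] by (simp add: norm_minus_commute)
      then have "1 - proj_norm u > 0" by (simp add: norm_completion_embed)
      then obtain M where M: "u = (\<Sum>(x, y)\<in>#M. alg_tensor x y)"
        "(\<Sum>(x, y)\<in>#M. norm x * norm y) < proj_norm u + (1 - proj_norm u)"
        by (rule proj_norm_approx)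
      have "completion_embed (\<Sum>(x, y)\<in>#M. alg_tensor x y) = (\<Sum>(x, y)\<in>#M. x \<otimes> y)"
        by (induction M) (auto simp: completion_embed_zero completion_embed_add tensor_def)
      then have "completion_embed u = (\<Sum>(x, y)\<in>#M. x \<otimes> y)" using M(1) by simp
      then have "completion_embed u \<in> H"
        using sum [of M] M(2) by (auto intro!: scale simp: sum_norms_nonneg)
      then show ?thesis using u by (intro bexI [of _ "completion_embed u"]) (auto simp: dist_norm norm_minus_commute)
    qed
    then have "v \<in> closure H" by (simp add: closure_approachable)
    then show ?thesis using H(1) by simp
  qed
  show ?thesis unfolding H_def [symmetric]
  proof (rule closed_contains_if_contains_shrinkings [OF H(1)])
    fix r :: real assume r: "0 \<le> r" "r < 1"
    have "r * norm w \<le> r * 1" using w r by (intro mult_left_mono) auto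
    then show "r *\<^sub>R w \<in> H" using r by (intro ball) simp
  qed
qed

section \<open>Analytic discs in the tensor product\<close>

lemma cauchy_estimate_shifted:
  fixes A B D :: "nat \<Rightarrow> 'a::complex_normed_vector"
  assumes bound: "\<And>z. cmod z = 1 \<Longrightarrow> norm ((\<Sum>k<M. z ^ k *\<^sub>C A k) + z *\<^sub>C (\<Sum>k<M. z ^ k *\<^sub>C B k)
      + z\<^sup>2 *\<^sub>C (\<Sum>k<M. z ^ k *\<^sub>C D k)) \<le> C"
    and "1 < M"
  shows "norm (A 1 + B 0) \<le> C"
proof -
  define cut :: "(nat \<Rightarrow> 'a) \<Rightarrow> nat \<Rightarrow> 'a" where "cut = (\<lambda>A k. if k < M then A k else 0)"
  define sh :: "(nat \<Rightarrow> 'a) \<Rightarrow> nat \<Rightarrow> 'a" where "sh = (\<lambda>A k. case k of 0 \<Rightarrow> 0 | Suc k \<Rightarrow> A k)"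
  have cut: "(\<Sum>k<M. z ^ k *\<^sub>C A k) = (\<Sum>k<Suc M. z ^ k *\<^sub>C cut A k)"
    "(\<Sum>k<M. z ^ k *\<^sub>C A k) = (\<Sum>k<Suc (Suc M). z ^ k *\<^sub>C cut A k)" for z A
    by (simp_all add: cut_def)
  have sh: "z *\<^sub>C (\<Sum>k<n. z ^ k *\<^sub>C A k) = (\<Sum>k<Suc n. z ^ k *\<^sub>C sh A k)" for z A n
    by (subst sum.lessThan_Suc_shift) (simp add: sh_def scaleC_sum_right scaleC_scaleC)
  define c where "c = (\<lambda>k. cut A k + sh (cut B) k + sh (sh (cut D)) k)"
  have "norm (c 1) \<le> C"
  proof (rule cauchy_estimate)
    fix z :: complex assume z: "cmod z = 1"
    have "z\<^sup>2 *\<^sub>C (\<Sum>k<M. z ^ k *\<^sub>C D k) = z *\<^sub>C z *\<^sub>C (\<Sum>k<M. z ^ k *\<^sub>C D k)"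
      by (simp add: scaleC_scaleC power2_eq_square)
    also have "\<dots> = (\<Sum>k<Suc (Suc M). z ^ k *\<^sub>C sh (sh D) k)" by (simp only: sh)
    also have "\<dots> = (\<Sum>k<Suc (Suc M). z ^ k *\<^sub>C sh (sh (cut D)) k)"
      by (intro sum.cong) (auto simp: sh_def cut_def split: nat.split)
    finally have "(\<Sum>k<M. z ^ k *\<^sub>C A k) + z *\<^sub>C (\<Sum>k<M. z ^ k *\<^sub>C B k)
      + z\<^sup>2 *\<^sub>C (\<Sum>k<M. z ^ k *\<^sub>C D k) = (\<Sum>k<Suc (Suc M). z ^ k *\<^sub>C c k)"
      by (simp only: cut(2) [of z A] cut(1) [of z B] sh c_def scaleC_add_right sum.distrib)
    then show "norm (\<Sum>k<Suc (Suc M). z ^ k *\<^sub>C c k) \<le> C" using bound [OF z] by simp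
  qed simp
  then show ?thesis using \<open>1 < M\<close> by (simp add: c_def cut_def sh_def)
qed

text \<open>Let \<open>F \<zeta> = q + \<zeta> X (1 - q\<^sup>2) + \<dots>\<close> be the disc of unitaries through \<open>q\<close>, and let
\<open>G \<zeta> = 1 + s (cnj \<zeta> b - \<zeta> star b)\<close>, a skew perturbation of the unit, which has norm at most
\<open>1 + 2 s\<^sup>2\<close>. In the mean of \<open>F \<zeta> \<otimes> G \<zeta>\<close> over the circle, only two terms survive: \<open>q \<otimes> 1\<close>, and the product of
the first coefficient of \<open>F\<close> with \<open>s b\<close>. There is no term with \<open>star b\<close>, because \<open>F\<close> is
analytic. The gain is that \<open>s\<close> enters the bound quadratically but the element linearly. In the
proof \<open>G \<zeta>\<close> is multiplied by \<open>\<zeta>\<close>, which makes the product a polynomial.\<close>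

lemma disc_tensor_bound:
  fixes q X :: "'a::unital_cstar_algebra" and b :: "'b::unital_cstar_algebra"
  assumes q: "star q = q" "norm q < 1" and X: "X \<in> unitaries" "X * q = q * X"
    and b: "norm b \<le> 1" and s: "s \<ge> 0"
  shows "norm (q \<otimes> 1 + s *\<^sub>R ((X * (1 - q * q)) \<otimes> b)) \<le> 1 + 2 * s\<^sup>2"
proof -
  obtain c K where c: "c 0 = q" "c 1 = sqrt_one_minus (q * star q) * X * sqrt_one_minus (star q * q)"
    and F: "\<And>\<zeta> N. cmod \<zeta> = 1 \<Longrightarrow> \<exists>F\<in>unitaries. norm (F - (\<Sum>k<Suc N. \<zeta> ^ k *\<^sub>C c k)) \<le> K * norm q ^ N"
    using unitary_dilation_polynomial [OF q(2) X(1)] by blast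
  have qq: "norm (q * q) < 1"
    using norm_mult_ineq [of q q] mult_strict_mono' [OF q(2) q(2)] by simp
  have "X * sqrt_one_minus (q * q) = sqrt_one_minus (q * q) * X"
    by (rule sqrt_one_minus_intertwines [OF _ qq qq]) (metis X(2) mult.assoc)
  then have "c 1 = X * (sqrt_one_minus (q * q) * sqrt_one_minus (q * q))"
    unfolding c(2) q(1) by (simp add: mult.assoc [symmetric])
  then have c1: "c 1 = X * (1 - q * q)" by (simp only: sqrt_one_minus_square [OF qq])
  have G: "norm (\<zeta> *\<^sub>C 1 + s *\<^sub>R b - (s *\<^sub>R \<zeta>\<^sup>2 *\<^sub>C star b)) \<le> 1 + 2 * s\<^sup>2" if \<zeta>: "cmod \<zeta> = 1" for \<zeta>
  proof -
    have cc: "\<zeta> * cnj \<zeta> = 1" using complex_norm_square [of \<zeta>] \<zeta> by simp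
    define k where "k = s *\<^sub>R (cnj \<zeta> *\<^sub>C b - \<zeta> *\<^sub>C star b)"
    have "star k = - k"
      by (simp add: k_def star_scaleR star_diff star_scaleC star_star scaleR_diff_right)
    then have "norm (1 + k) \<le> 1 + (norm k)\<^sup>2 / 2" by (rule norm_one_plus_skew)
    also have "norm k \<le> 2 * s"
    proof -
      have "norm (cnj \<zeta> *\<^sub>C b - \<zeta> *\<^sub>C star b) \<le> 2"
        using norm_triangle_ineq4 [of "cnj \<zeta> *\<^sub>C b" "\<zeta> *\<^sub>C star b"] b \<zeta> by (simp add: norm_scaleC norm_star)
      from mult_left_mono [OF this s] show ?thesis using s by (simp add: k_def mult.commute)
    qed
    then have "(norm k)\<^sup>2 / 2 \<le> (2 * s)\<^sup>2 / 2" by (intro divide_right_mono power_mono) auto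
    also have "\<dots> = 2 * s\<^sup>2" by (simp add: power2_eq_square)
    finally have "norm (1 + k) \<le> 1 + 2 * s\<^sup>2" by simp
    moreover have "\<zeta> *\<^sub>C 1 + s *\<^sub>R b - (s *\<^sub>R \<zeta>\<^sup>2 *\<^sub>C star b) = \<zeta> *\<^sub>C (1 + k)"
      by (simp add: k_def scaleC_add_right scaleC_diff_right scaleC_scaleR scaleC_scaleC cc scaleC_one
          power2_eq_square scaleR_diff_right)
    ultimately show ?thesis by (simp add: norm_scaleC \<zeta>)
  qed
  have bound: "norm (q \<otimes> 1 + s *\<^sub>R ((X * (1 - q * q)) \<otimes> b)) \<le> (1 + K * norm q ^ Suc N) * (1 + 2 * s\<^sup>2)" for N
  proof -
    let ?M = "Suc (Suc N)"
    have "norm (s *\<^sub>R (c 1 \<otimes> b) + c 0 \<otimes> 1) \<le> (1 + K * norm q ^ Suc N) * (1 + 2 * s\<^sup>2)"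
    proof (rule cauchy_estimate_shifted [where A = "\<lambda>k. s *\<^sub>R (c k \<otimes> b)" and B = "\<lambda>k. c k \<otimes> 1"
          and D = "\<lambda>k. - (s *\<^sub>R (c k \<otimes> star b))" and M = ?M])
      fix z :: complex assume z: "cmod z = 1"
      let ?P = "\<Sum>k<?M. z ^ k *\<^sub>C c k"
      obtain F where F: "F \<in> unitaries" "norm (F - ?P) \<le> K * norm q ^ Suc N" using F [OF z] by blast
      have P: "norm ?P \<le> 1 + K * norm q ^ Suc N"
      proof -
        have "norm Q \<le> norm F + norm (F - Q)" for Q using norm_triangle_ineq4 [of F "F - Q"] by simp
        from this [of ?P] show ?thesis using F(2) norm_unitary [OF F(1)] by linarith
      qed
      have "(\<Sum>k<?M. z ^ k *\<^sub>C s *\<^sub>R (c k \<otimes> b)) + z *\<^sub>C (\<Sum>k<?M. z ^ k *\<^sub>C (c k \<otimes> 1))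
          + z\<^sup>2 *\<^sub>C (\<Sum>k<?M. z ^ k *\<^sub>C (- (s *\<^sub>R (c k \<otimes> star b))))
          = s *\<^sub>R (?P \<otimes> b) + z *\<^sub>C (?P \<otimes> 1) - z\<^sup>2 *\<^sub>C (s *\<^sub>R (?P \<otimes> star b))"
        by (simp only: tensor_sum_left tensor_scaleC_left scaleR_sum_right scaleC_scaleR
            scaleC_minus_right sum_negf diff_conv_add_uminus)
      also have "\<dots> = ?P \<otimes> (z *\<^sub>C 1 + s *\<^sub>R b - (s *\<^sub>R z\<^sup>2 *\<^sub>C star b))"
        by (simp only: tensor_add_right tensor_diff_right tensor_scaleR_right tensor_scaleC_right scaleC_scaleR)
          (simp add: algebra_simps)
      also have "norm \<dots> \<le> norm ?P * norm (z *\<^sub>C 1 + s *\<^sub>R b - (s *\<^sub>R z\<^sup>2 *\<^sub>C star b))"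
        by (rule norm_tensor_le)
      also have "\<dots> \<le> (1 + K * norm q ^ Suc N) * (1 + 2 * s\<^sup>2)"
        using P G [OF z] order_trans [OF norm_ge_zero P] by (intro mult_mono) auto
      finally show "norm ((\<Sum>k<?M. z ^ k *\<^sub>C s *\<^sub>R (c k \<otimes> b)) + z *\<^sub>C (\<Sum>k<?M. z ^ k *\<^sub>C (c k \<otimes> 1))
          + z\<^sup>2 *\<^sub>C (\<Sum>k<?M. z ^ k *\<^sub>C (- (s *\<^sub>R (c k \<otimes> star b))))) \<le> (1 + K * norm q ^ Suc N) * (1 + 2 * s\<^sup>2)" .
    qed simp
    then show ?thesis by (simp only: c(1) c1 add.commute)
  qed
  have "(\<lambda>N. norm q ^ Suc N) \<longlonglongrightarrow> 0"
    using q(2) by (intro LIMSEQ_Suc [OF LIMSEQ_power_zero]) simp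
  then have "(\<lambda>N. (1 + K * norm q ^ Suc N) * (1 + 2 * s\<^sup>2)) \<longlonglongrightarrow> (1 + K * 0) * (1 + 2 * s\<^sup>2)"
    by (intro tendsto_intros)
  from LIMSEQ_le_const [OF this] show ?thesis using bound by simp
qed

section \<open>Averages of unitaries close to the unit\<close>

definition re_part :: "'a::involutive_algebra \<Rightarrow> 'a"
  where "re_part x = (1 / 2) *\<^sub>R (x + star x)"

lemma star_re_part: "star (re_part x) = re_part x"
  by (simp add: re_part_def star_scaleR star_add star_star add.commute)

lemma norm_re_part_le: "norm (re_part x) \<le> norm x" for x :: "'a::banach_star_algebra"
  using norm_triangle_ineq [of x "star x"] by (simp add: re_part_def norm_star)

lemma re_part_diff: "re_part (x - y) = re_part x - re_part y"
  by (simp add: re_part_def star_diff scaleR_add_right scaleR_diff_right)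

lemma re_part_one: "re_part (1 :: 'a::{involutive_algebra, monoid_mult}) = 1"
  by (simp add: re_part_def star_one flip: scaleR_2)

lemma re_part_sum: "re_part (\<Sum>i\<in>I. t i *\<^sub>R x i) = (\<Sum>i\<in>I. t i *\<^sub>R re_part (x i))"
  by (simp add: re_part_def star_sum star_scaleR scaleR_sum_right scaleR_add_right sum.distrib mult.commute)

lemma norm_weighted_sum_le:
  fixes x :: "'i \<Rightarrow> 'a::real_normed_vector"
  assumes "\<And>i. i \<in> I \<Longrightarrow> 0 \<le> t i" "sum t I = 1" "\<And>i. i \<in> I \<Longrightarrow> norm (x i) \<le> B"
  shows "norm (\<Sum>i\<in>I. t i *\<^sub>R x i) \<le> B"
proof -
  have "norm (\<Sum>i\<in>I. t i *\<^sub>R x i) \<le> (\<Sum>i\<in>I. t i * B)"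
    using assms by (intro sum_norm_le) (auto intro: mult_left_mono)
  also have "\<dots> = B" using assms(2) by (simp flip: sum_distrib_right)
  finally show ?thesis .
qed

lemma weighted_sum_const: "sum t I = 1 \<Longrightarrow> (\<Sum>i\<in>I. t i *\<^sub>R c) = (c :: 'a::real_vector)"
  by (simp flip: scaleR_sum_left)

text \<open>For commuting unitaries \<open>p\<close> and \<open>q\<close>, the defect \<open>1 - Re (p q)\<close> is at most
\<open>2 (1 - Re p) + 2 (1 - Re q)\<close>, since the difference is half of \<open>star y * y\<close> for a normal element
\<open>y\<close>: this is the parallelogram law for \<open>1 - q\<close> and \<open>q (1 - p)\<close>.\<close>

lemma commuting_unitaries_square:
  fixes p q :: "'a::unital_cstar_algebra"
  assumes "p \<in> unitaries" "q \<in> unitaries" and pq: "p * q = q * p"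
  defines "y \<equiv> 1 - 2 *\<^sub>R q + p * q"
  shows "(1 / 4) *\<^sub>R (star y * y + y * star y)
    = 2 *\<^sub>R (1 - re_part q) + 2 *\<^sub>R (1 - re_part p) - (1 - re_part (p * q))"
proof -
  define P Q where "P = star p" and "Q = star q"
  have pP: "p * P = 1" "P * p = 1" "q * Q = 1" "Q * q = 1"
    using assms(1,2) by (auto simp: unitaries_def P_def Q_def)
  have PQ: "Q * P = P * Q" using arg_cong [OF pq, of star] by (simp add: P_def Q_def star_mult)
  have e1: "Q * (P * (p * q)) = 1" "p * (q * (Q * P)) = 1"
    by (metis mult.assoc mult.left_neutral pP)+
  have e2: "Q * (p * q) = p" "Q * (P * q) = P" "q * (Q * P) = P"
    using PQ pq by (metis mult.assoc mult.left_neutral mult.right_neutral pP)+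
  have sy: "star y = 1 - 2 *\<^sub>R Q + Q * P"
    by (simp add: y_def star_add star_diff star_one star_scaleR star_mult P_def Q_def)
  let ?N = "1 + 4 *\<^sub>R 1 + 1 - 2 *\<^sub>R q - 2 *\<^sub>R Q + p * q + Q * P - 2 *\<^sub>R p - 2 *\<^sub>R P"
  have a: "star y * y = ?N"
    unfolding sy unfolding y_def by (simp add: algebra_simps e1 e2 pP)
  have b: "y * star y = ?N"
    unfolding sy unfolding y_def by (simp add: algebra_simps e1 e2 pP)
  have r: "re_part q = (1/2) *\<^sub>R (q + Q)" "re_part p = (1/2) *\<^sub>R (p + P)"
    "re_part (p * q) = (1/2) *\<^sub>R (p * q + Q * P)"
    by (simp_all add: re_part_def P_def Q_def star_mult)
  have "(1 / 4) *\<^sub>R (star y * y + y * star y) = (1 / 2) *\<^sub>R ?N"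
    unfolding a b by (simp flip: scaleR_2)
  also have "\<dots> = (1 / 2) *\<^sub>R (1 + 1) + 2 *\<^sub>R 1 - (q + Q) + re_part (p * q) - (p + P)"
    by (simp only: scaleR_add_right scaleR_diff_right r) (simp add: algebra_simps)
  also have "(1 / 2) *\<^sub>R (1 + 1 :: 'a) = 1" by (simp flip: scaleR_2)
  finally show ?thesis unfolding r by (simp add: scaleR_2 algebra_simps)
qed

locale unitary_average =
  fixes I :: "'i set" and t :: "'i \<Rightarrow> real" and u :: "'i \<Rightarrow> 'a::unital_cstar_algebra"
  assumes weight_nonneg: "\<And>i. i \<in> I \<Longrightarrow> 0 \<le> t i" and weight_sum: "sum t I = 1"
    and unitary: "\<And>i. i \<in> I \<Longrightarrow> u i \<in> unitaries"
begin

definition defect :: "nat \<Rightarrow> 'a"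
  where "defect k = (\<Sum>i\<in>I. t i *\<^sub>R (1 - re_part (u i ^ k)))"

lemma defect_eq: "defect k = 1 - (\<Sum>i\<in>I. t i *\<^sub>R re_part (u i ^ k))"
  by (simp add: defect_def scaleR_diff_right sum_subtractf weighted_sum_const weight_sum)

lemma star_defect: "star (defect k) = defect k"
  by (simp add: defect_def star_sum star_scaleR star_diff star_one star_re_part)

lemma norm_re_part_power: "i \<in> I \<Longrightarrow> norm (re_part (u i ^ k)) \<le> 1"
  using norm_re_part_le [of "u i ^ k"] norm_unitary [OF unitary_power [OF unitary]] by metis

lemma norm_defect_le_2: "norm (defect k) \<le> 2"
proof -
  have "norm (\<Sum>i\<in>I. t i *\<^sub>R re_part (u i ^ k)) \<le> 1"
    by (rule norm_weighted_sum_le [OF weight_nonneg weight_sum norm_re_part_power])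
  then show ?thesis
    unfolding defect_eq using norm_triangle_ineq4 [of 1 "\<Sum>i\<in>I. t i *\<^sub>R re_part (u i ^ k)"] by simp
qed

lemma norm_one_minus_defect_le:
  assumes "0 \<le> s" "s \<le> 1" shows "norm (1 - s *\<^sub>R defect k) \<le> 1"
proof -
  have "1 - s *\<^sub>R defect k = (1 - s) *\<^sub>R 1 + s *\<^sub>R (\<Sum>i\<in>I. t i *\<^sub>R re_part (u i ^ k))"
    by (simp add: defect_eq scaleR_diff_right scaleR_diff_left)
  also have "norm \<dots> \<le> (1 - s) + s * norm (\<Sum>i\<in>I. t i *\<^sub>R re_part (u i ^ k))"
    using assms norm_triangle_ineq [of "(1 - s) *\<^sub>R (1::'a)"] by (metis (no_types, lifting) abs_of_nonneg diff_ge_0_iff_ge mult.right_neutral norm_one norm_scaleR)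
  also have "norm (\<Sum>i\<in>I. t i *\<^sub>R re_part (u i ^ k)) \<le> 1"
    by (rule norm_weighted_sum_le [OF weight_nonneg weight_sum norm_re_part_power])
  finally show ?thesis using assms by (simp add: mult_left_mono)
qed

text \<open>The defect of the \<open>k\<close>-th powers is controlled by that of the first powers. The induction step
writes \<open>1 + s defect (Suc k)\<close> as the mean of three elements whose norms are \<open>1\<close> up to terms of
order \<open>s\<^sup>2\<close> and \<open>s \<epsilon>\<close>. Upper bounds of this kind, for all \<open>s \<ge> 0\<close>, play the part of order
relations between self-adjoint elements. The sequence \<open>C k = 400 * 13 ^ k\<close>
serves because \<open>C (Suc k)\<close> is at least \<open>12 * C k + 384\<close> and at least \<open>2 * C k + 2\<close>.\<close>

lemma norm_one_plus_defect_le: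
  assumes e: "norm (1 - (\<Sum>i\<in>I. t i *\<^sub>R u i)) \<le> \<epsilon>" and s: "0 \<le> s"
  shows "norm (1 + s *\<^sub>R defect k) \<le> 1 + 400 * 13 ^ k * (s\<^sup>2 + s * \<epsilon>)"
proof -
  have e0: "0 \<le> \<epsilon>" using e norm_ge_zero order_trans by blast
  show ?thesis
    using s
  proof (induction k arbitrary: s)
    case 0
    then show ?case using e0 by (simp add: defect_def re_part_one)
  next
    case (Suc k)
    have d1: "norm (1 + (6 * s) *\<^sub>R defect 1) \<le> 1 + 6 * s * \<epsilon>"
    proof -
      have "defect 1 = re_part (1 - (\<Sum>i\<in>I. t i *\<^sub>R u i))"
        by (simp add: defect_eq re_part_diff re_part_one re_part_sum)
      then have "norm (defect 1) \<le> \<epsilon>" using norm_re_part_le e order_trans by metis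
      then have "6 * s * norm (defect 1) \<le> 6 * s * \<epsilon>" using Suc.prems by (intro mult_left_mono) auto
      then show ?thesis
        using norm_triangle_ineq [of 1 "(6 * s) *\<^sub>R defect 1"] Suc.prems by simp
    qed
    define y where "y = (\<lambda>i. 1 - 2 *\<^sub>R u i ^ k + u i ^ Suc k)"
    define R where "R = (\<Sum>i\<in>I. t i *\<^sub>R (1 / 4) *\<^sub>R (star (y i) * y i + y i * star (y i)))"
    have y: "(1 / 4) *\<^sub>R (star (y i) * y i + y i * star (y i)) =
        2 *\<^sub>R (1 - re_part (u i ^ k)) + 2 *\<^sub>R (1 - re_part (u i ^ 1)) - (1 - re_part (u i ^ Suc k))"
      if i: "i \<in> I" for i
    proof -
      have "u i ^ Suc k = u i * u i ^ k" by simp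
      then show ?thesis
        using commuting_unitaries_square [OF unitary [OF i] unitary_power [OF unitary [OF i]] power_commutes [symmetric], of k]
        by (simp add: y_def)
    qed
    have R: "defect (Suc k) = 2 *\<^sub>R defect k + 2 *\<^sub>R defect 1 - R"
    proof -
      have "R = (\<Sum>i\<in>I. t i *\<^sub>R (2 *\<^sub>R (1 - re_part (u i ^ k)) + 2 *\<^sub>R (1 - re_part (u i ^ 1)) - (1 - re_part (u i ^ Suc k))))"
        unfolding R_def using y by (intro sum.cong) auto
      then show ?thesis
        unfolding defect_def
        by (simp only: scaleR_sum_right scaleR_add_right scaleR_diff_right sum.distrib sum_subtractf scaleR_left_commute [of 2])
          simp
    qed
    have nR: "norm (1 - (3 * s) *\<^sub>R R) \<le> 1 + 1152 * s\<^sup>2"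
    proof -
      have "1 - (3 * s) *\<^sub>R R
          = (\<Sum>i\<in>I. t i *\<^sub>R (1 - (3 * s / 4) *\<^sub>R (star (y i) * y i + y i * star (y i))))"
        by (simp add: R_def scaleR_diff_right sum_subtractf weighted_sum_const weight_sum scaleR_sum_right mult.commute)
      also have "norm \<dots> \<le> 1 + 1152 * s\<^sup>2"
      proof (rule norm_weighted_sum_le [OF weight_nonneg weight_sum])
        fix i assume i: "i \<in> I"
        have "norm (1 - 2 *\<^sub>R u i ^ k) \<le> 1 + 2"
          using norm_triangle_ineq4 [of 1 "2 *\<^sub>R u i ^ k"] norm_unitary [OF unitary_power [OF unitary [OF i]]] by simp
        then have "norm (y i) \<le> 4"
          using norm_triangle_ineq [of "1 - 2 *\<^sub>R u i ^ k" "u i ^ Suc k"]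
            norm_unitary [OF unitary_power [OF unitary [OF i]], of "Suc k"] unfolding y_def by linarith
        then have "norm (y i) ^ 4 \<le> 4 ^ 4" by (intro power_mono) auto
        then have "8 * (3 * s / 4)\<^sup>2 * norm (y i) ^ 4 \<le> 8 * (3 * s / 4)\<^sup>2 * 4 ^ 4"
          by (intro mult_left_mono) auto
        also have "\<dots> = 1152 * s\<^sup>2" by (simp add: power2_eq_square)
        finally have "1 + 8 * (3 * s / 4)\<^sup>2 * norm (y i) ^ 4 \<le> 1 + 1152 * s\<^sup>2" by (rule add_left_mono)
        moreover have "norm (1 - (3 * s / 4) *\<^sub>R (star (y i) * y i + y i * star (y i)))
            \<le> 1 + 8 * (3 * s / 4)\<^sup>2 * norm (y i) ^ 4"
          using Suc.prems by (intro norm_one_minus_jordan_square) simp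
        ultimately show "norm (1 - (3 * s / 4) *\<^sub>R (star (y i) * y i + y i * star (y i))) \<le> 1 + 1152 * s\<^sup>2"
          by (rule order_trans [rotated])
      qed
      finally show ?thesis .
    qed
    have "3 *\<^sub>R (1 + s *\<^sub>R defect (Suc k))
        = (1 + (6 * s) *\<^sub>R defect k) + (1 + (6 * s) *\<^sub>R defect 1) + (1 - (3 * s) *\<^sub>R R)"
    proof -
      have "(3::real) *\<^sub>R (1::'a) = 1 + 1 + 1" by (simp add: scaleR_left_distrib [of 1 1, simplified] scaleR_left_distrib [of 1 2, simplified])
      then show ?thesis by (simp add: R scaleR_add_right scaleR_diff_right algebra_simps)
    qed
    then have "3 * norm (1 + s *\<^sub>R defect (Suc k))
        \<le> norm (1 + (6 * s) *\<^sub>R defect k) + norm (1 + (6 * s) *\<^sub>R defect 1) + norm (1 - (3 * s) *\<^sub>R R)"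
      by (metis abs_numeral norm_scaleR norm_triangle_le norm_triangle_ineq add_right_mono)
    also have "\<dots> \<le> (1 + 400 * 13 ^ k * ((6 * s)\<^sup>2 + 6 * s * \<epsilon>)) + (1 + 6 * s * \<epsilon>) + (1 + 1152 * s\<^sup>2)"
      using Suc.prems by (intro add_mono Suc.IH d1 nR) auto
    also have "\<dots> \<le> 3 * (1 + 400 * 13 ^ Suc k * (s\<^sup>2 + s * \<epsilon>))"
    proof -
      have c: "(1::real) \<le> 13 ^ k" by simp
      then have "(1152::real) \<le> 1200 * 13 ^ k" "(6::real) \<le> 13200 * 13 ^ k" by linarith+
      then have "1152 * s\<^sup>2 \<le> (1200 * 13 ^ k) * s\<^sup>2" "6 * (s * \<epsilon>) \<le> (13200 * 13 ^ k) * (s * \<epsilon>)"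
        using Suc.prems e0 by (intro mult_right_mono; simp)+
      then show ?thesis by (simp add: power_mult_distrib algebra_simps)
    qed
    finally show ?case by simp
  qed
qed

text \<open>The perturbations \<open>1 + c s defect k\<close> have norm \<open>1 + O(s\<^sup>2 + s \<epsilon>)\<close> for each of the four values
\<open>c = 1, - 1, \<i>, - \<i>\<close>, hence, by convexity, with \<open>s / 2\<close> in place of \<open>s\<close> in every direction; the choice
\<open>s = \<epsilon>\<close> balances the two error terms.\<close>

lemma norm_defect_le:
  assumes e: "norm (1 - (\<Sum>i\<in>I. t i *\<^sub>R u i)) \<le> \<epsilon>" and \<epsilon>: "0 < \<epsilon>" "\<epsilon> \<le> 1"
  shows "norm (defect k) \<le> 36 * (400 * 13 ^ k) * \<epsilon>"
proof -
  define C :: real where "C = 400 * 13 ^ k"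
  have "(1::real) \<le> 13 ^ k" by simp
  then have C: "C \<ge> 1" unfolding C_def by linarith
  define \<beta> where "\<beta> = 2 * C * \<epsilon>\<^sup>2"
  have \<beta>: "\<beta> > 0" "2 * \<epsilon>\<^sup>2 \<le> \<beta>" using C \<epsilon> by (simp_all add: \<beta>_def)
  show ?thesis
  proof (cases "\<beta> \<le> 1")
    case False
    have "\<beta> \<le> 2 * C * \<epsilon>" using \<epsilon> C by (simp add: \<beta>_def power2_eq_square mult_left_le)
    with False have "36 * C * \<epsilon> \<ge> 18" by simp
    then have "2 \<le> 36 * C * \<epsilon>" by linarith
    then show ?thesis using norm_defect_le_2 [of k] unfolding C_def by (rule order_trans [rotated])
  next
    case True
    let ?D = "\<epsilon> *\<^sub>R defect k"
    have up: "norm (1 + ?D) \<le> 1 + \<beta>"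
      using norm_one_plus_defect_le [OF e, of \<epsilon> k] \<epsilon> by (simp add: \<beta>_def C_def power2_eq_square)
    have down: "norm (1 - ?D) \<le> 1 + \<beta>"
      using norm_one_minus_defect_le [of \<epsilon> k] \<epsilon> \<beta> by simp
    have side: "norm (1 + c *\<^sub>C ?D) \<le> 1 + \<beta>" if c: "cmod c = 1" "cnj c = - c" for c
    proof -
      have "star (c *\<^sub>C ?D) = - (c *\<^sub>C ?D)"
        by (simp add: star_scaleC star_scaleR star_defect c scaleC_minus_left)
      then have "norm (1 + c *\<^sub>C ?D) \<le> 1 + (norm (c *\<^sub>C ?D))\<^sup>2 / 2" by (rule norm_one_plus_skew)
      also have "norm (c *\<^sub>C ?D) \<le> 2 * \<epsilon>"
        using norm_defect_le_2 [of k] \<epsilon> by (simp add: norm_scaleC c)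
      then have "(norm (c *\<^sub>C ?D))\<^sup>2 / 2 \<le> (2 * \<epsilon>)\<^sup>2 / 2" by (intro divide_right_mono power_mono) auto
      also have "\<dots> \<le> \<beta>" using \<beta> by (simp add: power_mult_distrib)
      finally show ?thesis by simp
    qed
    have "norm ((1 / 2) *\<^sub>R ?D) \<le> 9 * \<beta>"
    proof (rule small_if_perturbs_one_little)
      fix \<zeta> :: complex assume \<zeta>: "cmod \<zeta> = 1"
      define x y where "x = Re \<zeta>" and "y = Im \<zeta>"
      have xy: "\<bar>x\<bar> \<le> 1" "\<bar>y\<bar> \<le> 1"
        using abs_Re_le_cmod [of \<zeta>] abs_Im_le_cmod [of \<zeta>] \<zeta> by (simp_all add: x_def y_def)
      define X where "X = (if x \<ge> 0 then 1 + ?D else 1 - ?D)"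
      define Y where "Y = (if y \<ge> 0 then 1 + \<i> *\<^sub>C ?D else 1 + (- \<i>) *\<^sub>C ?D)"
      have XY: "norm X \<le> 1 + \<beta>" "norm Y \<le> 1 + \<beta>"
        using up down side [of \<i>] side [of "- \<i>"] by (simp_all add: X_def Y_def)
      have "\<zeta> *\<^sub>C ?D = x *\<^sub>R ?D + y *\<^sub>R (\<i> *\<^sub>C ?D)"
      proof -
        have "\<zeta> = complex_of_real x + complex_of_real y * \<i>" by (simp add: complex_eq_iff x_def y_def)
        then show ?thesis by (metis scaleC_add_left scaleC_scaleC scaleR_scaleC)
      qed
      moreover have "\<bar>x\<bar> *\<^sub>R X = \<bar>x\<bar> *\<^sub>R 1 + x *\<^sub>R ?D" by (simp add: X_def scaleR_add_right scaleR_diff_right abs_if)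
      moreover have "\<bar>y\<bar> *\<^sub>R Y = \<bar>y\<bar> *\<^sub>R 1 + y *\<^sub>R (\<i> *\<^sub>C ?D)"
        by (simp add: Y_def scaleR_add_right scaleR_diff_right scaleC_minus_left abs_if)
      ultimately have "2 *\<^sub>R (1 + \<zeta> *\<^sub>C ((1 / 2) *\<^sub>R ?D)) = (2 - \<bar>x\<bar> - \<bar>y\<bar>) *\<^sub>R 1 + \<bar>x\<bar> *\<^sub>R X + \<bar>y\<bar> *\<^sub>R Y"
        by (simp add: scaleC_scaleR scaleR_add_right scaleR_diff_left)
      then have "2 * norm (1 + \<zeta> *\<^sub>C ((1 / 2) *\<^sub>R ?D)) = norm ((2 - \<bar>x\<bar> - \<bar>y\<bar>) *\<^sub>R 1 + \<bar>x\<bar> *\<^sub>R X + \<bar>y\<bar> *\<^sub>R Y)"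
        by (metis abs_numeral norm_scaleR)
      also have "\<dots> \<le> norm ((2 - \<bar>x\<bar> - \<bar>y\<bar>) *\<^sub>R (1::'a)) + norm (\<bar>x\<bar> *\<^sub>R X) + norm (\<bar>y\<bar> *\<^sub>R Y)"
        by (intro norm_triangle_le add_mono norm_triangle_ineq order_refl)
      also have "\<dots> \<le> (2 - \<bar>x\<bar> - \<bar>y\<bar>) * (1 + \<beta>) + \<bar>x\<bar> * (1 + \<beta>) + \<bar>y\<bar> * (1 + \<beta>)"
      proof (intro add_mono)
        have "(2 - \<bar>x\<bar> - \<bar>y\<bar>) * 1 \<le> (2 - \<bar>x\<bar> - \<bar>y\<bar>) * (1 + \<beta>)"
          using xy \<beta> by (intro mult_left_mono) auto
        then show "norm ((2 - \<bar>x\<bar> - \<bar>y\<bar>) *\<^sub>R (1::'a)) \<le> (2 - \<bar>x\<bar> - \<bar>y\<bar>) * (1 + \<beta>)" using xy by simp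
      qed (use XY in \<open>auto intro: mult_left_mono\<close>)
      also have "\<dots> = 2 * (1 + \<beta>)" by (simp add: algebra_simps)
      finally show "norm (1 + \<zeta> *\<^sub>C ((1 / 2) *\<^sub>R ?D)) \<le> 1 + \<beta>" by simp
    qed (use \<beta> True in auto)
    then have "\<epsilon> * norm (defect k) \<le> \<epsilon> * (36 * C * \<epsilon>)" using \<epsilon> by (simp add: \<beta>_def power2_eq_square)
    then show ?thesis using \<epsilon> by (simp add: C_def)
  qed
qed

end

text \<open>The sums over the powers of \<open>u\<close> and of \<open>star u\<close> telescope when they are multiplied by \<open>1 - u\<close>.\<close>

lemma norm_one_minus_unitary_times_mean:
  fixes u :: "'a::unital_cstar_algebra"
  assumes u: "u \<in> unitaries" and n: "n > 0"
  shows "norm ((1 - u) * ((1 / real n) *\<^sub>R (\<Sum>k<n. re_part (u ^ k)))) \<le> 2 / real n"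
proof -
  have uu: "u * star u = 1" using u by (simp add: unitaries_def)
  have tel: "(1 - v) * (\<Sum>k<n. v ^ k) = 1 - v ^ n" for v :: 'a
    by (induction n) (simp_all add: distrib_left left_diff_distrib)
  have two: "norm (1 - v ^ n) \<le> 2" if "v \<in> unitaries" for v :: 'a
    using norm_triangle_ineq4 [of 1 "v ^ n"] norm_unitary [OF unitary_power [OF that]] by simp
  have "(1 - u) = - u * (1 - star u)" by (simp add: uu algebra_simps)
  then have "(1 - u) * (\<Sum>k<n. star u ^ k) = - u * (1 - star u ^ n)" by (metis mult.assoc tel)
  then have "norm ((1 - u) * (\<Sum>k<n. star u ^ k)) \<le> norm u * norm (1 - star u ^ n)"
    by (metis norm_minus_cancel norm_mult_ineq)
  then have 1: "norm ((1 - u) * (\<Sum>k<n. star u ^ k)) \<le> 2"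
    using two [OF unitary_star [OF u]] norm_unitary [OF u] by simp
  have 2: "norm ((1 - u) * (\<Sum>k<n. u ^ k)) \<le> 2" unfolding tel by (rule two [OF u])
  have "(1 - u) * ((1 / real n) *\<^sub>R (\<Sum>k<n. re_part (u ^ k)))
      = (1 / (2 * real n)) *\<^sub>R ((1 - u) * (\<Sum>k<n. u ^ k) + (1 - u) * (\<Sum>k<n. star u ^ k))"
    by (simp add: re_part_def star_power sum.distrib scaleR_sum_right [symmetric] distrib_left)
  also have "norm \<dots> \<le> (1 / (2 * real n)) * (2 + 2)"
  proof -
    have "norm ((1 - u) * (\<Sum>k<n. u ^ k) + (1 - u) * (\<Sum>k<n. star u ^ k)) \<le> 2 + 2"
      using norm_triangle_ineq [of "(1 - u) * (\<Sum>k<n. u ^ k)" "(1 - u) * (\<Sum>k<n. star u ^ k)"] 1 2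
      by linarith
    then have "(1 / (2 * real n)) * norm ((1 - u) * (\<Sum>k<n. u ^ k) + (1 - u) * (\<Sum>k<n. star u ^ k))
        \<le> (1 / (2 * real n)) * (2 + 2)"
      by (rule mult_left_mono) simp
    then show ?thesis unfolding norm_scaleR by simp
  qed
  finally show ?thesis by simp
qed

section \<open>Averages near the unit inside the tensor product\<close>

text \<open>The discs through \<open>q i\<close> with \<open>X = 1\<close> and with \<open>X = - u i\<close> have as the mean of their first coefficients
\<open>(1 - u i) (1 - (q i)\<^sup>2) / 2\<close>. As the mean of the \<open>q i\<close> is close to the unit, the sum perturbs the unit of the
tensor product only to second order.\<close>

lemma tensor_average_bound:
  fixes u :: "'i \<Rightarrow> 'a::unital_cstar_algebra" and Y :: "'i \<Rightarrow> 'b::unital_cstar_algebra"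
  assumes "\<And>i. i \<in> I \<Longrightarrow> 0 \<le> t i" "sum t I = 1" and u: "\<And>i. i \<in> I \<Longrightarrow> u i \<in> unitaries"
    and q: "\<And>i. i \<in> I \<Longrightarrow> star (q i) = q i" "\<And>i. i \<in> I \<Longrightarrow> norm (q i) < 1"
      "\<And>i. i \<in> I \<Longrightarrow> u i * q i = q i * u i"
    and Y: "\<And>i. i \<in> I \<Longrightarrow> norm (Y i) \<le> 1"
    and \<delta>: "norm (1 - (\<Sum>i\<in>I. t i *\<^sub>R q i)) \<le> \<delta>" "0 < \<delta>" "\<delta> \<le> 1 / 3"
  shows "norm (\<Sum>i\<in>I. t i *\<^sub>R (((1 - u i) * (1 - q i * q i)) \<otimes> Y i)) \<le> 54 * sqrt \<delta>"
proof -
  define Z where "Z = (\<Sum>i\<in>I. t i *\<^sub>R (((1 - u i) * (1 - q i * q i)) \<otimes> Y i))"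
  \<comment> \<open>This choice balances the quadratic error \<open>2 s\<^sup>2\<close> of the discs against the deviation \<open>\<delta>\<close>.\<close>
  define s where "s = sqrt \<delta>"
  have s: "s > 0" "s\<^sup>2 = \<delta>" using \<delta> by (simp_all add: s_def)
  have "norm ((s / 2) *\<^sub>R Z) \<le> 9 * (3 * \<delta>)"
  proof (rule small_if_perturbs_one_little)
    fix \<zeta> :: complex assume \<zeta>: "cmod \<zeta> = 1"
    define W where "W = (\<lambda>i. q i \<otimes> 1 + (s / 2) *\<^sub>R (((1 - u i) * (1 - q i * q i)) \<otimes> (\<zeta> *\<^sub>C Y i)))"
    have W: "norm (W i) \<le> 1 + 2 * s\<^sup>2" if i: "i \<in> I" for i
    proof -
      have b: "norm (\<zeta> *\<^sub>C Y i) \<le> 1" using Y [OF i] \<zeta> by (simp add: norm_scaleC)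
      define V where "V = (\<lambda>X. q i \<otimes> 1 + s *\<^sub>R ((X * (1 - q i * q i)) \<otimes> (\<zeta> *\<^sub>C Y i)))"
      have "norm (V X) \<le> 1 + 2 * s\<^sup>2" if "X \<in> unitaries" "X * q i = q i * X" for X
        unfolding V_def using q i that b s by (intro disc_tensor_bound) auto
      then have V: "norm (V 1) \<le> 1 + 2 * s\<^sup>2" "norm (V (- u i)) \<le> 1 + 2 * s\<^sup>2"
        using q(3) [OF i] u [OF i] by (simp_all add: unitary_one unitary_minus)
      have "2 *\<^sub>R W i = V 1 + V (- u i)"
        by (simp add: W_def V_def scaleR_2 scaleR_add_right tensor_diff_left tensor_minus_left
            left_diff_distrib scaleR_diff_right)
      then have "2 * norm (W i) = norm (V 1 + V (- u i))" by (metis abs_numeral norm_scaleR)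
      then show ?thesis using norm_triangle_ineq [of "V 1" "V (- u i)"] V by linarith
    qed
    have eq: "1 + \<zeta> *\<^sub>C ((s / 2) *\<^sub>R Z) = (1 - (\<Sum>i\<in>I. t i *\<^sub>R q i)) \<otimes> 1 + (\<Sum>i\<in>I. t i *\<^sub>R W i)"
    proof -
      have "(\<Sum>i\<in>I. t i *\<^sub>R W i) = (\<Sum>i\<in>I. t i *\<^sub>R q i) \<otimes> 1 + \<zeta> *\<^sub>C ((s / 2) *\<^sub>R Z)"
        by (simp add: W_def Z_def scaleR_add_right sum.distrib tensor_sum_left tensor_scaleR_left
            scaleR_sum_right scaleC_sum_right tensor_scaleC_right scaleC_scaleR mult.commute)
      then show ?thesis by (simp add: one_proj_tensor_product_def tensor_diff_left)
    qed
    have "norm (1 + \<zeta> *\<^sub>C ((s / 2) *\<^sub>R Z))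
        \<le> norm ((1 - (\<Sum>i\<in>I. t i *\<^sub>R q i)) \<otimes> (1::'b)) + norm (\<Sum>i\<in>I. t i *\<^sub>R W i)"
      unfolding eq by (rule norm_triangle_ineq)
    also have "\<dots> \<le> \<delta> + (1 + 2 * s\<^sup>2)"
      using \<delta>(1) by (intro add_mono norm_weighted_sum_le [OF assms(1,2) W]) (auto simp: norm_tensor_one)
    finally show "norm (1 + \<zeta> *\<^sub>C ((s / 2) *\<^sub>R Z)) \<le> 1 + 3 * \<delta>" by (simp add: s)
  qed (use \<delta> in auto)
  then have "s * norm Z \<le> 54 * \<delta>" using s by simp
  also have "54 * \<delta> = s * (54 * s)" using s by (simp add: power2_eq_square)
  finally have "s * norm Z \<le> s * (54 * s)" .
  then have "norm Z \<le> 54 * s" using s(1) by (simp only: mult_le_cancel_left_pos)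
  then show ?thesis by (simp add: Z_def s_def)
qed

text \<open>The main estimate: if a mean of unitaries \<open>u i\<close> is close to the unit, then inside the tensor
product each \<open>u i\<close> may be replaced by the unit, whatever contractions \<open>Y i\<close> it is paired with.
The individual norms of \<open>1 - u i\<close> need not be small, so this is a statement of the kind
usually derived from a Grothendieck inequality. Here, the auxiliary contraction \<open>q i\<close>, essentially the mean of the real parts
of the first \<open>n\<close> powers of \<open>u i\<close>, separates two regimes: where \<open>u i\<close> is far from the unit,
\<open>q i\<close> is small, and \<open>(1 - u i) (q i)\<^sup>2\<close> is small in norm; and \<open>1 - q i\<close> is small on average,
so that the rest is handled by the discs through \<open>q i\<close>.\<close>

lemma small_defect_imp_small_tensor_sum:
  assumes \<eta>: "0 < \<eta>"
  obtains \<epsilon> where "0 < \<epsilon>" "\<epsilon> \<le> \<eta>"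
    "\<And>(I :: 'i set) t (u :: 'i \<Rightarrow> 'a::unital_cstar_algebra) (Y :: 'i \<Rightarrow> 'b::unital_cstar_algebra).
      unitary_average I t u \<Longrightarrow> norm (1 - (\<Sum>i\<in>I. t i *\<^sub>R u i)) \<le> \<epsilon> \<Longrightarrow>
      (\<And>i. i \<in> I \<Longrightarrow> norm (Y i) \<le> 1) \<Longrightarrow>
      norm (\<Sum>i\<in>I. t i *\<^sub>R ((1 - u i) \<otimes> Y i)) \<le> \<eta>"
proof -
  obtain n where n: "real n > 4 / \<eta>" using reals_Archimedean2 by blast
  then have n0: "n > 0" using \<eta> by (cases n) (auto simp: divide_less_0_iff not_less)
  have n2: "2 / real n \<le> \<eta> / 2" using n n0 \<eta> by (simp add: field_simps)
  define C :: real where "C = 36 * (400 * 13 ^ n)"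
  have C: "C \<ge> 0" by (simp add: C_def)
  \<comment> \<open>Both contributions to the sum are to be at most \<open>\<eta> / 2\<close>: \<open>2 / n\<close> and \<open>54 * sqrt \<delta>\<close>.\<close>
  define \<delta> where "\<delta> = min (1 / 3) (min \<eta> ((\<eta> / 108)\<^sup>2))"
  have \<delta>: "0 < \<delta>" "\<delta> \<le> 1 / 3" "\<delta> \<le> \<eta>" "sqrt \<delta> \<le> \<eta> / 108"
  proof -
    show "sqrt \<delta> \<le> \<eta> / 108" using \<eta> by (intro real_le_lsqrt) (auto simp: \<delta>_def)
  qed (use \<eta> in \<open>auto simp: \<delta>_def\<close>)
  define \<epsilon> where "\<epsilon> = \<delta> / (1 + C)"
  have "\<epsilon> * (1 + C) = \<delta>" using C by (simp add: \<epsilon>_def)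
  then have "\<epsilon> + C * \<epsilon> = \<delta>" by (simp add: algebra_simps)
  moreover have "0 < \<epsilon>" using \<delta> C by (simp add: \<epsilon>_def)
  ultimately have \<epsilon>: "0 < \<epsilon>" "\<epsilon> + C * \<epsilon> = \<delta>" by blast+
  have \<epsilon>1: "\<epsilon> \<le> \<delta>" using \<epsilon> C mult_nonneg_nonneg [of C \<epsilon>] by linarith
  show thesis
  proof (rule that [of \<epsilon>])
    show "0 < \<epsilon>" "\<epsilon> \<le> \<eta>" using \<epsilon> \<epsilon>1 \<delta> by auto
    fix I :: "'i set" and t and u :: "'i \<Rightarrow> 'a" and Y :: "'i \<Rightarrow> 'b"
    assume ua: "unitary_average I t u" and close: "norm (1 - (\<Sum>i\<in>I. t i *\<^sub>R u i)) \<le> \<epsilon>"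
      and Y: "\<And>i. i \<in> I \<Longrightarrow> norm (Y i) \<le> 1"
    interpret unitary_average I t u by (rule ua)
    define D where "D = (\<lambda>i. (1 / real n) *\<^sub>R (\<Sum>k<n. re_part (u i ^ k)))"
    \<comment> \<open>The factor \<open>1 - \<epsilon>\<close> makes \<open>q i\<close> a strict contraction, as the dilation requires.\<close>
    define q where "q = (\<lambda>i. (1 - \<epsilon>) *\<^sub>R D i)"
    have nD: "norm (D i) \<le> 1" if "i \<in> I" for i
    proof -
      have "norm (\<Sum>k<n. re_part (u i ^ k)) \<le> (\<Sum>k<n. 1)"
        using norm_re_part_power [OF that] by (intro sum_norm_le) auto
      then show ?thesis using n0 by (simp add: D_def)
    qed
    have e01: "0 \<le> 1 - \<epsilon>" "1 - \<epsilon> < 1" using \<epsilon> \<epsilon>1 \<delta> by auto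
    have nq: "norm (q i) \<le> norm (D i)" "norm (q i) < 1" if "i \<in> I" for i
    proof -
      have "(1 - \<epsilon>) * norm (D i) \<le> 1 * norm (D i)" using e01 by (intro mult_right_mono) auto
      then show "norm (q i) \<le> norm (D i)" using e01 by (simp add: q_def)
      have "(1 - \<epsilon>) * norm (D i) \<le> (1 - \<epsilon>) * 1" using e01 nD [OF that] by (intro mult_left_mono) auto
      then show "norm (q i) < 1" using e01 by (simp add: q_def)
    qed
    have sq: "star (q i) = q i" for i
      by (simp add: q_def D_def star_scaleR star_sum star_re_part)
    have comm: "u i * q i = q i * u i" if i: "i \<in> I" for i
    proof -
      have "u i * star (u i) = star (u i) * u i" using unitary [OF i] by (simp add: unitaries_def)
      then have "star (u i) ^ k * u i = u i * star (u i) ^ k" for k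
        by (simp add: power_commuting_commutes)
      then have "u i * re_part (u i ^ k) = re_part (u i ^ k) * u i" for k
        by (simp add: re_part_def star_power distrib_left distrib_right power_commutes)
      then show ?thesis by (simp add: q_def D_def sum_distrib_left sum_distrib_right)
    qed
    have xq: "norm ((1 - u i) * q i) \<le> 2 / real n" if i: "i \<in> I" for i
    proof -
      have "norm ((1 - u i) * q i) = (1 - \<epsilon>) * norm ((1 - u i) * D i)" using e01 by (simp add: q_def)
      also have "\<dots> \<le> 1 * norm ((1 - u i) * D i)" using e01 by (intro mult_right_mono) auto
      also have "\<dots> \<le> 2 / real n"
        unfolding D_def using norm_one_minus_unitary_times_mean [OF unitary [OF i] n0] by simp
      finally show ?thesis .
    qed
    have mean: "norm (1 - (\<Sum>i\<in>I. t i *\<^sub>R q i)) \<le> \<delta>"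
    proof -
      have "(\<Sum>i\<in>I. t i *\<^sub>R D i) = (1 / real n) *\<^sub>R (\<Sum>k<n. \<Sum>i\<in>I. t i *\<^sub>R re_part (u i ^ k))"
        unfolding D_def scaleR_sum_right by (subst sum.swap) (simp add: mult.commute)
      also have "\<dots> = (1 / real n) *\<^sub>R (\<Sum>k<n. 1 - defect k)" by (simp add: defect_eq)
      also have "\<dots> = 1 - (1 / real n) *\<^sub>R (\<Sum>k<n. defect k)"
        unfolding sum_subtractf sum_constant_scaleR scaleR_diff_right using n0 by simp
      finally have D: "(\<Sum>i\<in>I. t i *\<^sub>R D i) = 1 - (1 / real n) *\<^sub>R (\<Sum>k<n. defect k)" .
      have "(\<Sum>i\<in>I. t i *\<^sub>R q i) = (1 - \<epsilon>) *\<^sub>R (\<Sum>i\<in>I. t i *\<^sub>R D i)"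
        by (simp only: q_def scaleR_sum_right scaleR_scaleR mult.commute)
      moreover have "1 - (1 - \<epsilon>) *\<^sub>R (1 - X) = \<epsilon> *\<^sub>R 1 + (1 - \<epsilon>) *\<^sub>R X" for X :: 'a
        by (simp add: scaleR_diff_left scaleR_diff_right)
      ultimately have "1 - (\<Sum>i\<in>I. t i *\<^sub>R q i) = \<epsilon> *\<^sub>R 1 + (1 - \<epsilon>) *\<^sub>R ((1 / real n) *\<^sub>R (\<Sum>k<n. defect k))"
        by (simp only: D)
      then have "norm (1 - (\<Sum>i\<in>I. t i *\<^sub>R q i))
          \<le> norm (\<epsilon> *\<^sub>R (1::'a)) + norm ((1 - \<epsilon>) *\<^sub>R ((1 / real n) *\<^sub>R (\<Sum>k<n. defect k)))"
        by (metis norm_triangle_ineq)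
      also have "\<dots> = \<epsilon> + (1 - \<epsilon>) * (norm (\<Sum>k<n. defect k) / real n)" using \<epsilon> e01 by simp
      also have "\<dots> \<le> \<epsilon> + 1 * (C * \<epsilon>)"
      proof -
        have "norm (\<Sum>k<n. defect k) \<le> (\<Sum>k<n. C * \<epsilon>)"
        proof (rule sum_norm_le)
          fix k assume k: "k \<in> {..<n}"
          have "norm (defect k) \<le> 36 * (400 * 13 ^ k) * \<epsilon>"
            by (rule norm_defect_le [OF close]) (use \<epsilon> \<epsilon>1 \<delta> in auto)
          also have "\<dots> \<le> C * \<epsilon>"
            unfolding C_def using k \<epsilon> by (intro mult_right_mono mult_left_mono power_increasing) auto
          finally show "norm (defect k) \<le> C * \<epsilon>" .
        qed
        then have "norm (\<Sum>k<n. defect k) / real n \<le> C * \<epsilon>" using n0 by (simp add: field_simps)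
        then show ?thesis using e01 by (intro add_left_mono mult_mono) auto
      qed
      finally show ?thesis using \<epsilon>(2) by simp
    qed
    have split: "(\<Sum>i\<in>I. t i *\<^sub>R ((1 - u i) \<otimes> Y i))
        = (\<Sum>i\<in>I. t i *\<^sub>R (((1 - u i) * (1 - q i * q i)) \<otimes> Y i))
        + (\<Sum>i\<in>I. t i *\<^sub>R (((1 - u i) * (q i * q i)) \<otimes> Y i))"
    proof -
      have "(1 - u i) \<otimes> Y i = ((1 - u i) * (1 - q i * q i)) \<otimes> Y i + ((1 - u i) * (q i * q i)) \<otimes> Y i" for i
        by (simp flip: tensor_add_left distrib_left)
      then show ?thesis by (simp add: scaleR_add_right flip: sum.distrib)
    qed
    have "norm (\<Sum>i\<in>I. t i *\<^sub>R (((1 - u i) * (1 - q i * q i)) \<otimes> Y i)) \<le> 54 * sqrt \<delta>"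
      by (rule tensor_average_bound [OF weight_nonneg weight_sum unitary sq nq(2) comm Y mean \<delta>(1,2)])
    moreover have "norm (\<Sum>i\<in>I. t i *\<^sub>R (((1 - u i) * (q i * q i)) \<otimes> Y i)) \<le> 2 / real n"
    proof (rule norm_weighted_sum_le [OF weight_nonneg weight_sum])
      fix i assume i: "i \<in> I"
      have "norm (((1 - u i) * (q i * q i)) \<otimes> Y i) \<le> norm ((1 - u i) * q i * q i) * norm (Y i)"
        using norm_tensor_le [of "(1 - u i) * (q i * q i)" "Y i"] by (simp add: mult.assoc)
      also have "\<dots> \<le> norm ((1 - u i) * q i) * norm (q i) * norm (Y i)"
        by (intro mult_right_mono norm_mult_ineq) auto
      also have "\<dots> \<le> (2 / real n) * 1 * 1"
        using xq [OF i] nq(2) [OF i] Y [OF i] by (intro mult_mono) auto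
      finally show "norm (((1 - u i) * (q i * q i)) \<otimes> Y i) \<le> 2 / real n" by simp
    qed
    ultimately show "norm (\<Sum>i\<in>I. t i *\<^sub>R ((1 - u i) \<otimes> Y i)) \<le> \<eta>"
      unfolding split using n2 \<delta>(4) by (intro norm_triangle_le) linarith
  qed
qed

section \<open>Norm-one unitaries\<close>

lemma norm_additive_diff:
  assumes "Modules.additive T" "\<And>u. norm (T u) \<le> norm u"
  shows "norm (T u - T v) \<le> norm (u - v)"
  using assms by (metis additive.diff)

lemma tendsto_additive:
  fixes T :: "'a::real_normed_vector \<Rightarrow> 'b::real_normed_vector"
  assumes "Modules.additive T" "\<And>u. norm (T u) \<le> norm u" and f: "f \<longlonglongrightarrow> l"
  shows "(\<lambda>n. T (f n)) \<longlonglongrightarrow> T l"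
proof -
  have "(\<lambda>n. norm (f n - l)) \<longlonglongrightarrow> 0" using f by (simp add: tendsto_norm_zero LIM_zero)
  then have "(\<lambda>n. T (f n) - T l) \<longlonglongrightarrow> 0"
    by (rule Lim_null_comparison [rotated]) (simp add: norm_additive_diff assms)
  then show ?thesis by (rule LIM_zero_cancel)
qed

lemma bounded_bilinear_tensor: "bounded_bilinear (\<otimes>)"
proof
  show "\<exists>K. \<forall>a b. norm (a \<otimes> b) \<le> norm a * norm b * K"
    by (rule exI [of _ 1]) (simp add: norm_tensor_le)
qed (simp_all add: tensor_add_left tensor_add_right tensor_scaleR_left tensor_scaleR_right)

text \<open>Slicing by a state \<open>f\<close> turns the tensors into \<open>f (Q i) P i\<close>. Since the mean of these is close to
the unit and \<open>cmod (f (Q i)) \<le> 1\<close>, the moduli are close to 1 on average, and passing to the phases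
costs at most another \<open>\<epsilon>\<close>.\<close>

lemma state_slice_phases:
  fixes P :: "'i \<Rightarrow> 'a::unital_cstar_algebra" and Q :: "'i \<Rightarrow> 'b::unital_cstar_algebra"
  assumes t: "\<And>i. i \<in> I \<Longrightarrow> 0 \<le> t i" "sum t I = 1"
    and P: "\<And>i. i \<in> I \<Longrightarrow> norm (P i) \<le> 1" and Q: "\<And>i. i \<in> I \<Longrightarrow> norm (Q i) \<le> 1"
    and close: "norm (1 - (\<Sum>i\<in>I. t i *\<^sub>R (P i \<otimes> Q i))) \<le> \<epsilon>"
  obtains \<sigma> where "\<And>i. cmod (\<sigma> i) = 1" "norm (1 - (\<Sum>i\<in>I. t i *\<^sub>R (\<sigma> i *\<^sub>C P i))) \<le> 2 * \<epsilon>"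
proof -
  obtain f :: "'b \<Rightarrow> complex" where f: "state f" using state_exists by blast
  obtain T :: "('a, 'b) proj_tensor_product \<Rightarrow> 'a" where T: "Modules.additive T"
    "\<And>x y. T (x \<otimes> y) = f y *\<^sub>C x" "\<And>u. norm (T u) \<le> norm u"
    using right_slice [OF f] by blast
  interpret T: Modules.additive T by (rule T(1))
  define \<mu> where "\<mu> = (\<lambda>i. f (Q i))"
  define \<sigma> where "\<sigma> = (\<lambda>i. if \<mu> i = 0 then 1 else \<mu> i / cmod (\<mu> i))"
  have \<mu>: "cmod (\<mu> i) \<le> 1" if "i \<in> I" for i
    unfolding \<mu>_def using state_norm [OF f] Q [OF that] order_trans by blast
  have \<sigma>: "cmod (\<sigma> i) = 1" for i by (simp add: \<sigma>_def norm_divide)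
  have \<mu>\<sigma>: "cmod (\<mu> i - \<sigma> i) = 1 - cmod (\<mu> i)" if "i \<in> I" for i
  proof (cases "\<mu> i = 0")
    case False
    then have "\<mu> i - \<sigma> i = (cmod (\<mu> i) - 1) * \<sigma> i" by (simp add: \<sigma>_def field_simps)
    then have "cmod (\<mu> i - \<sigma> i) = \<bar>cmod (\<mu> i) - 1\<bar>"
      using \<sigma> by (simp only: norm_mult) (metis mult.right_neutral norm_of_real of_real_1 of_real_diff)
    then show ?thesis using \<mu> [OF that] by simp
  qed (simp add: \<sigma>_def)
  have "T (\<Sum>i\<in>I. t i *\<^sub>R (P i \<otimes> Q i)) = (\<Sum>i\<in>I. t i *\<^sub>R (\<mu> i *\<^sub>C P i))"
    unfolding T.sum
    by (intro sum.cong) (simp_all add: T(2) \<mu>_def scaleC_scaleR flip: tensor_scaleR_left)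
  moreover have "T 1 = 1" by (simp add: one_proj_tensor_product_def T(2) state_one [OF f] scaleC_one)
  ultimately have c1: "norm (1 - (\<Sum>i\<in>I. t i *\<^sub>R (\<mu> i *\<^sub>C P i))) \<le> \<epsilon>"
    using T(3) [of "1 - (\<Sum>i\<in>I. t i *\<^sub>R (P i \<otimes> Q i))"] close by (simp add: T.diff)
  have "norm (\<Sum>i\<in>I. t i *\<^sub>R (\<mu> i *\<^sub>C P i)) \<le> (\<Sum>i\<in>I. t i * cmod (\<mu> i))"
  proof (rule sum_norm_le)
    fix i assume i: "i \<in> I"
    have "norm (\<mu> i *\<^sub>C P i) \<le> cmod (\<mu> i) * 1"
      unfolding norm_scaleC using P [OF i] by (intro mult_left_mono) auto
    then show "norm (t i *\<^sub>R (\<mu> i *\<^sub>C P i)) \<le> t i * cmod (\<mu> i)"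
      using t(1) [OF i] by (simp add: mult_left_mono)
  qed
  moreover have "1 - norm (\<Sum>i\<in>I. t i *\<^sub>R (\<mu> i *\<^sub>C P i)) \<le> \<epsilon>"
    using norm_triangle_ineq2 [of 1 "\<Sum>i\<in>I. t i *\<^sub>R (\<mu> i *\<^sub>C P i)"] c1 by simp
  ultimately have c2: "1 - (\<Sum>i\<in>I. t i * cmod (\<mu> i)) \<le> \<epsilon>" by linarith
  have "norm (\<Sum>i\<in>I. t i *\<^sub>R ((\<mu> i - \<sigma> i) *\<^sub>C P i)) \<le> (\<Sum>i\<in>I. t i * (1 - cmod (\<mu> i)))"
  proof (rule sum_norm_le)
    fix i assume i: "i \<in> I"
    have "norm ((\<mu> i - \<sigma> i) *\<^sub>C P i) \<le> (1 - cmod (\<mu> i)) * 1"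
      unfolding norm_scaleC \<mu>\<sigma> [OF i] using P [OF i] \<mu> [OF i] by (intro mult_left_mono) auto
    then show "norm (t i *\<^sub>R ((\<mu> i - \<sigma> i) *\<^sub>C P i)) \<le> t i * (1 - cmod (\<mu> i))"
      using t(1) [OF i] by (simp add: mult_left_mono)
  qed
  also have "\<dots> \<le> \<epsilon>" using c2 t(2) by (simp add: right_diff_distrib sum_subtractf)
  finally have c3: "norm (\<Sum>i\<in>I. t i *\<^sub>R ((\<mu> i - \<sigma> i) *\<^sub>C P i)) \<le> \<epsilon>" .
  have "(\<mu> i - \<sigma> i) *\<^sub>C P i = \<mu> i *\<^sub>C P i - \<sigma> i *\<^sub>C P i" for i
    using scaleC_add_left [of "\<mu> i - \<sigma> i" "\<sigma> i" "P i"] by simp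
  then have eq: "1 - (\<Sum>i\<in>I. t i *\<^sub>R (\<sigma> i *\<^sub>C P i))
      = (1 - (\<Sum>i\<in>I. t i *\<^sub>R (\<mu> i *\<^sub>C P i))) + (\<Sum>i\<in>I. t i *\<^sub>R ((\<mu> i - \<sigma> i) *\<^sub>C P i))"
    by (simp add: scaleR_diff_right sum_subtractf)
  have "norm (1 - (\<Sum>i\<in>I. t i *\<^sub>R (\<sigma> i *\<^sub>C P i))) \<le> 2 * \<epsilon>"
    unfolding eq using norm_triangle_ineq [of "1 - (\<Sum>i\<in>I. t i *\<^sub>R (\<mu> i *\<^sub>C P i))"
        "\<Sum>i\<in>I. t i *\<^sub>R ((\<mu> i - \<sigma> i) *\<^sub>C P i)"] c1 c3 by linarith
  with \<sigma> show thesis by (rule that)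
qed

lemma sum_pairs: "(\<Sum>i\<in>S. \<Sum>j\<in>S. g i j) = (\<Sum>p\<in>S \<times> S. g (fst p) (snd p))"
  by (simp add: sum.cartesian_product case_prod_beta)

text \<open>Approximate \<open>w\<close> by a mean \<open>w'\<close> of tensors \<open>U i \<otimes> V i\<close> of unitaries. The equations
\<open>w * star w = 1\<close> and \<open>star w * w = 1\<close>, sliced by a state, give phases \<open>\<sigma>\<close> and \<open>\<tau>\<close> for which the
unitaries \<open>\<sigma> (i, j) U i star (U j)\<close> and \<open>\<tau> (i, j) star (U i) U j\<close> have means close to the unit, so that
the main estimate applies to both families. For \<open>a\<close> a combination of the \<open>U i\<close>, the first family shows that
\<open>w (star a \<otimes> 1)\<close> is close to some \<open>1 \<otimes> b\<close>, and the second that \<open>star a * a\<close> is close to a scalar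
\<open>c\<close>. Hence \<open>c w\<close> is close to \<open>a \<otimes> b\<close>, and it remains to choose \<open>a\<close> with \<open>c\<close> away from zero. This is possible for one
of the combinations \<open>a k = \<Sum>i. t i \<sigma> (i, k) U i\<close>, because the elements \<open>a k star (U k)\<close> have
a mean close to the unit.\<close>

lemma norm_one_unitary_near_elementary_tensor:
  fixes w :: "('a::unital_cstar_algebra, 'b::unital_cstar_algebra) proj_tensor_product"
  assumes w: "w \<in> norm_one_unitaries" and e: "0 < e"
  shows "\<exists>a b. norm (w - a \<otimes> b) \<le> e"
proof -
  have w1: "star w * w = 1" "w * star w = 1" "norm w = 1" using w by (auto simp: norm_one_unitaries_def)
  define \<eta> where "\<eta> = min (e / 8) (1 / 64)"
  have \<eta>: "0 < \<eta>" "8 * \<eta> \<le> e" "64 * \<eta> \<le> 1" using e by (auto simp: \<eta>_def)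
  obtain \<epsilon> where \<epsilon>: "0 < \<epsilon>" "\<epsilon> \<le> \<eta>" and key: "\<And>(I :: (('a, 'b) proj_tensor_product \<times> ('a, 'b) proj_tensor_product) set) t u Y.
      unitary_average I t u \<Longrightarrow> norm (1 - (\<Sum>i\<in>I. t i *\<^sub>R u i)) \<le> \<epsilon> \<Longrightarrow>
      (\<And>i. i \<in> I \<Longrightarrow> norm (Y i) \<le> 1) \<Longrightarrow>
      norm (\<Sum>i\<in>I. t i *\<^sub>R ((1 - u i :: 'a) \<otimes> (Y i :: 'b))) \<le> \<eta>"
    using small_defect_imp_small_tensor_sum [OF \<eta>(1)] by blast
  \<comment> \<open>Multiplying \<open>w'\<close> by its adjoint doubles the error \<open>d\<close>, and so does the passage to phases.\<close>
  define d where "d = \<epsilon> / 4"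
  have d: "0 < d" "4 * d = \<epsilon>" using \<epsilon> by (auto simp: d_def)
  obtain w' where w': "w' \<in> convex hull unitary_tensors" "norm (w - w') \<le> d"
    using proj_unit_ball_subset_hull [of w] w1(3) d(1)
    by (auto simp: closure_approachable dist_norm norm_minus_commute intro: less_imp_le)
  obtain S t where S: "finite S" "S \<subseteq> unitary_tensors" "\<And>x. x \<in> S \<Longrightarrow> 0 \<le> t x" "sum t S = 1"
    and w'eq: "w' = (\<Sum>x\<in>S. t x *\<^sub>R x)"
    using w'(1) unfolding convex_hull_explicit by blast
  have "\<exists>u v. u \<in> unitaries \<and> v \<in> unitaries \<and> x = u \<otimes> v" if "x \<in> S" for x
    using that S(2) unfolding unitary_tensors_def by blast
  then obtain U V where U: "\<And>x. x \<in> S \<Longrightarrow> U x \<in> unitaries" and V: "\<And>x. x \<in> S \<Longrightarrow> V x \<in> unitaries"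
    and UV: "\<And>x. x \<in> S \<Longrightarrow> x = U x \<otimes> V x"
    by metis
  have w'sum: "w' = (\<Sum>x\<in>S. t x *\<^sub>R (U x \<otimes> V x))" unfolding w'eq using UV by (intro sum.cong) auto
  have UU: "U x * star (U x) = 1" "star (U x) * U x = 1" if "x \<in> S" for x
    using U [OF that] by (auto simp: unitaries_def)
  have nU: "norm (U x) = 1" "norm (V x) = 1" if "x \<in> S" for x
    using U V that norm_unitary by blast+
  have nw': "norm w' \<le> 1"
    unfolding w'sum
  proof (rule norm_weighted_sum_le [OF S(3,4)])
    show "norm (U x \<otimes> V x) \<le> 1" if "x \<in> S" for x
      using norm_tensor_le [of "U x" "V x"] nU [OF that] by simp
  qed
  define I where "I = S \<times> S"
  define tt where "tt = (\<lambda>p. t (fst p) * t (snd p))"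
  have tt: "\<And>p. p \<in> I \<Longrightarrow> 0 \<le> tt p" "sum tt I = 1"
  proof -
    show "0 \<le> tt p" if "p \<in> I" for p using that S(3) by (auto simp: I_def tt_def)
    have "sum tt I = sum t S * sum t S"
      unfolding I_def tt_def sum_product by (simp only: sum_pairs)
    then show "sum tt I = 1" by (simp add: S(4))
  qed
  have inI: "fst p \<in> S" "snd p \<in> S" if "p \<in> I" for p using that by (auto simp: I_def)
  have sw': "star w' = (\<Sum>x\<in>S. t x *\<^sub>R (star (U x) \<otimes> star (V x)))"
    by (simp add: w'sum star_sum star_scaleR star_tensor)
  have prod: "norm (1 - x * y) \<le> 2 * d" if "x' * y' = 1" "norm (x' - x) \<le> d" "norm (y' - y) \<le> d"
    "norm y' \<le> 1" "norm x \<le> 1" for x y x' y' :: "('a, 'b) proj_tensor_product"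
  proof -
    have "1 - x * y = (x' - x) * y' + x * (y' - y)" using that(1) by (simp add: algebra_simps)
    then have "norm (1 - x * y) \<le> norm (x' - x) * norm y' + norm x * norm (y' - y)"
      by (metis norm_triangle_le add_mono norm_mult_ineq)
    also have "\<dots> \<le> d * 1 + 1 * d" using that d by (intro add_mono mult_mono) auto
    finally show ?thesis by simp
  qed
  have ns: "norm (star w - star w') \<le> d" "norm (star w') \<le> 1" "norm (star w) \<le> 1"
    using w'(2) nw' w1(3) by (simp_all add: norm_star flip: star_diff)
  define P1 where "P1 = (\<lambda>p. U (fst p) * star (U (snd p)))"
  define P2 where "P2 = (\<lambda>p. star (U (fst p)) * U (snd p))"
  have P: "P1 p \<in> unitaries" "P2 p \<in> unitaries" if "p \<in> I" for p
    using inI [OF that] U by (auto simp: P1_def P2_def intro!: unitary_mult unitary_star)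
  have Q: "norm (V (fst p) * star (V (snd p))) = 1" "norm (star (V (fst p)) * V (snd p)) = 1" if "p \<in> I" for p
    using inI [OF that] V by (auto intro!: norm_unitary unitary_mult unitary_star)
  have c1: "norm (1 - (\<Sum>p\<in>I. tt p *\<^sub>R (P1 p \<otimes> (V (fst p) * star (V (snd p)))))) \<le> 2 * d"
  proof -
    have "w' * star w' = (\<Sum>p\<in>I. tt p *\<^sub>R (P1 p \<otimes> (V (fst p) * star (V (snd p)))))"
      unfolding sw' by (subst w'sum) (simp add: sum_product sum_pairs tensor_mult I_def tt_def P1_def mult.commute [of "t (snd _)"])
    then show ?thesis using prod [OF w1(2) w'(2) ns(1) ns(3) nw'] by simp
  qed
  have c2: "norm (1 - (\<Sum>p\<in>I. tt p *\<^sub>R (P2 p \<otimes> (star (V (fst p)) * V (snd p))))) \<le> 2 * d"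
  proof -
    have "star w' * w' = (\<Sum>p\<in>I. tt p *\<^sub>R (P2 p \<otimes> (star (V (fst p)) * V (snd p))))"
      unfolding sw' by (subst w'sum) (simp add: sum_product sum_pairs tensor_mult I_def tt_def P2_def mult.commute [of "t (snd _)"])
    then show ?thesis using prod [OF w1(1) ns(1) w'(2) _ ns(2)] w1(3) by simp
  qed
  obtain \<sigma> where \<sigma>: "\<And>p. cmod (\<sigma> p) = 1" "norm (1 - (\<Sum>p\<in>I. tt p *\<^sub>R (\<sigma> p *\<^sub>C P1 p))) \<le> 2 * (2 * d)"
    by (rule state_slice_phases [OF tt _ _ c1]) (use P Q in \<open>auto simp: norm_unitary\<close>)
  obtain \<tau> where \<tau>: "\<And>p. cmod (\<tau> p) = 1" "norm (1 - (\<Sum>p\<in>I. tt p *\<^sub>R (\<tau> p *\<^sub>C P2 p))) \<le> 2 * (2 * d)"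
    by (rule state_slice_phases [OF tt _ _ c2]) (use P Q in \<open>auto simp: norm_unitary\<close>)
  have cc: "cnj (\<sigma> p) * \<sigma> p = 1" "cnj (\<tau> p) * \<tau> p = 1" for p
    using complex_norm_square [of "\<sigma> p"] complex_norm_square [of "\<tau> p"] \<sigma>(1) \<tau>(1) by (simp_all add: mult.commute)
  have K1: "norm ((\<Sum>p\<in>I. tt p *\<^sub>R (P1 p \<otimes> Y p)) - 1 \<otimes> (\<Sum>p\<in>I. tt p *\<^sub>R (cnj (\<sigma> p) *\<^sub>C Y p))) \<le> \<eta>"
    if Y: "\<And>p. p \<in> I \<Longrightarrow> norm (Y p) \<le> 1" for Y :: "_ \<Rightarrow> 'b"
  proof -
    have "norm (\<Sum>p\<in>I. tt p *\<^sub>R ((1 - \<sigma> p *\<^sub>C P1 p) \<otimes> (cnj (\<sigma> p) *\<^sub>C Y p))) \<le> \<eta>"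
      by (rule key) (use P \<sigma> tt Y d(2) in \<open>auto simp: unitary_average_def unitary_scaleC norm_scaleC\<close>)
    moreover have "(1 - \<sigma> p *\<^sub>C P1 p) \<otimes> (cnj (\<sigma> p) *\<^sub>C Y p) = 1 \<otimes> (cnj (\<sigma> p) *\<^sub>C Y p) - P1 p \<otimes> Y p" for p
      by (simp add: tensor_diff_left tensor_scaleC_left tensor_scaleC_right scaleC_scaleC scaleC_diff_right cc scaleC_one)
    ultimately have "norm (1 \<otimes> (\<Sum>p\<in>I. tt p *\<^sub>R (cnj (\<sigma> p) *\<^sub>C Y p)) - (\<Sum>p\<in>I. tt p *\<^sub>R (P1 p \<otimes> Y p))) \<le> \<eta>"
      by (simp add: scaleR_diff_right sum_subtractf tensor_sum_right tensor_scaleR_right)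
    then show ?thesis by (simp only: norm_minus_commute)
  qed
  have K2: "norm ((\<Sum>p\<in>I. tt p *\<^sub>R (y p *\<^sub>C P2 p)) - (\<Sum>p\<in>I. complex_of_real (tt p) * (cnj (\<tau> p) * y p)) *\<^sub>C 1) \<le> \<eta>"
    if y: "\<And>p. p \<in> I \<Longrightarrow> cmod (y p) \<le> 1" for y
  proof -
    have "norm (\<Sum>p\<in>I. tt p *\<^sub>R ((1 - \<tau> p *\<^sub>C P2 p) \<otimes> ((cnj (\<tau> p) * y p) *\<^sub>C (1 :: 'b)))) \<le> \<eta>"
      by (rule key) (use P \<tau> tt y d(2) in \<open>auto simp: unitary_average_def unitary_scaleC norm_scaleC norm_mult\<close>)
    moreover have "(1 - \<tau> p *\<^sub>C P2 p) \<otimes> ((cnj (\<tau> p) * y p) *\<^sub>C (1 :: 'b)) = ((cnj (\<tau> p) * y p) *\<^sub>C 1 - y p *\<^sub>C P2 p) \<otimes> 1" for p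
    proof -
      have "(cnj (\<tau> p) * y p) * \<tau> p = y p" using cc(2) [of p] by (metis mult.assoc mult.commute mult_1)
      then have "(cnj (\<tau> p) * y p) *\<^sub>C \<tau> p *\<^sub>C X = y p *\<^sub>C X" for X :: "('a, 'b) proj_tensor_product"
        by (simp only: scaleC_scaleC)
      then show ?thesis
        by (simp add: tensor_diff_left tensor_scaleC_left tensor_scaleC_right scaleC_diff_right)
    qed
    ultimately have "norm ((\<Sum>p\<in>I. tt p *\<^sub>R ((cnj (\<tau> p) * y p) *\<^sub>C 1 - y p *\<^sub>C P2 p)) \<otimes> (1 :: 'b)) \<le> \<eta>"
      by (simp add: tensor_sum_left tensor_scaleR_left)
    then have "norm (\<Sum>p\<in>I. tt p *\<^sub>R ((cnj (\<tau> p) * y p) *\<^sub>C 1 - y p *\<^sub>C P2 p)) \<le> \<eta>"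
      by (simp add: norm_tensor_one)
    moreover have "(\<Sum>p\<in>I. complex_of_real (tt p) * (cnj (\<tau> p) * y p)) *\<^sub>C (1 :: 'a)
        = (\<Sum>p\<in>I. tt p *\<^sub>R ((cnj (\<tau> p) * y p) *\<^sub>C 1))"
      by (simp add: scaleC_sum_left scaleR_scaleC scaleC_scaleC)
    ultimately show ?thesis
      by (simp add: scaleR_diff_right sum_subtractf norm_minus_commute)
  qed
  define a where "a = (\<lambda>k. \<Sum>i\<in>S. t i *\<^sub>R (\<sigma> (i, k) *\<^sub>C U i))"
  define c where "c = (\<lambda>k. \<Sum>p\<in>I. complex_of_real (tt p) * (cnj (\<tau> p) * (cnj (\<sigma> (fst p, k)) * \<sigma> (snd p, k))))"
  have na: "norm (a k) \<le> 1" for k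
    unfolding a_def using nU by (intro norm_weighted_sum_le S) (auto simp: norm_scaleC \<sigma>)
  have sa: "star (a k) = (\<Sum>i\<in>S. t i *\<^sub>R (cnj (\<sigma> (i, k)) *\<^sub>C star (U i)))" for k
    by (simp add: a_def star_sum star_scaleR star_scaleC)
  have ac: "norm (star (a k) * a k - c k *\<^sub>C 1) \<le> \<eta>" for k
  proof -
    have "star (a k) * a k = (\<Sum>p\<in>I. tt p *\<^sub>R ((cnj (\<sigma> (fst p, k)) * \<sigma> (snd p, k)) *\<^sub>C P2 p))"
      unfolding sa unfolding a_def
      by (simp add: sum_product sum_pairs I_def tt_def P2_def scaleC_mult_simps scaleC_scaleR mult.commute)
    then show ?thesis using K2 [of "\<lambda>p. cnj (\<sigma> (fst p, k)) * \<sigma> (snd p, k)"]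
      by (simp add: c_def norm_mult \<sigma>)
  qed
  have "\<exists>k\<in>S. Re (c k) \<ge> 1 / 2"
  proof (rule ccontr)
    assume neg: "\<not> ?thesis"
    obtain f :: "'a \<Rightarrow> complex" where f: "state f" using state_exists by blast
    \<comment> \<open>Expanding the positive value of \<open>f\<close> at the symmetrised square of \<open>g k - 1\<close> gives, on average,
      about \<open>2\<close> as a lower bound for \<open>f (J (g k))\<close>. The summand \<open>g k * star (g k)\<close> contributes at most
      \<open>1\<close>, and the other one essentially \<open>c k\<close>.\<close>
    define g where "g = (\<lambda>k. a k * star (U k))"
    have gsum: "(\<Sum>k\<in>S. t k *\<^sub>R g k) = (\<Sum>p\<in>I. tt p *\<^sub>R (\<sigma> p *\<^sub>C P1 p))"
    proof -
      have "(\<Sum>k\<in>S. t k *\<^sub>R g k) = (\<Sum>k\<in>S. \<Sum>i\<in>S. (t i * t k) *\<^sub>R (\<sigma> (i, k) *\<^sub>C (U i * star (U k))))"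
        by (simp add: g_def a_def sum_distrib_right scaleR_sum_right scaleC_mult_simps scaleC_scaleR mult.commute)
      also have "\<dots> = (\<Sum>i\<in>S. \<Sum>k\<in>S. (t i * t k) *\<^sub>R (\<sigma> (i, k) *\<^sub>C (U i * star (U k))))"
        by (rule sum.swap)
      finally show ?thesis by (simp add: sum_pairs I_def tt_def P1_def)
    qed
    define G where "G = (\<Sum>k\<in>S. t k *\<^sub>R g k)"
    have G: "norm (1 - G) \<le> 4 * d" using \<sigma>(2) by (simp add: G_def gsum)
    then have sG: "norm (1 - star G) \<le> 4 * d" by (metis norm_star star_diff star_one)
    have fR: "Re (f x) \<ge> 1 - 4 * d" if "norm (1 - x) \<le> 4 * d" for x
    proof -
      have "1 - Re (f x) = Re (f (1 - x))" by (simp add: state_diff [OF f] state_one [OF f])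
      also have "\<dots> \<le> norm (1 - x)"
        using complex_Re_le_cmod [of "f (1 - x)"] state_norm [OF f, of "1 - x"] by linarith
      finally show ?thesis using that by linarith
    qed
    have up: "Re (f x) \<le> norm x" for x
      using complex_Re_le_cmod [of "f x"] state_norm [OF f, of x] by linarith
    define J where "J = (\<lambda>z::'a. star z * z + z * star z)"
    have "0 \<le> Re (f (J (g k - 1)))" for k unfolding J_def by (rule state_jordan_positive [OF f])
    then have "0 \<le> (\<Sum>k\<in>S. t k * Re (f (J (g k - 1))))" using S(3) by (intro sum_nonneg) auto
    also have "(\<Sum>k\<in>S. t k * Re (f (J (g k - 1))))
        = (\<Sum>k\<in>S. t k * Re (f (J (g k)))) - 2 * (\<Sum>k\<in>S. t k * Re (f (g k)))
          - 2 * (\<Sum>k\<in>S. t k * Re (f (star (g k)))) + 2 * sum t S"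
    proof -
      have "J (g k - 1) = J (g k) - 2 *\<^sub>R g k - 2 *\<^sub>R star (g k) + 2 *\<^sub>R 1" for k
        by (simp add: J_def star_diff star_one algebra_simps scaleR_2)
      then have J1: "Re (f (J (g k - 1))) = Re (f (J (g k))) - 2 * Re (f (g k)) - 2 * Re (f (star (g k))) + 2" for k
        by (simp add: state_diff [OF f] state_add [OF f] state_scaleR [OF f] state_one [OF f])
      have "(\<Sum>k\<in>S. t k * 2) = sum t S * 2" by (rule sum_distrib_right [symmetric])
      then show ?thesis
        unfolding J1 by (simp add: algebra_simps sum.distrib sum_subtractf sum_distrib_left)
    qed
    also have "(\<Sum>k\<in>S. t k * Re (f (g k))) = Re (f G)"
      by (simp add: G_def state_sum [OF f] state_scaleR [OF f])
    also have "(\<Sum>k\<in>S. t k * Re (f (star (g k)))) = Re (f (star G))"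
      by (simp add: G_def star_sum star_scaleR state_sum [OF f] state_scaleR [OF f])
    finally have low: "(\<Sum>k\<in>S. t k * Re (f (J (g k)))) \<ge> 2 - 16 * d"
      using fR [OF G] fR [OF sG] S(4) by linarith
    have "Re (f (J (g k))) \<le> 3 / 2 + \<eta>" if k: "k \<in> S" for k
    proof -
      have "g k * star (g k) = a k * (star (U k) * U k) * star (a k)"
        by (simp add: g_def star_mult star_star mult.assoc)
      then have "g k * star (g k) = a k * star (a k)" using UU [OF k] by simp
      then have "norm (g k * star (g k)) \<le> norm (a k) * norm (a k)"
        by (metis norm_mult_ineq norm_star)
      also have "\<dots> \<le> 1 * 1" using na by (intro mult_mono) auto
      finally have 1: "Re (f (g k * star (g k))) \<le> 1" using up [of "g k * star (g k)"] by linarith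
      have eq: "star (g k) * g k - c k *\<^sub>C 1 = U k * (star (a k) * a k - c k *\<^sub>C 1) * star (U k)"
        using UU [OF k]
        by (simp add: g_def star_mult star_star mult.assoc left_diff_distrib right_diff_distrib scaleC_mult_simps)
      have "norm (star (g k) * g k - c k *\<^sub>C 1)
          \<le> norm (U k) * norm (star (a k) * a k - c k *\<^sub>C 1) * norm (star (U k))"
        unfolding eq by (rule order_trans [OF norm_mult_ineq mult_right_mono [OF norm_mult_ineq norm_ge_zero]])
      then have "norm (star (g k) * g k - c k *\<^sub>C 1) \<le> \<eta>" using ac [of k] nU [OF k] by (simp add: norm_star)
      with up [of "star (g k) * g k - c k *\<^sub>C 1"] have "Re (f (star (g k) * g k - c k *\<^sub>C 1)) \<le> \<eta>" by linarith
      then have "Re (f (star (g k) * g k)) \<le> Re (c k) + \<eta>"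
        by (simp add: state_diff [OF f] state_scaleC [OF f] state_one [OF f])
      moreover have "Re (c k) < 1 / 2" using neg k by auto
      ultimately show ?thesis using 1 by (simp add: J_def state_add [OF f])
    qed
    then have "(\<Sum>k\<in>S. t k * Re (f (J (g k)))) \<le> (\<Sum>k\<in>S. t k * (3 / 2 + \<eta>))"
      using S(3) by (intro sum_mono mult_left_mono) auto
    also have "\<dots> = 3 / 2 + \<eta>" using S(4) by (simp flip: sum_distrib_right)
    finally have "2 - 16 * d \<le> 3 / 2 + \<eta>" using low by linarith
    then show False using d \<epsilon> \<eta> by linarith
  qed
  then obtain k where k: "k \<in> S" "Re (c k) \<ge> 1 / 2" by blast
  define b where "b = (\<Sum>p\<in>I. tt p *\<^sub>R (cnj (\<sigma> p) *\<^sub>C (cnj (\<sigma> (snd p, k)) *\<^sub>C V (fst p))))"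
  have "w' * (star (a k) \<otimes> 1) = (\<Sum>p\<in>I. tt p *\<^sub>R (P1 p \<otimes> (cnj (\<sigma> (snd p, k)) *\<^sub>C V (fst p))))"
    unfolding sa
    by (subst w'sum) (simp add: tensor_sum_left tensor_scaleR_left sum_product sum_pairs I_def tt_def P1_def
        tensor_mult tensor_scaleC_left tensor_scaleC_right scaleC_mult_simps scaleC_scaleR mult.commute)
  then have wb: "norm (w' * (star (a k) \<otimes> 1) - 1 \<otimes> b) \<le> \<eta>"
    using K1 [of "\<lambda>p. cnj (\<sigma> (snd p, k)) *\<^sub>C V (fst p)"] inI nU by (simp add: b_def norm_scaleC \<sigma>)
  have na1: "norm (x \<otimes> (1::'b)) = norm x" for x :: 'a by (rule norm_tensor_one)
  have "norm (c k *\<^sub>C w - a k \<otimes> b) \<le> d + \<eta> + \<eta>"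
  proof -
    have "c k *\<^sub>C w - a k \<otimes> b
        = (w - w') * ((star (a k) * a k) \<otimes> 1)
          + (w' * (star (a k) \<otimes> 1) - 1 \<otimes> b) * (a k \<otimes> 1)
          - w * ((star (a k) * a k - c k *\<^sub>C 1) \<otimes> 1)"
    proof -
      have "w' * (star (a k) \<otimes> 1) * (a k \<otimes> 1) = w' * ((star (a k) * a k) \<otimes> 1)"
        by (simp add: mult.assoc tensor_mult)
      moreover have "w * ((c k *\<^sub>C 1) \<otimes> 1) = c k *\<^sub>C w"
        by (simp add: tensor_scaleC_left scaleC_mult_simps flip: one_proj_tensor_product_def)
      ultimately show ?thesis
        by (simp add: left_diff_distrib right_diff_distrib tensor_mult tensor_diff_left)
    qed
    also have "norm \<dots> \<le> norm (w - w') * norm ((star (a k) * a k) \<otimes> (1::'b))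
          + norm (w' * (star (a k) \<otimes> 1) - 1 \<otimes> b) * norm (a k \<otimes> (1::'b))
          + norm w * norm ((star (a k) * a k - c k *\<^sub>C 1) \<otimes> (1::'b))"
      by (intro order_trans [OF norm_triangle_ineq4] order_trans [OF norm_triangle_ineq] add_mono norm_mult_ineq)
    also have "\<dots> \<le> d * 1 + \<eta> * 1 + 1 * \<eta>"
    proof (intro add_mono mult_mono)
      have "norm (star (a k) * a k) \<le> norm (a k) * norm (a k)" by (metis norm_mult_ineq norm_star)
      also have "\<dots> \<le> 1 * 1" using na by (intro mult_mono) auto
      finally show "norm ((star (a k) * a k) \<otimes> (1::'b)) \<le> 1" by (simp add: na1)
    qed (use w'(2) wb na ac w1 d \<eta> in \<open>auto simp: na1\<close>)
    finally show ?thesis by simp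
  qed
  moreover have "cmod (c k) \<ge> 1 / 2" using k(2) complex_Re_le_cmod [of "c k"] by linarith
  ultimately have "cmod (c k) * norm (w - inverse (c k) *\<^sub>C (a k \<otimes> b)) \<le> d + \<eta> + \<eta>"
  proof -
    assume *: "norm (c k *\<^sub>C w - a k \<otimes> b) \<le> d + \<eta> + \<eta>" "cmod (c k) \<ge> 1 / 2"
    then have "c k \<noteq> 0" by auto
    then have "c k *\<^sub>C (w - inverse (c k) *\<^sub>C (a k \<otimes> b)) = c k *\<^sub>C w - a k \<otimes> b"
      by (simp add: scaleC_diff_right scaleC_scaleC scaleC_one)
    then show ?thesis using *(1) by (metis norm_scaleC)
  qed
  moreover have "1 / 2 * norm (w - inverse (c k) *\<^sub>C (a k \<otimes> b)) \<le> cmod (c k) * norm (w - inverse (c k) *\<^sub>C (a k \<otimes> b))"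
    using \<open>cmod (c k) \<ge> 1 / 2\<close> by (intro mult_right_mono) auto
  ultimately have "norm (w - inverse (c k) *\<^sub>C (a k \<otimes> b)) \<le> e" using \<eta> \<epsilon> d by linarith
  then have "norm (w - (inverse (c k) *\<^sub>C a k) \<otimes> b) \<le> e" by (simp add: tensor_scaleC_left)
  then show ?thesis by blast
qed

text \<open>The elementary tensors approximating \<open>w\<close> need not have convergent factors, but the slices of
\<open>w (1 \<otimes> \<beta>)\<close> and \<open>w (\<alpha> \<otimes> 1)\<close> are limits of scalar multiples of these factors, and so
\<open>c w\<close> is an elementary tensor for a scalar \<open>c\<close>. Choosing \<open>\<alpha> \<otimes> \<beta>\<close> close to the inverse of \<open>w\<close> makes \<open>c\<close> close to 1.\<close>

lemma norm_one_unitary_is_elementary_tensor: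
  fixes w :: "('a::unital_cstar_algebra, 'b::unital_cstar_algebra) proj_tensor_product"
  assumes w: "w \<in> norm_one_unitaries"
  shows "\<exists>a b. w = a \<otimes> b"
proof -
  have w1: "star w * w = 1" "w * star w = 1" "norm w = 1" using w by (auto simp: norm_one_unitaries_def)
  have "\<exists>a b. norm (w - a \<otimes> b) \<le> 1 / real (Suc n)" for n
    by (rule norm_one_unitary_near_elementary_tensor [OF w]) simp
  then obtain A B where AB: "\<And>n. norm (w - A n \<otimes> B n) \<le> 1 / real (Suc n)" by metis
  have lim: "(\<lambda>n. A n \<otimes> B n) \<longlonglongrightarrow> w"
  proof -
    have "(\<lambda>n. A n \<otimes> B n - w) \<longlonglongrightarrow> 0"
      by (rule Lim_null_comparison [OF _ LIMSEQ_inverse_real_of_nat])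
        (use AB in \<open>simp add: norm_minus_commute inverse_eq_divide\<close>)
    then show ?thesis by (rule LIM_zero_cancel)
  qed
  define \<alpha> \<beta> where "\<alpha> = star (A 1)" and "\<beta> = star (B 1)"
  have close: "norm (1 - w * (\<alpha> \<otimes> \<beta>)) \<le> 1 / 2"
  proof -
    have "1 - w * (\<alpha> \<otimes> \<beta>) = w * star (w - A 1 \<otimes> B 1)"
      by (simp add: \<alpha>_def \<beta>_def star_diff star_tensor right_diff_distrib w1)
    then have "norm (1 - w * (\<alpha> \<otimes> \<beta>)) \<le> norm w * norm (w - A 1 \<otimes> B 1)" by (metis norm_mult_ineq norm_star)
    then show ?thesis using AB [of 1] w1 by simp
  qed
  obtain f :: "'a \<Rightarrow> complex" where f: "state f" using state_exists by blast
  obtain g :: "'b \<Rightarrow> complex" where g: "state g" using state_exists by blast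
  obtain R :: "('a, 'b) proj_tensor_product \<Rightarrow> 'a" where R: "Modules.additive R"
    "\<And>x y. R (x \<otimes> y) = g y *\<^sub>C x" "\<And>u. norm (R u) \<le> norm u"
    using right_slice [OF g] by blast
  obtain L :: "('a, 'b) proj_tensor_product \<Rightarrow> 'b" where L: "Modules.additive L"
    "\<And>x y. L (x \<otimes> y) = f x *\<^sub>C y" "\<And>u. norm (L u) \<le> norm u"
    using left_slice [OF f] by blast
  define a where "a = R (w * (1 \<otimes> \<beta>))"
  define b where "b = L (w * (\<alpha> \<otimes> 1))"
  \<comment> \<open>The product of the scalars that appear in the approximations of \<open>a\<close> and \<open>b\<close> converges to \<open>c\<close>.\<close>
  define c where "c = f (R (w * (\<alpha> \<otimes> \<beta>)))"
  have "(\<lambda>n. R ((A n \<otimes> B n) * (1 \<otimes> \<beta>))) \<longlonglongrightarrow> a"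
    unfolding a_def by (rule tendsto_additive [OF R(1,3)]) (intro tendsto_mult lim tendsto_const)
  then have la: "(\<lambda>n. g (B n * \<beta>) *\<^sub>C A n) \<longlonglongrightarrow> a" by (simp add: tensor_mult R(2))
  have "(\<lambda>n. L ((A n \<otimes> B n) * (\<alpha> \<otimes> 1))) \<longlonglongrightarrow> b"
    unfolding b_def by (rule tendsto_additive [OF L(1,3)]) (intro tendsto_mult lim tendsto_const)
  then have lb: "(\<lambda>n. f (A n * \<alpha>) *\<^sub>C B n) \<longlonglongrightarrow> b" by (simp add: tensor_mult L(2))
  have fa: "Modules.additive f" using state_add [OF f] by (simp add: Modules.additive_def)
  have "(\<lambda>n. f (R ((A n \<otimes> B n) * (\<alpha> \<otimes> \<beta>)))) \<longlonglongrightarrow> c"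
    unfolding c_def
    by (rule tendsto_additive [OF fa], simp add: state_norm [OF f], rule tendsto_additive [OF R(1,3)])
      (intro tendsto_mult lim tendsto_const)
  then have lc: "(\<lambda>n. g (B n * \<beta>) * f (A n * \<alpha>)) \<longlonglongrightarrow> c"
    by (simp add: tensor_mult R(2) state_scaleC [OF f])
  have "(\<lambda>n. (g (B n * \<beta>) *\<^sub>C A n) \<otimes> (f (A n * \<alpha>) *\<^sub>C B n)) \<longlonglongrightarrow> a \<otimes> b"
    by (rule bounded_bilinear.tendsto [OF bounded_bilinear_tensor la lb])
  then have "(\<lambda>n. (g (B n * \<beta>) * f (A n * \<alpha>)) *\<^sub>C (A n \<otimes> B n)) \<longlonglongrightarrow> a \<otimes> b"
    by (simp add: tensor_scaleC_left tensor_scaleC_right scaleC_scaleC mult.commute)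
  moreover have "(\<lambda>n. (g (B n * \<beta>) * f (A n * \<alpha>)) *\<^sub>C (A n \<otimes> B n)) \<longlonglongrightarrow> c *\<^sub>C w"
  proof -
    have "bounded_bilinear (\<lambda>c (u :: ('a, 'b) proj_tensor_product). c *\<^sub>C u)"
    proof
      show "\<exists>K. \<forall>c (u :: ('a, 'b) proj_tensor_product). norm (c *\<^sub>C u) \<le> norm c * norm u * K"
        by (rule exI [of _ 1]) (simp add: norm_scaleC)
    qed (simp_all add: scaleC_add_left scaleC_add_right scaleC_scaleR scaleR_scaleC scaleC_scaleC scaleC_complex_def mult.commute)
    then show ?thesis by (rule bounded_bilinear.tendsto) (rule lc lim)+
  qed
  ultimately have cw: "a \<otimes> b = c *\<^sub>C w" by (rule LIMSEQ_unique)
  have "c \<noteq> 0"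
  proof
    assume "c = 0"
    have "f (R 1) = 1" by (simp add: one_proj_tensor_product_def R(2) state_one [OF f] state_one [OF g] scaleC_one)
    then have "f (R (1 - w * (\<alpha> \<otimes> \<beta>))) = 1"
      using \<open>c = 0\<close> by (simp add: additive.diff [OF R(1)] state_diff [OF f] c_def)
    then have "1 \<le> norm (R (1 - w * (\<alpha> \<otimes> \<beta>)))" using state_norm [OF f] by (metis norm_one)
    then show False using R(3) [of "1 - w * (\<alpha> \<otimes> \<beta>)"] close by linarith
  qed
  then have "w = (inverse c *\<^sub>C a) \<otimes> b" by (simp add: tensor_scaleC_left cw scaleC_scaleC scaleC_one)
  then show ?thesis by blast
qed

text \<open>Slicing shows that \<open>star a * a\<close> and \<open>a * star a\<close> are scalars. They agree, and their common value
is positive by positivity of states on symmetrised products; rescaling makes both factors unitary.\<close>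

lemma elementary_unitary_factors:
  fixes a :: "'a::unital_cstar_algebra" and b :: "'b::unital_cstar_algebra"
  assumes 1: "star (a \<otimes> b) * (a \<otimes> b) = 1" and 2: "(a \<otimes> b) * star (a \<otimes> b) = 1"
  shows "\<exists>u\<in>unitaries. \<exists>v\<in>unitaries. a \<otimes> b = u \<otimes> v"
proof -
  obtain f :: "'a \<Rightarrow> complex" where f: "state f" using state_exists by blast
  obtain g :: "'b \<Rightarrow> complex" where g: "state g" using state_exists by blast
  obtain R :: "('a, 'b) proj_tensor_product \<Rightarrow> 'a" where R: "\<And>x y. R (x \<otimes> y) = g y *\<^sub>C x"
    using right_slice [OF g] by metis
  obtain L :: "('a, 'b) proj_tensor_product \<Rightarrow> 'b" where L: "\<And>x y. L (x \<otimes> y) = f x *\<^sub>C y"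
    using left_slice [OF f] by metis
  have scalar: "\<exists>r. r \<noteq> 0 \<and> x = r *\<^sub>C 1 \<and> r *\<^sub>C y = 1" if xy: "x \<otimes> y = 1 \<otimes> 1" for x :: 'a and y :: 'b
  proof -
    have gx: "g y *\<^sub>C x = 1" using arg_cong [OF xy, of R] by (simp add: R state_one [OF g] scaleC_one)
    then have "g y \<noteq> 0" by auto
    then have x: "x = inverse (g y) *\<^sub>C 1" by (simp add: scaleC_scaleC scaleC_one flip: gx)
    have "f x *\<^sub>C y = 1" using arg_cong [OF xy, of L] by (simp add: L state_one [OF f] scaleC_one)
    moreover have "f x = inverse (g y)" by (simp add: x state_scaleC [OF f] state_one [OF f])
    ultimately show ?thesis using x \<open>g y \<noteq> 0\<close> by (intro exI [of _ "inverse (g y)"]) simp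
  qed
  obtain r where r: "r \<noteq> 0" "star a * a = r *\<^sub>C 1" "r *\<^sub>C (star b * b) = 1"
    using scalar [of "star a * a" "star b * b"] 1 by (auto simp: star_tensor tensor_mult one_proj_tensor_product_def)
  obtain s where s: "s \<noteq> 0" "a * star a = s *\<^sub>C 1" "s *\<^sub>C (b * star b) = 1"
    using scalar [of "a * star a" "b * star b"] 2 by (auto simp: star_tensor tensor_mult one_proj_tensor_product_def)
  have fr: "f (star a * a) = r" "f (a * star a) = s" by (simp_all add: r s state_scaleC [OF f] state_one [OF f])
  have rs: "r = s"
  proof -
    have "r *\<^sub>C (star a * a) = star a * (a * star a) * a"
      by (metis mult.assoc mult_scaleC_left mult_1 r(2))
    also have "\<dots> = s *\<^sub>C (star a * a)" by (simp add: s(2) scaleC_mult_simps)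
    finally have "f (r *\<^sub>C (star a * a)) = f (s *\<^sub>C (star a * a))" by simp
    then show ?thesis using r(1) by (simp add: state_scaleC [OF f] fr)
  qed
  have "star (star a * a) = star a * a" by (simp add: star_mult star_star)
  then have "cnj r *\<^sub>C (1::'a) = r *\<^sub>C 1" by (simp add: r(2) star_scaleC star_one)
  then have "f (cnj r *\<^sub>C 1) = f (r *\<^sub>C 1)" by simp
  then have "cnj r = r" by (simp add: state_scaleC [OF f] state_one [OF f])
  then have real: "r = complex_of_real (Re r)" by (simp add: complex_eq_iff)
  have "0 \<le> Re (f (star a * a + a * star a))" by (rule state_jordan_positive [OF f])
  then have "0 \<le> Re r" by (simp add: state_add [OF f] fr rs)
  moreover have "Re r \<noteq> 0" using r(1) real by auto
  ultimately have pos: "Re r > 0" by simp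
  define \<rho> where "\<rho> = sqrt (Re r)"
  have \<rho>: "\<rho> > 0" "\<rho> * \<rho> = Re r" using pos by (simp_all add: \<rho>_def)
  define u where "u = (1 / \<rho>) *\<^sub>R a"
  define v where "v = \<rho> *\<^sub>R b"
  have aa: "star a * a = Re r *\<^sub>R 1" "a * star a = Re r *\<^sub>R 1"
    using r(2) s(2) rs real by (simp_all add: scaleR_scaleC)
  have bb: "Re r *\<^sub>R (star b * b) = 1" "Re r *\<^sub>R (b * star b) = 1"
    using r(3) s(3) rs real by (simp_all add: scaleR_scaleC)
  have "u \<in> unitaries" using \<rho> by (auto simp: unitaries_def u_def star_scaleR aa field_simps simp flip: \<rho>(2))
  moreover have "v \<in> unitaries" using bb by (simp add: unitaries_def v_def star_scaleR \<rho>(2))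
  moreover have "a \<otimes> b = u \<otimes> v" using \<rho> by (simp add: u_def v_def tensor_scaleR_left tensor_scaleR_right)
  ultimately show ?thesis by blast
qed

lemma tensor_of_unitaries:
  fixes a :: "'a::unital_cstar_algebra" and b :: "'b::unital_cstar_algebra"
  assumes a: "a \<in> unitaries" and b: "b \<in> unitaries" shows "a \<otimes> b \<in> norm_one_unitaries"
proof -
  have u: "star (a \<otimes> b) * (a \<otimes> b) = 1" "(a \<otimes> b) * star (a \<otimes> b) = 1"
    using a b by (simp_all add: star_tensor tensor_mult unitaries_def one_proj_tensor_product_def)
  have le: "norm (a \<otimes> b) \<le> 1" using norm_tensor_le [of a b] by (simp add: norm_unitary a b)
  have "1 \<le> norm (star (a \<otimes> b)) * norm (a \<otimes> b)"
    using norm_mult_ineq [of "star (a \<otimes> b)" "a \<otimes> b"] by (simp add: u norm_proj_one)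
  also have "\<dots> \<le> 1 * norm (a \<otimes> b)" using le by (intro mult_right_mono) (auto simp: norm_star)
  finally show ?thesis using u le by (simp add: norm_one_unitaries_def)
qed

theorem theorem2p12:
  shows "(norm_one_unitaries ::
      ('a::unital_cstar_algebra, 'b::unital_cstar_algebra) proj_tensor_product set) =
    {a \<otimes> b | a b. a \<in> (unitaries :: 'a set) \<and> b \<in> (unitaries :: 'b set)}"
proof (intro equalityI subsetI)
  fix w :: "('a, 'b) proj_tensor_product" assume w: "w \<in> norm_one_unitaries"
  obtain a b where "w = a \<otimes> b" using norm_one_unitary_is_elementary_tensor [OF w] by blast
  moreover from this have "\<exists>u\<in>unitaries. \<exists>v\<in>unitaries. a \<otimes> b = u \<otimes> v"
    using w by (intro elementary_unitary_factors) (simp_all add: norm_one_unitaries_def)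
  ultimately show "w \<in> {a \<otimes> b | a b. a \<in> (unitaries :: 'a set) \<and> b \<in> (unitaries :: 'b set)}" by blast
qed (auto intro: tensor_of_unitaries)

end
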